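(* The quantum Barnes function $G_q$ is the common factor of the partition functions of the resolved conifold $X=\mathcal{O}(-1)\oplus\mathcal{O}(-1)\to\mathbb{CP}^1$ and of the $3$-sphere, namely: (1) for $q\in\mathbb{C}\setminus(-\infty,0]$ with $|q|<1$ and $z\in\mathbb{C}$, $$(1-q)^{-\frac{z(z-1)}2}\,Z_X(q^z;q)=\big((q;q)_\infty\big)^{-z}\,G_q(z+1);$$ (2) for positive integers $k,N$, with $q=e^{2\pi i/(k+N)}$ and $z=N$, $$(1-q)^{-\frac{z(z-1)}2}\,Z_{S^3}(z;q)=i^{\frac{z(z-1)}2}\,q^{-\frac{z(z^2-1)}{12}}\,z^{-\frac12}\left(\frac{\ln q}{2\pi i}\right)^{\frac{z-1}2}G_q(z+1).$$
   Context: **Notation.** For $|q|<1$: $(a;q)_\infty:=\prod_{i\ge0}(1-aq^i)$. Powers $q^s$ are $e^{s\ln q}$ with the principal logarithm (so in (2) $\ln q=2\pi i/(k+N)$ and $q^s=e^{2\pi i s/(k+N)}$); complex powers of $1-q$ use the principal logarithm and $((q;q)_\infty)^{-z}:=\exp(-z\sum_{n\ge1}\ln(1-q^n))$ with principal logarithms. A partition is a non-increasing sequence $\lambda=(\lambda_1\ge\lambda_2\ge\dots\ge0)$ of integers with finitely many non-zero entries; $l(\lambda)$ is the number of non-zero entries, $|\lambda|=\sum\lambda_i$, $\lambda'$ is the conjugate partition, $\mathcal P$ is the set of all partitions, and $s_\lambda$ is the Schur function. **Quantum Barnes function.** For $0<q<1$ there is a unique hierarchy of meromorphic functions $G_q^{(d)}(z)$,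 $d\ge0$, with (i) $G_q^{(0)}(z)=\frac{1-q^z}{1-q}$, $G_q^{(d)}(1)=1$ for all $d\ge 0$; (ii) $G_q^{(d)}(z+1)=G_q^{(d-1)}(z)G_q^{(d)}(z)$ for $d\ge1$; (iii) $G_q^{(d)}(x)>0$ and $\frac{d^{d+1}}{dx^{d+1}}\ln G_q^{(d)}(x)\ge0$ for real $x>0$. For other $q$ with $|q|<1$, $q\notin(-\infty,0]$, they are defined by analytic continuation in $q$. $G_q:=G_q^{(2)}$ is the quantum Barnes function. For a positive integer $N$, $G_q(N+1)$ is (by (i), (ii)) a polynomial in $q$, and this defines its value at roots of unity. **Partition function of the resolved conifold.** For $|q|<1$, $q\notin(-\infty,0]$, $Z_X(a;q):=Z_X^0(q)\,Z_X'(a;q)$. Here the degree zero partition function is taken to be the MacMahon function $Z_X^0(q)=\prod_{n\ge1}(1-q^n)^{-n}$. The reduced Gromov–Witten partition function $Z_X'$ is the exponential of $\sum_{g\ge0,d\ge1}\langle1\rangle_{g,d}\,a^d x^{2g-2}$, where $\langle 1\rangle_{g,d}$ are the genus $g$ degree $d$ Gromov–Witten invariants of $X$ and $q=e^{ix}$; in the variables $(a;q)$ it is given by the topological vertex state sum $$Z_X'(a;q)=\sum_{\lambda\in\mathcal P}(-a)^{|\lambda|}\,\mathcal W_\lambda(q)\,\mathcal W_{\lambda'}(q),\qquad \mathcal W_\lambda(q)=(-1)^{|\lambda|}s_{\lambda'}(q^{1/2},q^{3/2},q^{5/2},\dots),$$ (analytically continued in $a$ if necessary), which is to be used as its definition here.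 $q$ is the usual variable of the topological vertex and $a=q^z$ is the degree variable. Equivalently, if $t$ is the Kähler parameter and $x$ the string coupling constant, $q=e^{ix}$, $q^z=e^{-t}$. **Partition function of the $3$-sphere.** Let $k$ (level) and $N$ (rank) be positive integers, $q=e^{2\pi i/(k+N)}$, $\mathcal P_{N-1}^k:=\{\lambda\in\mathcal P: l(\lambda)\le N-1,\ \lambda_1\le k\}$. Let $W_\lambda(N;q):=s_\lambda(q^{(N-1)/2},q^{(N-3)/2},\dots,q^{-(N-1)/2})$ ($N$-variable Schur polynomial). The Chern–Simons (Reshetikhin–Turaev) partition function of $S^3$ is $$Z_{S^3}(N;q):=\Big(\sum_{\lambda\in\mathcal P_{N-1}^k}W_\lambda(N;q)^2\Big)^{-1/2},$$ with the positive square root. *)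

theory Defs
  imports "HOL-Complex_Analysis.Complex_Analysis" "HOL-Library.FuncSet"
begin

section \<open>Partitions and Schur functions\<close>

text \<open>Parts, rows, columns and variables are all indexed from 0.\<close>

definition int_partitions :: "(nat \<Rightarrow> nat) set" where
  "int_partitions = {\<mu>. antimono \<mu> \<and> finite {i. \<mu> i \<noteq> 0}}"

definition part_length :: "(nat \<Rightarrow> nat) \<Rightarrow> nat" where
  "part_length \<mu> = card {i. \<mu> i \<noteq> 0}"

definition part_size :: "(nat \<Rightarrow> nat) \<Rightarrow> nat" where
  "part_size \<mu> = (\<Sum>i | \<mu> i \<noteq> 0. \<mu> i)"

definition conjugate :: "(nat \<Rightarrow> nat) \<Rightarrow> nat \<Rightarrow> nat" where
  "conjugate \<mu> = (\<lambda>j. card {i. j < \<mu> i})"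

definition young_diagram :: "(nat \<Rightarrow> nat) \<Rightarrow> (nat \<times> nat) set" where
  "young_diagram \<mu> = {(i, j). j < \<mu> i}"

definition ssyt :: "nat set \<Rightarrow> (nat \<Rightarrow> nat) \<Rightarrow> (nat \<times> nat \<Rightarrow> nat) set" where
  "ssyt I \<mu> = {T \<in> young_diagram \<mu> \<rightarrow>\<^sub>E I.
     (\<forall>i j. (i, Suc j) \<in> young_diagram \<mu> \<longrightarrow> T (i, j) \<le> T (i, Suc j)) \<and>
     (\<forall>i j. (Suc i, j) \<in> young_diagram \<mu> \<longrightarrow> T (i, j) < T (Suc i, j))}"

text \<open>The Schur function in the variables \<open>x i\<close>, \<open>i \<in> I\<close>: a Schur polynomial if \<open>I\<close> is finite,
  and an infinite (unordered) sum otherwise.\<close>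

definition schur :: "nat set \<Rightarrow> (nat \<Rightarrow> complex) \<Rightarrow> (nat \<Rightarrow> nat) \<Rightarrow> complex" where
  "schur I x \<mu> = (\<Sum>\<^sub>\<infinity>T\<in>ssyt I \<mu>. \<Prod>c\<in>young_diagram \<mu>. x (T c))"

section \<open>The quantum Barnes function\<close>

text \<open>One step of the hierarchy for \<open>0 < q < 1\<close>: \<open>f\<close> is a level \<open>d\<close> function above the
  level \<open>d - 1\<close> function \<open>g\<close>. Meromorphic functions are normalised to be 0 at their poles, so
  the functional equation, being an identity of meromorphic functions, is only required off a
  sparse set. Positivity at \<open>x > 0\<close> excludes a pole there, so the iterated derivatives are
  genuine.\<close>

definition multigamma_step ::
  "nat \<Rightarrow> (complex \<Rightarrow> complex) \<Rightarrow> (complex \<Rightarrow> complex) \<Rightarrow> bool" where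
  "multigamma_step d g f \<longleftrightarrow>
     f nicely_meromorphic_on UNIV \<and>
     f 1 = 1 \<and>
     eventually (\<lambda>z. f (z + 1) = g z * f z) (cosparse UNIV) \<and>
     (\<forall>x::real. 0 < x \<longrightarrow>
        f (of_real x) \<in> \<real> \<and> 0 < Re (f (of_real x)) \<and>
        0 \<le> (deriv ^^ (d + 1)) (\<lambda>t. ln (Re (f (of_real t)))) x)"

text \<open>The base \<open>q\<close> is meant to lie in \<open>(0, 1)\<close>. The defining conditions couple each level only
  to the one below, so the unique hierarchy is obtained level by level.\<close>

primrec quantum_multigamma :: "real \<Rightarrow> nat \<Rightarrow> complex \<Rightarrow> complex" where
  "quantum_multigamma q 0 = (\<lambda>z. (1 - of_real q powr z) / (1 - of_real q))"
| "quantum_multigamma q (Suc d) = (THE f. multigamma_step (Suc d) (quantum_multigamma q d) f)"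

definition slit_disc :: "complex set" where
  "slit_disc = ball 0 1 - \<real>\<^sub>\<le>\<^sub>0"

text \<open>For \<open>q\<close> in the slit disc, the value at \<open>q\<close> of the analytic continuation, for fixed \<open>z\<close>,
  of the function given on the interval \<open>(0, 1)\<close>. For \<open>q\<close> outside it, the definition is only
  meaningful if \<open>z - 1\<close> is a positive integer; the function on \<open>(0, 1)\<close> is then a polynomial.\<close>

definition quantum_Barnes :: "complex \<Rightarrow> complex \<Rightarrow> complex" where
  "quantum_Barnes q z =
     (if q \<in> slit_disc then
        (THE w. \<exists>h. h holomorphic_on slit_disc \<and>
                    (\<forall>x\<in>{0<..<1}. h (of_real x) = quantum_multigamma x 2 z) \<and> w = h q)
      else
        poly (THE p. \<forall>x\<in>{0<..<1}. poly p (of_real x) = quantum_multigamma x 2 z) q)"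

text \<open>The power \<open>((q;q)\<^sub>\<infinity>)\<^sup>s\<close>, with the branch fixed by principal logarithms of the factors.\<close>

definition qpoch_inf_powr :: "complex \<Rightarrow> complex \<Rightarrow> complex" where
  "qpoch_inf_powr q s = exp (s * (\<Sum>n. Ln (1 - q ^ Suc n)))"

section \<open>Partition function of the resolved conifold\<close>

definition vertex_W :: "(nat \<Rightarrow> nat) \<Rightarrow> complex \<Rightarrow> complex" where
  "vertex_W \<mu> q =
     (-1) ^ part_size \<mu> * schur UNIV (\<lambda>i. q powr (of_nat i + 1 / 2)) (conjugate \<mu>)"

definition conifold_Z0 :: "complex \<Rightarrow> complex" where
  "conifold_Z0 q = (\<Prod>n. inverse ((1 - q ^ Suc n) ^ Suc n))"

text \<open>For \<open>norm q < 1\<close> this series converges absolutely for every \<open>a\<close>, so that no analytic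
  continuation in \<open>a\<close> is needed.\<close>

definition conifold_Z_reduced :: "complex \<Rightarrow> complex \<Rightarrow> complex" where
  "conifold_Z_reduced a q =
     (\<Sum>\<^sub>\<infinity>\<mu>\<in>int_partitions. (- a) ^ part_size \<mu> * vertex_W \<mu> q * vertex_W (conjugate \<mu>) q)"

definition conifold_Z :: "complex \<Rightarrow> complex \<Rightarrow> complex" where
  "conifold_Z a q = conifold_Z0 q * conifold_Z_reduced a q"

section \<open>Partition function of the 3-sphere\<close>

definition bounded_partitions :: "nat \<Rightarrow> nat \<Rightarrow> (nat \<Rightarrow> nat) set" where
  "bounded_partitions l k = {\<mu> \<in> int_partitions. part_length \<mu> \<le> l \<and> \<mu> 0 \<le> k}"

definition quantum_W :: "nat \<Rightarrow> (nat \<Rightarrow> nat) \<Rightarrow> complex \<Rightarrow> complex" where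
  "quantum_W N \<mu> q = schur {..<N} (\<lambda>i. q powr ((of_nat N - 1) / 2 - of_nat i)) \<mu>"

text \<open>The sum of squares is a positive real number at \<open>q = exp (2 * pi * \<i> / (k + N))\<close>, so
  that its principal root is the positive one.\<close>

definition sphere_Z :: "nat \<Rightarrow> nat \<Rightarrow> complex \<Rightarrow> complex" where
  "sphere_Z k N q =
     inverse (csqrt (\<Sum>\<mu>\<in>bounded_partitions (N - 1) k. (quantum_W N \<mu> q)\<^sup>2))"

end

theory Submission
  imports "Jordan_Normal_Form.Determinant" Defs
begin

text \<open>Both sides of both identities are explicit products, so the work is to evaluate three objects.

The quantum Barnes function. For \<open>0 < q < 1\<close> the hierarchy is solved by Jackson's
\<open>q\<close>-gamma function and by
\<open>(1 - q)\<^sup>-\<^sup>(\<^sup>z\<^sup>-\<^sup>1\<^sup>)\<^sup>(\<^sup>z\<^sup>-\<^sup>2\<^sup>)\<^sup>/\<^sup>2 (q;q)\<^sub>\<infinity>\<^sup>z\<^sup>-\<^sup>1 M(q\<^sup>z\<^sup>-\<^sup>1) / M(1)\<close> with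
\<open>M(a) = \<Prod>n\<ge>1. (1 - a q\<^sup>n)\<^sup>n\<close>. The recurrences come from
\<open>M(a) = (aq;q)\<^sub>\<infinity> M(aq)\<close>. For \<open>x > 0\<close> the logarithms are polynomials in \<open>x\<close> plus or minus
power series in \<open>q\<^sup>x\<close> with non-negative coefficients; this gives the sign of the top derivative,
and also that it tends to 0 at infinity. The latter forces uniqueness
(\<open>multigamma_step_unique\<close>): the difference of the logarithms of two solutions is 1-periodic, its
top derivative is bounded below by something that tends to 0, hence is non-negative, and a periodic
function with non-negative derivative is constant. The product formula is holomorphic in \<open>q\<close> on the
connected slit disc, so it is the analytic continuation there (\<open>quantum_Barnes_slit_disc\<close>); at
\<open>z = N + 1\<close> the recurrences turn it into the polynomial
\<open>\<Prod>n<N. \<Prod>i=1..n. (1 - q\<^sup>i) / (1 - q)\<close> (\<open>quantum_Barnes_nat\<close>).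

The conifold. The vertex state sum is \<open>\<Sum>\<mu>. s\<^sub>\<mu>(-ax) s\<^sub>\<mu>\<^sub>'(x)\<close> at \<open>x\<^sub>i = q\<^sup>i\<^sup>+\<^sup>1\<^sup>/\<^sup>2\<close>, and the dual
Cauchy identity (\<open>dual_Cauchy\<close>) sums it to \<open>\<Prod>i j. (1 - a q\<^sup>i\<^sup>+\<^sup>j\<^sup>+\<^sup>1) = M(a)\<close>. The dual Cauchy
identity itself is reduced, by removing one variable at a time, to a commutation rule for adding a
horizontal and a vertical strip (\<open>strip_commutation\<close>), which can be checked row by row.

The sphere. By the bialternant formula (\<open>schur_bialternant\<close>) each \<open>W\<^sub>\<mu>\<close> is a quotient of two
alternants whose entries are roots of unity, and the denominator does not depend on \<open>\<mu>\<close>. The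
orthogonality of characters of the cyclic group of order \<open>k + N\<close> evaluates the sum of the squared
moduli of the numerators (\<open>sum_norm_alternant_partitions\<close>), so that
\<open>\<Sum>\<mu>. W\<^sub>\<mu>\<^sup>2 = N (k + N)\<^sup>N\<^sup>-\<^sup>1 / D\<^sup>2\<close> with \<open>D = \<Prod>n<N. \<Prod>i=1..n. \<bar>1 - q\<^sup>i\<bar>\<close>. Up to a power of
\<open>1 - q\<close> and the phases, \<open>D\<close> is the value of the Barnes function: each
factor satisfies \<open>\<bar>1 - q\<^sup>i\<bar> = \<i> q\<^sup>-\<^sup>i\<^sup>/\<^sup>2 (1 - q\<^sup>i)\<close>, which accounts for the powers of \<open>\<i>\<close> and \<open>q\<close> in
the second identity.\<close>

section \<open>Partitions and strips\<close>

lemma int_partitionsD: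
  assumes "\<mu> \<in> int_partitions"
  shows "i \<le> j \<Longrightarrow> \<mu> j \<le> \<mu> i" "finite {i. \<mu> i \<noteq> 0}"
  using assms by (auto simp: int_partitions_def antimono_def)

lemma int_partitions_iff:
  "\<mu> \<in> int_partitions \<longleftrightarrow> (\<forall>i. \<mu> (Suc i) \<le> \<mu> i) \<and> (\<exists>n. \<forall>i\<ge>n. \<mu> i = 0)"
proof
  assume *: "\<mu> \<in> int_partitions"
  obtain n where "\<forall>i\<in>{i. \<mu> i \<noteq> 0}. i < n"
    using int_partitionsD(2)[OF *] finite_nat_set_iff_bounded by auto
  then have "\<forall>i\<ge>n. \<mu> i = 0" by force
  with * show "(\<forall>i. \<mu> (Suc i) \<le> \<mu> i) \<and> (\<exists>n. \<forall>i\<ge>n. \<mu> i = 0)"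
    using int_partitionsD(1)[OF *] by auto
next
  assume *: "(\<forall>i. \<mu> (Suc i) \<le> \<mu> i) \<and> (\<exists>n. \<forall>i\<ge>n. \<mu> i = 0)"
  then obtain n where n: "\<forall>i\<ge>n. \<mu> i = 0" by blast
  have "{i. \<mu> i \<noteq> 0} \<subseteq> {..<n}" using n by (auto simp: not_less[symmetric])
  then have "finite {i. \<mu> i \<noteq> 0}" by (rule finite_subset) simp
  moreover have "antimono \<mu>" using * by (simp add: decseq_Suc_iff)
  ultimately show "\<mu> \<in> int_partitions" by (simp add: int_partitions_def)
qed

lemma int_partitions_bound:
  assumes "\<mu> \<in> int_partitions"
  obtains n where "\<And>i. n \<le> i \<Longrightarrow> \<mu> i = 0"
  using assms int_partitions_iff by blast

lemma zero_int_partition [simp]: "(\<lambda>_. 0) \<in> int_partitions"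
  by (simp add: int_partitions_iff)

lemma part_size_eq:
  assumes "\<And>i. n \<le> i \<Longrightarrow> \<mu> i = 0"
  shows "part_size \<mu> = (\<Sum>i<n. \<mu> i)"
  unfolding part_size_def
proof (rule sum.mono_neutral_left)
  show "{i. \<mu> i \<noteq> 0} \<subseteq> {..<n}"
    using assms by (metis (mono_tags) lessThan_iff mem_Collect_eq not_less subsetI)
qed auto

lemma young_diagram_Sigma:
  assumes "\<And>i. n \<le> i \<Longrightarrow> \<mu> i = 0"
  shows "young_diagram \<mu> = Sigma {..<n} (\<lambda>i. {..<\<mu> i})"
proof -
  have "i < n" if "j < \<mu> i" for i j
    using assms[of i] that by (cases "i < n") auto
  then show ?thesis by (auto simp: young_diagram_def)
qed

lemma finite_young_diagram [intro]: "\<mu> \<in> int_partitions \<Longrightarrow> finite (young_diagram \<mu>)"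
  using young_diagram_Sigma by (metis finite_SigmaI finite_lessThan int_partitions_bound)

lemma card_young_diagram:
  assumes "\<mu> \<in> int_partitions" shows "card (young_diagram \<mu>) = part_size \<mu>"
proof -
  obtain n where n: "\<And>i. n \<le> i \<Longrightarrow> \<mu> i = 0" using int_partitions_bound[OF assms] by metis
  show ?thesis by (simp add: young_diagram_Sigma[OF n] part_size_eq[OF n] card_SigmaI)
qed

text \<open>The rows of length greater than \<open>i\<close> form an initial segment, so their number exceeds \<open>j\<close>
exactly if row \<open>j\<close> is one of them. All facts about conjugation below follow from this Galois-type
relation.\<close>

lemma less_conjugate_iff:
  assumes "\<mu> \<in> int_partitions"
  shows "j < conjugate \<mu> i \<longleftrightarrow> i < \<mu> j"
proof -
  have fin: "finite {k. i < \<mu> k}"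
    by (rule finite_subset[OF _ int_partitionsD(2)[OF assms]]) auto
  show ?thesis
  proof
    assume "i < \<mu> j"
    then have "{..j} \<subseteq> {k. i < \<mu> k}"
      using int_partitionsD(1)[OF assms] by (auto intro: less_le_trans)
    from card_mono[OF fin this] show "j < conjugate \<mu> i" by (simp add: conjugate_def)
  next
    assume *: "j < conjugate \<mu> i"
    show "i < \<mu> j"
    proof (rule ccontr)
      assume "\<not> i < \<mu> j"
      then have "{k. i < \<mu> k} \<subseteq> {..<j}"
        using int_partitionsD(1)[OF assms] by (auto simp: not_less[symmetric]) (meson leD le_less_trans not_less)
      from card_mono[OF _ this] * show False by (simp add: conjugate_def)
    qed
  qed
qed

lemma conjugate_in [intro, simp]:
  assumes "\<mu> \<in> int_partitions" shows "conjugate \<mu> \<in> int_partitions"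
proof -
  have "conjugate \<mu> (Suc i) \<le> conjugate \<mu> i" for i
    using less_conjugate_iff[OF assms] by (metis Suc_lessD linorder_not_le order_less_irrefl)
  moreover have "conjugate \<mu> i = 0" if "\<mu> 0 \<le> i" for i
    using less_conjugate_iff[OF assms, of 0 i] that by auto
  ultimately show ?thesis by (auto simp: int_partitions_iff)
qed

lemma conjugate_conjugate [simp]:
  assumes "\<mu> \<in> int_partitions" shows "conjugate (conjugate \<mu>) = \<mu>"
proof
  fix i
  have "j < conjugate (conjugate \<mu>) i \<longleftrightarrow> j < \<mu> i" for j
    using assms by (simp add: less_conjugate_iff)
  then show "conjugate (conjugate \<mu>) i = \<mu> i" by (meson linorder_neqE_nat order_less_irrefl)
qed

lemma part_size_conjugate [simp]:
  assumes "\<mu> \<in> int_partitions" shows "part_size (conjugate \<mu>) = part_size \<mu>"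
proof -
  have "young_diagram (conjugate \<mu>) = prod.swap ` young_diagram \<mu>"
    using assms by (auto simp: young_diagram_def less_conjugate_iff image_iff)
  then have "card (young_diagram (conjugate \<mu>)) = card (young_diagram \<mu>)"
    by (simp add: card_image)
  then show ?thesis using assms by (simp add: card_young_diagram)
qed

text \<open>The skew shape \<open>\<nu>/\<mu>\<close> has at most one cell in each column; in terms of the parts, \<open>\<mu>\<close> and
\<open>\<nu>\<close> interlace.\<close>

definition hstrip :: "(nat \<Rightarrow> nat) \<Rightarrow> (nat \<Rightarrow> nat) \<Rightarrow> bool" where
  "hstrip \<mu> \<nu> \<longleftrightarrow> (\<forall>i. \<mu> i \<le> \<nu> i \<and> \<nu> (Suc i) \<le> \<mu> i)"

text \<open>The skew shape \<open>\<nu>/\<mu>\<close> has at most one cell in each row. Unlike for horizontal strips, this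
does not imply that \<open>\<mu>\<close> is a partition if \<open>\<nu>\<close> is one.\<close>

definition vstrip :: "(nat \<Rightarrow> nat) \<Rightarrow> (nat \<Rightarrow> nat) \<Rightarrow> bool" where
  "vstrip \<mu> \<nu> \<longleftrightarrow> (\<forall>i. \<mu> i \<le> \<nu> i \<and> \<nu> i \<le> Suc (\<mu> i))"

lemma hstrip_conjugate_iff:
  assumes \<mu>: "\<mu> \<in> int_partitions" and \<nu>: "\<nu> \<in> int_partitions"
  shows "hstrip (conjugate \<mu>) (conjugate \<nu>) \<longleftrightarrow> vstrip \<mu> \<nu>"
proof -
  have le1: "(a \<le> b) \<longleftrightarrow> (\<forall>i. i < a \<longrightarrow> i < b)" for a b :: nat
    by (metis leI less_irrefl less_le_trans)
  have le2: "(a \<le> Suc b) \<longleftrightarrow> (\<forall>i. Suc i < a \<longrightarrow> i < b)" for a b :: nat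
    by (metis Suc_less_SucD leI less_irrefl less_le_trans)
  have le: "conjugate \<alpha> i \<le> conjugate \<beta> k \<longleftrightarrow> (\<forall>j. i < \<alpha> j \<longrightarrow> k < \<beta> j)"
    if "\<alpha> \<in> int_partitions" "\<beta> \<in> int_partitions" for \<alpha> \<beta> i k
    by (simp only: le1[of "conjugate \<alpha> i"] less_conjugate_iff[OF that(1)] less_conjugate_iff[OF that(2)])
  have "hstrip (conjugate \<mu>) (conjugate \<nu>) \<longleftrightarrow>
      (\<forall>i. \<forall>j. i < \<mu> j \<longrightarrow> i < \<nu> j) \<and> (\<forall>i. \<forall>j. Suc i < \<nu> j \<longrightarrow> i < \<mu> j)"
    unfolding hstrip_def le[OF \<mu> \<nu>] le[OF \<nu> \<mu>] by auto
  also have "(\<forall>i. \<forall>j. i < \<mu> j \<longrightarrow> i < \<nu> j) \<longleftrightarrow> (\<forall>j. \<mu> j \<le> \<nu> j)"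
    by (subst all_comm) (simp only: le1)
  also have "(\<forall>i. \<forall>j. Suc i < \<nu> j \<longrightarrow> i < \<mu> j) \<longleftrightarrow> (\<forall>j. \<nu> j \<le> Suc (\<mu> j))"
    by (subst all_comm) (simp only: le2)
  finally show ?thesis by (auto simp: vstrip_def)
qed

lemma hstrip_in:
  assumes "hstrip \<mu> \<nu>" "\<nu> \<in> int_partitions" shows "\<mu> \<in> int_partitions"
proof -
  obtain n where n: "\<And>i. n \<le> i \<Longrightarrow> \<nu> i = 0" using int_partitions_bound[OF assms(2)] by metis
  have "\<mu> (Suc i) \<le> \<mu> i" for i
    using assms(1) by (meson hstrip_def order_trans)
  moreover have "\<forall>i\<ge>n. \<mu> i = 0" using assms(1) n by (metis hstrip_def le_zero_eq)
  ultimately show ?thesis by (auto simp: int_partitions_iff)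
qed

section \<open>The branching rule for Schur functions\<close>

lemma finite_ssyt [intro]: "\<mu> \<in> int_partitions \<Longrightarrow> finite I \<Longrightarrow> finite (ssyt I \<mu>)"
  unfolding ssyt_def by (rule finite_subset[of _ "young_diagram \<mu> \<rightarrow>\<^sub>E I"])
    (auto intro: finite_PiE)

lemma schur_finite:
  assumes "\<mu> \<in> int_partitions" "finite I"
  shows "schur I x \<mu> = (\<Sum>T\<in>ssyt I \<mu>. \<Prod>c\<in>young_diagram \<mu>. x (T c))"
  unfolding schur_def using finite_ssyt[OF assms] by simp

lemma ssyt_row_le:
  assumes "\<mu> \<in> int_partitions" "T \<in> ssyt I \<mu>" "(i, j) \<in> young_diagram \<mu>" "j' \<le> j"
  shows "T (i, j') \<le> T (i, j)"
proof -
  have "j < \<mu> i \<Longrightarrow> T (i, j') \<le> T (i, j)"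
    using assms(4)
  proof (induction j rule: dec_induct)
    case (step n)
    then show ?case using assms(2) by (auto simp: ssyt_def young_diagram_def intro: order_trans)
  qed simp
  then show ?thesis using assms(3) by (simp add: young_diagram_def)
qed

text \<open>Columns increase strictly, starting from an entry that is at least 0.\<close>

lemma ssyt_row_index_le:
  assumes "\<mu> \<in> int_partitions" "T \<in> ssyt I \<mu>" "(i, j) \<in> young_diagram \<mu>"
  shows "i \<le> T (i, j)"
  using assms(3)
proof (induction i)
  case (Suc i)
  have "\<mu> (Suc i) \<le> \<mu> i" using int_partitionsD(1)[OF assms(1)] by simp
  then have "(i, j) \<in> young_diagram \<mu>" using Suc.prems by (auto simp: young_diagram_def)
  moreover have "T (i, j) < T (Suc i, j)"
    using Suc.prems assms(2) by (auto simp: ssyt_def)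
  ultimately show ?case using Suc.IH by simp
qed simp

lemma schur_eq_0:
  assumes "\<mu> \<in> int_partitions" "\<mu> n \<noteq> 0"
  shows "schur {..<n} x \<mu> = 0"
proof -
  have "ssyt {..<n} \<mu> = {}"
  proof (rule ccontr)
    assume "ssyt {..<n} \<mu> \<noteq> {}"
    then obtain T where T: "T \<in> ssyt {..<n} \<mu>" by blast
    have "(n, 0) \<in> young_diagram \<mu>" using assms by (simp add: young_diagram_def)
    then have "n \<le> T (n, 0)" "T (n, 0) \<in> {..<n}"
      using ssyt_row_index_le[OF assms(1) T] T by (auto simp: ssyt_def)
    then show False by simp
  qed
  then show ?thesis by (simp add: schur_def)
qed

lemma young_diagram_zero [simp]: "young_diagram (\<lambda>_. 0) = {}"
  by (simp add: young_diagram_def)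

lemma part_size_zero [simp]: "part_size (\<lambda>_. 0) = 0"
  by (simp add: part_size_def)

lemma conjugate_zero [simp]: "conjugate (\<lambda>_. 0) = (\<lambda>_. 0)"
  by (simp add: conjugate_def)

lemma schur_zero [simp]: "schur I x (\<lambda>_. 0) = 1"
proof -
  have "ssyt I (\<lambda>_. 0) = {\<lambda>_. undefined}"
    by (auto simp: ssyt_def)
  then show ?thesis by (simp add: schur_def)
qed

lemma schur_empty:
  assumes "\<mu> \<in> int_partitions"
  shows "schur {..<0} x \<mu> = (if \<mu> = (\<lambda>_. 0) then 1 else 0)"
proof (cases "\<mu> 0 = 0")
  case True
  then have "\<mu> = (\<lambda>_. 0)" using int_partitionsD(1)[OF assms, of 0] by auto
  then show ?thesis using schur_zero by simp
next
  case False
  then show ?thesis using schur_eq_0[OF assms, of 0] by auto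
qed

lemma finite_hstrips:
  assumes "\<nu> \<in> int_partitions"
  shows "finite {\<mu>. hstrip \<mu> \<nu>}"
proof -
  obtain n where n: "\<And>i. n \<le> i \<Longrightarrow> \<nu> i = 0" using int_partitions_bound[OF assms] by metis
  let ?F = "{\<mu>. \<forall>i. (i \<in> {..<n} \<longrightarrow> \<mu> i \<in> {..\<nu> 0}) \<and> (i \<notin> {..<n} \<longrightarrow> \<mu> i = 0)}"
  have "finite ?F" by (rule finite_set_of_finite_funs) auto
  moreover have "{\<mu>. hstrip \<mu> \<nu>} \<subseteq> ?F"
    using n int_partitionsD(1)[OF assms, of 0]
    by (auto simp: hstrip_def not_less) (meson le_trans, metis le_zero_eq)
  ultimately show ?thesis by (rule rev_finite_subset)
qed

text \<open>In a tableau with entries at most \<open>n\<close>, the cells with entries below \<open>n\<close> form a smaller Young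
diagram, and the cells with entry \<open>n\<close> form a horizontal strip because columns increase strictly.
Conversely such a strip can be filled with \<open>n\<close> in only one way.\<close>

lemma schur_branching:
  assumes \<nu>: "\<nu> \<in> int_partitions"
  shows "schur {..<Suc n} x \<nu> =
    (\<Sum>\<mu> | hstrip \<mu> \<nu>. x n ^ (part_size \<nu> - part_size \<mu>) * schur {..<n} x \<mu>)"
proof -
  define shape where "shape T = (\<lambda>i. card {j. j < \<nu> i \<and> T (i, j) < n})" for T :: "nat \<times> nat \<Rightarrow> nat"
  define extend where "extend \<mu> T = (\<lambda>c. if c \<in> young_diagram \<mu> then T c else if c \<in> young_diagram \<nu> then n else undefined)"
    for \<mu> and T :: "nat \<times> nat \<Rightarrow> nat"
  have less_shape: "j < shape T i \<longleftrightarrow> j < \<nu> i \<and> T (i, j) < n" if T: "T \<in> ssyt {..<Suc n} \<nu>" for T i j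
  proof -
    define A where "A = {j. j < \<nu> i \<and> T (i, j) < n}"
    have fin: "finite A" by (simp add: A_def)
    have down: "j' \<in> A" if "j \<in> A" "j' \<le> j" for j j'
      using that ssyt_row_le[OF \<nu> T, of i j j'] by (auto simp: A_def young_diagram_def)
    have "j < card A \<longleftrightarrow> j \<in> A"
    proof
      assume "j \<in> A"
      then have "{..j} \<subseteq> A" using down by auto
      from card_mono[OF fin this] show "j < card A" by simp
    next
      assume *: "j < card A"
      show "j \<in> A"
      proof (rule ccontr)
        assume "j \<notin> A"
        then have "A \<subseteq> {..<j}" using down by (meson lessThan_iff not_less subsetI)
        from card_mono[OF _ this] * show False by simp
      qed
    qed
    then show ?thesis by (simp add: shape_def A_def)
  qed
  have in_shape: "c \<in> young_diagram (shape T) \<longleftrightarrow> c \<in> young_diagram \<nu> \<and> T c < n"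
    if "T \<in> ssyt {..<Suc n} \<nu>" for T c
    using less_shape[OF that] by (cases c) (auto simp: young_diagram_def)
  have shape_hstrip: "hstrip (shape T) \<nu>" if T: "T \<in> ssyt {..<Suc n} \<nu>" for T
    unfolding hstrip_def
  proof (intro allI conjI)
    fix i
    show "shape T i \<le> \<nu> i" using less_shape[OF T] by (meson leI order_less_irrefl)
    show "\<nu> (Suc i) \<le> shape T i"
    proof (rule ccontr)
      assume "\<not> \<nu> (Suc i) \<le> shape T i"
      then have j: "(Suc i, shape T i) \<in> young_diagram \<nu>" by (simp add: young_diagram_def)
      have "\<nu> (Suc i) \<le> \<nu> i" using int_partitionsD(1)[OF \<nu>] by simp
      then have "shape T i < \<nu> i" using j by (simp add: young_diagram_def)
      moreover have "T (i, shape T i) < T (Suc i, shape T i)" "T (Suc i, shape T i) < Suc n"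
        using j T by (auto simp: ssyt_def)
      ultimately show False using less_shape[OF T, of "shape T i" i] by simp
    qed
  qed
  have sub: "young_diagram \<mu> \<subseteq> young_diagram \<nu>" if "hstrip \<mu> \<nu>" for \<mu>
    using that by (auto simp: young_diagram_def hstrip_def intro: less_le_trans)
  have extend_ssyt: "extend \<mu> T \<in> ssyt {..<Suc n} \<nu>" if h: "hstrip \<mu> \<nu>" and T: "T \<in> ssyt {..<n} \<mu>" for \<mu> T
  proof -
    have Tn: "T c < n" if "c \<in> young_diagram \<mu>" for c using T that by (auto simp: ssyt_def)
    have 1: "extend \<mu> T \<in> young_diagram \<nu> \<rightarrow>\<^sub>E {..<Suc n}"
      using Tn sub[OF h] by (auto simp: extend_def less_Suc_eq)
    have 2: "extend \<mu> T (i, j) \<le> extend \<mu> T (i, Suc j)" if "(i, Suc j) \<in> young_diagram \<nu>" for i j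
    proof (cases "(i, Suc j) \<in> young_diagram \<mu>")
      case True
      then have "(i, j) \<in> young_diagram \<mu>" by (auto simp: young_diagram_def)
      then show ?thesis using True T by (auto simp: extend_def ssyt_def)
    next
      case False
      moreover have "(i, j) \<in> young_diagram \<nu>" using that by (auto simp: young_diagram_def)
      ultimately show ?thesis using that by (auto simp: extend_def dest: Tn)
    qed
    have 3: "extend \<mu> T (i, j) < extend \<mu> T (Suc i, j)" if "(Suc i, j) \<in> young_diagram \<nu>" for i j
    proof -
      have ij: "(i, j) \<in> young_diagram \<mu>" using that h by (auto simp: young_diagram_def hstrip_def intro: less_le_trans)
      show ?thesis
      proof (cases "(Suc i, j) \<in> young_diagram \<mu>")
        case True
        then show ?thesis using ij T by (auto simp: extend_def ssyt_def)
      next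
        case False
        then show ?thesis using ij that by (auto simp: extend_def dest: Tn)
      qed
    qed
    show ?thesis unfolding ssyt_def using 1 2 3 by blast
  qed
  have restrict_ssyt: "restrict T (young_diagram (shape T)) \<in> ssyt {..<n} (shape T)"
    if T: "T \<in> ssyt {..<Suc n} \<nu>" for T
    using T in_shape[OF T] hstrip_in[OF shape_hstrip[OF T] \<nu>]
    by (auto simp: ssyt_def restrict_def PiE_def extensional_def)
       (metis in_shape[OF T] less_imp_le_nat less_le_trans young_diagram_def case_prodI case_prodD int_partitionsD(1) lessI mem_Collect_eq)+
  let ?P = "{\<mu>. hstrip \<mu> \<nu>}"
  let ?S = "Sigma ?P (\<lambda>\<mu>. ssyt {..<n} \<mu>)"
  have "schur {..<Suc n} x \<nu> = (\<Sum>T\<in>ssyt {..<Suc n} \<nu>. \<Prod>c\<in>young_diagram \<nu>. x (T c))"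
    by (rule schur_finite[OF \<nu>]) simp
  also have "\<dots> = (\<Sum>(\<mu>, T)\<in>?S. \<Prod>c\<in>young_diagram \<nu>. x (extend \<mu> T c))"
  proof (rule sum.reindex_bij_witness[of _ "\<lambda>(\<mu>, T). extend \<mu> T" "\<lambda>T. (shape T, restrict T (young_diagram (shape T)))"])
    fix T assume T: "T \<in> ssyt {..<Suc n} \<nu>"
    have "extend (shape T) (restrict T (young_diagram (shape T))) c = T c" for c
      using in_shape[OF T, of c] T
      by (cases c) (auto simp: extend_def ssyt_def PiE_def extensional_def less_Suc_eq Pi_iff)
    then have e: "extend (shape T) (restrict T (young_diagram (shape T))) = T" by blast
    then show "(case (shape T, restrict T (young_diagram (shape T))) of (\<mu>, T) \<Rightarrow> extend \<mu> T) = T" by simp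
    show "(shape T, restrict T (young_diagram (shape T))) \<in> ?S"
      using shape_hstrip[OF T] restrict_ssyt[OF T] by simp
    show "(case (shape T, restrict T (young_diagram (shape T))) of (\<mu>, T) \<Rightarrow> \<Prod>c\<in>young_diagram \<nu>. x (extend \<mu> T c)) = (\<Prod>c\<in>young_diagram \<nu>. x (T c))"
      using e by simp
  next
    fix p assume "p \<in> ?S"
    then obtain \<mu> T where p: "p = (\<mu>, T)" and h: "hstrip \<mu> \<nu>" and T: "T \<in> ssyt {..<n} \<mu>" by blast
    let ?E = "extend \<mu> T"
    have Tn: "T c < n" if "c \<in> young_diagram \<mu>" for c using T that by (auto simp: ssyt_def)
    have E: "?E \<in> ssyt {..<Suc n} \<nu>" by (rule extend_ssyt[OF h T])
    have yd: "c \<in> young_diagram (shape ?E) \<longleftrightarrow> c \<in> young_diagram \<mu>" for c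
      using in_shape[OF E, of c] sub[OF h] Tn by (auto simp: extend_def)
    have "shape ?E = \<mu>"
    proof
      fix i
      have "j < shape ?E i \<longleftrightarrow> j < \<mu> i" for j using yd[of "(i, j)"] by (simp add: young_diagram_def)
      then show "shape ?E i = \<mu> i" by (meson linorder_neqE_nat order_less_irrefl)
    qed
    moreover have "restrict ?E (young_diagram \<mu>) = T"
      using T by (auto simp: extend_def ssyt_def restrict_def PiE_def extensional_def)
    ultimately show "(\<lambda>T. (shape T, restrict T (young_diagram (shape T)))) (case p of (\<mu>, T) \<Rightarrow> extend \<mu> T) = p"
      by (simp add: p)
    show "(case p of (\<mu>, T) \<Rightarrow> extend \<mu> T) \<in> ssyt {..<Suc n} \<nu>" using E by (simp add: p)
  qed
  also have "\<dots> = (\<Sum>(\<mu>, T)\<in>?S. x n ^ (part_size \<nu> - part_size \<mu>) * (\<Prod>c\<in>young_diagram \<mu>. x (T c)))"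
  proof (rule sum.cong[OF refl], clarify)
    fix \<mu> T assume h: "hstrip \<mu> \<nu>" and T: "T \<in> ssyt {..<n} \<mu>"
    note \<mu> = hstrip_in[OF h \<nu>]
    have "(\<Prod>c\<in>young_diagram \<nu>. x (extend \<mu> T c)) =
        (\<Prod>c\<in>young_diagram \<nu> - young_diagram \<mu>. x (extend \<mu> T c)) * (\<Prod>c\<in>young_diagram \<mu>. x (extend \<mu> T c))"
      by (rule prod.subset_diff[OF sub[OF h] finite_young_diagram[OF \<nu>]])
    also have "(\<Prod>c\<in>young_diagram \<nu> - young_diagram \<mu>. x (extend \<mu> T c)) = x n ^ card (young_diagram \<nu> - young_diagram \<mu>)"
      by (simp add: extend_def)
    also have "card (young_diagram \<nu> - young_diagram \<mu>) = part_size \<nu> - part_size \<mu>"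
      using card_Diff_subset[OF finite_young_diagram[OF \<mu>] sub[OF h]] by (simp add: card_young_diagram \<mu> \<nu>)
    also have "(\<Prod>c\<in>young_diagram \<mu>. x (extend \<mu> T c)) = (\<Prod>c\<in>young_diagram \<mu>. x (T c))"
      by (rule prod.cong) (auto simp: extend_def)
    finally show "(\<Prod>c\<in>young_diagram \<nu>. x (extend \<mu> T c)) =
        x n ^ (part_size \<nu> - part_size \<mu>) * (\<Prod>c\<in>young_diagram \<mu>. x (T c))" .
  qed
  also have "\<dots> = (\<Sum>\<mu>\<in>?P. \<Sum>T\<in>ssyt {..<n} \<mu>. x n ^ (part_size \<nu> - part_size \<mu>) * (\<Prod>c\<in>young_diagram \<mu>. x (T c)))"
    by (rule sum.Sigma[symmetric]) (use finite_hstrips[OF \<nu>] hstrip_in[OF _ \<nu>] in auto)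
  also have "\<dots> = (\<Sum>\<mu> | hstrip \<mu> \<nu>. x n ^ (part_size \<nu> - part_size \<mu>) * schur {..<n} x \<mu>)"
    by (rule sum.cong[OF refl]) (use hstrip_in[OF _ \<nu>] in \<open>simp add: schur_finite sum_distrib_left\<close>)
  finally show ?thesis .
qed

section \<open>The dual Cauchy identity\<close>

text \<open>Distributivity, for sequences that vanish from \<open>n\<close> on instead of restricted functions: shapes
between given bounds are of this form.\<close>

lemma sum_prod_rows:
  fixes f :: "nat \<Rightarrow> nat \<Rightarrow> 'a :: comm_semiring_1"
  assumes "\<And>i. i < n \<Longrightarrow> finite (A i)"
  shows "(\<Sum>v | (\<forall>i<n. v i \<in> A i) \<and> (\<forall>i\<ge>n. v i = 0). \<Prod>i<n. f i (v i)) = (\<Prod>i<n. \<Sum>k\<in>A i. f i k)"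
proof -
  have "(\<Prod>i<n. \<Sum>k\<in>A i. f i k) = (\<Sum>v\<in>PiE {..<n} A. \<Prod>i<n. f i (v i))"
    by (rule prod_sum_PiE) (use assms in auto)
  also have "\<dots> = (\<Sum>v | (\<forall>i<n. v i \<in> A i) \<and> (\<forall>i\<ge>n. v i = 0). \<Prod>i<n. f i (v i))"
    by (rule sum.reindex_bij_witness[of _ "\<lambda>v. restrict v {..<n}" "\<lambda>v i. if i < n then v i else 0"])
       (auto simp: PiE_def extensional_def restrict_def fun_eq_iff Pi_iff intro!: prod.cong)
  finally show ?thesis by simp
qed

text \<open>Given \<open>\<alpha>\<close> and \<open>\<beta>\<close>, both conditions on \<open>\<nu>\<close> bound each part of \<open>\<nu>\<close> separately, by parts of \<open>\<alpha>\<close>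
and \<open>\<beta>\<close>; likewise for \<open>\<mu>\<close>. So both sums factor over the rows. The factors of row \<open>i\<close> on the two
sides differ only by a ratio \<open>D i / D (Suc i)\<close>, and these ratios telescope.\<close>

lemma strip_commutation:
  fixes x y :: "'a :: comm_semiring_1"
  assumes \<alpha>: "\<alpha> \<in> int_partitions" and \<beta>: "\<beta> \<in> int_partitions"
  shows "(\<Sum>\<nu> | \<nu> \<in> int_partitions \<and> hstrip \<alpha> \<nu> \<and> vstrip \<beta> \<nu>.
            x ^ (part_size \<nu> - part_size \<alpha>) * y ^ (part_size \<nu> - part_size \<beta>)) =
         (1 + x * y) *
         (\<Sum>\<mu> | hstrip \<mu> \<beta> \<and> vstrip \<mu> \<alpha>.
            x ^ (part_size \<beta> - part_size \<mu>) * y ^ (part_size \<alpha> - part_size \<mu>))"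
    (is "?lhs = _ * ?rhs")
proof -
  obtain a where a: "\<And>i. a \<le> i \<Longrightarrow> \<alpha> i = 0" using int_partitions_bound[OF \<alpha>] by metis
  obtain b where b: "\<And>i. b \<le> i \<Longrightarrow> \<beta> i = 0" using int_partitions_bound[OF \<beta>] by metis
  define n where "n = Suc (max a b)"
  have \<alpha>0: "\<alpha> i = 0" if "n \<le> Suc i" for i using that a by (simp add: n_def)
  have \<beta>0: "\<beta> i = 0" if "n \<le> Suc i" for i using that b by (simp add: n_def)
  define V where "V i = {k. \<beta> i \<le> k \<and> k \<le> Suc (\<beta> i) \<and> \<alpha> i \<le> k \<and> (0 < i \<longrightarrow> k \<le> \<alpha> (i - 1))}" for i
  define U where "U i = {k. k \<le> \<alpha> i \<and> \<alpha> i \<le> Suc k \<and> k \<le> \<beta> i \<and> \<beta> (Suc i) \<le> k}" for i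
  define L where "L i = (\<Sum>k\<in>V i. x ^ (k - \<alpha> i) * y ^ (k - \<beta> i))" for i
  define R where "R i = (\<Sum>k\<in>U i. x ^ (\<beta> i - k) * y ^ (\<alpha> i - k))" for i
  \<comment> \<open>chosen so that the products over the rows before \<open>i\<close> are in the ratio \<open>1 + x * y : D i\<close>\<close>
  define D where "D i = (if i = 0 \<or> \<beta> i < \<alpha> (i - 1) then 1 + x * y else if \<beta> i = \<alpha> (i - 1) then 1 else 0)" for i
  have finV: "finite (V i)" for i by (rule finite_subset[of _ "{..Suc (\<beta> i)}"]) (auto simp: V_def)
  have finU: "finite (U i)" for i by (rule finite_subset[of _ "{..\<alpha> i}"]) (auto simp: U_def)
  have size: "part_size \<nu> - part_size \<mu> = (\<Sum>i<n. \<nu> i - \<mu> i)"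
    if "\<And>i. \<mu> i \<le> \<nu> i" "\<forall>i\<ge>n. \<nu> i = 0" for \<mu> \<nu>
  proof -
    have "\<And>i. n \<le> i \<Longrightarrow> \<nu> i = 0" "\<And>i. n \<le> i \<Longrightarrow> \<mu> i = 0" using that by (auto, metis le_zero_eq)
    then show ?thesis
      using that by (simp add: part_size_eq[of n] sum_subtractf_nat)
  qed
  have \<alpha>n: "\<forall>i\<ge>n. \<alpha> i = 0" and \<beta>n: "\<forall>i\<ge>n. \<beta> i = 0" using \<alpha>0 \<beta>0 by auto
  have setV: "{\<nu>. \<nu> \<in> int_partitions \<and> hstrip \<alpha> \<nu> \<and> vstrip \<beta> \<nu>} = {\<nu>. (\<forall>i<n. \<nu> i \<in> V i) \<and> (\<forall>i\<ge>n. \<nu> i = 0)}"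
    (is "?A = ?B")
  proof (intro equalityI subsetI)
    fix \<nu> assume "\<nu> \<in> ?A"
    then have h: "hstrip \<alpha> \<nu>" and v: "vstrip \<beta> \<nu>" by auto
    have "\<nu> i \<in> V i" for i
      using h v by (cases i) (auto simp: V_def hstrip_def vstrip_def)
    moreover have "\<nu> i = 0" if "n \<le> i" for i
    proof -
      have "\<nu> (Suc (i - 1)) \<le> \<alpha> (i - 1)" using h by (simp add: hstrip_def)
      moreover have "Suc (i - 1) = i" using that by (simp add: n_def)
      ultimately show ?thesis using \<alpha>0[of "i - 1"] that by simp
    qed
    ultimately show "\<nu> \<in> ?B" by simp
  next
    fix \<nu> assume \<nu>: "\<nu> \<in> ?B"
    have *: "\<alpha> i \<le> \<nu> i" "\<beta> i \<le> \<nu> i" "\<nu> i \<le> Suc (\<beta> i)" for i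
      using \<nu> \<alpha>n \<beta>n by (cases "i < n"; auto simp: V_def)+
    have **: "\<nu> (Suc i) \<le> \<alpha> i" for i
    proof (cases "Suc i < n")
      case True
      then have "\<nu> (Suc i) \<in> V (Suc i)" using \<nu> by blast
      then show ?thesis by (simp add: V_def)
    next
      case False
      then show ?thesis using \<nu> by simp
    qed
    have "\<nu> (Suc i) \<le> \<nu> i" for i using *(1)[of i] **[of i] by simp
    then have "\<nu> \<in> int_partitions" using \<nu> by (auto simp: int_partitions_iff)
    then show "\<nu> \<in> ?A" using * ** by (simp add: hstrip_def vstrip_def)
  qed
  have setU: "{\<mu>. hstrip \<mu> \<beta> \<and> vstrip \<mu> \<alpha>} = {\<mu>. (\<forall>i<n. \<mu> i \<in> U i) \<and> (\<forall>i\<ge>n. \<mu> i = 0)}"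
    (is "?A = ?B")
  proof (intro equalityI subsetI)
    fix \<mu> assume "\<mu> \<in> ?A"
    then have h: "hstrip \<mu> \<beta>" and v: "vstrip \<mu> \<alpha>" by auto
    have "\<mu> i \<in> U i" for i
      using h v by (auto simp: U_def hstrip_def vstrip_def)
    moreover have "\<mu> i = 0" if "n \<le> i" for i
      using h \<beta>n that by (metis hstrip_def le_zero_eq)
    ultimately show "\<mu> \<in> ?B" by simp
  next
    fix \<mu> assume \<mu>: "\<mu> \<in> ?B"
    have "\<mu> i \<le> \<alpha> i \<and> \<alpha> i \<le> Suc (\<mu> i) \<and> \<mu> i \<le> \<beta> i \<and> \<beta> (Suc i) \<le> \<mu> i" for i
      using \<mu> \<alpha>n \<beta>n by (cases "i < n") (auto simp: U_def)
    then show "\<mu> \<in> ?A" by (simp add: hstrip_def vstrip_def)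
  qed
  have "?lhs =
        (\<Sum>\<nu> | (\<forall>i<n. \<nu> i \<in> V i) \<and> (\<forall>i\<ge>n. \<nu> i = 0). \<Prod>i<n. x ^ (\<nu> i - \<alpha> i) * y ^ (\<nu> i - \<beta> i))"
  proof (rule sum.cong[OF setV])
    fix \<nu> assume "\<nu> \<in> {\<nu>. (\<forall>i<n. \<nu> i \<in> V i) \<and> (\<forall>i\<ge>n. \<nu> i = 0)}"
    then have "\<nu> \<in> {\<nu>. \<nu> \<in> int_partitions \<and> hstrip \<alpha> \<nu> \<and> vstrip \<beta> \<nu>}" and z: "\<forall>i\<ge>n. \<nu> i = 0"
      using setV by (blast, simp)
    then have "\<And>i. \<alpha> i \<le> \<nu> i" "\<And>i. \<beta> i \<le> \<nu> i"
      by (auto simp: hstrip_def vstrip_def)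
    with z show "x ^ (part_size \<nu> - part_size \<alpha>) * y ^ (part_size \<nu> - part_size \<beta>) =
        (\<Prod>i<n. x ^ (\<nu> i - \<alpha> i) * y ^ (\<nu> i - \<beta> i))"
      by (simp add: size power_sum prod.distrib)
  qed
  also have "\<dots> = (\<Prod>i<n. L i)"
    unfolding L_def by (rule sum_prod_rows) (rule finV)
  finally have left: "?lhs = (\<Prod>i<n. L i)" .
  have "?rhs =
        (\<Sum>\<mu> | (\<forall>i<n. \<mu> i \<in> U i) \<and> (\<forall>i\<ge>n. \<mu> i = 0). \<Prod>i<n. x ^ (\<beta> i - \<mu> i) * y ^ (\<alpha> i - \<mu> i))"
  proof (rule sum.cong[OF setU])
    fix \<mu> assume "\<mu> \<in> {\<mu>. (\<forall>i<n. \<mu> i \<in> U i) \<and> (\<forall>i\<ge>n. \<mu> i = 0)}"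
    then have "\<And>i. \<mu> i \<le> \<alpha> i" "\<And>i. \<mu> i \<le> \<beta> i"
      unfolding setU[symmetric] by (auto simp: hstrip_def vstrip_def)
    then show "x ^ (part_size \<beta> - part_size \<mu>) * y ^ (part_size \<alpha> - part_size \<mu>) =
        (\<Prod>i<n. x ^ (\<beta> i - \<mu> i) * y ^ (\<alpha> i - \<mu> i))"
      using \<alpha>n \<beta>n by (simp add: size power_sum prod.distrib)
  qed
  also have "\<dots> = (\<Prod>i<n. R i)"
    unfolding R_def by (rule sum_prod_rows) (rule finU)
  finally have right: "?rhs = (\<Prod>i<n. R i)" .
  \<comment> \<open>both sides equal \<open>0\<close>, \<open>y (1 + x y)\<close>, or \<open>x ^ (\<beta> i - \<alpha> i) * D i * D (Suc i)\<close>\<close>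
  have row: "L i * D (Suc i) = R i * D i" for i
  proof -
    have dec\<alpha>: "0 < i \<Longrightarrow> \<alpha> i \<le> \<alpha> (i - 1)" and dec\<beta>: "\<beta> (Suc i) \<le> \<beta> i"
      using int_partitionsD(1)[OF \<alpha>, of "i - 1" i] int_partitionsD(1)[OF \<beta>, of i "Suc i"] by auto
    have V: "V i = (if \<alpha> i \<le> \<beta> i \<and> (i = 0 \<or> \<beta> i \<le> \<alpha> (i - 1)) then {\<beta> i} else {}) \<union>
        (if \<alpha> i \<le> Suc (\<beta> i) \<and> (i = 0 \<or> \<beta> i < \<alpha> (i - 1)) then {Suc (\<beta> i)} else {})"
      by (auto simp: V_def le_Suc_eq)
    have U: "U i = (if \<alpha> i \<le> \<beta> i \<and> \<beta> (Suc i) \<le> \<alpha> i then {\<alpha> i} else {}) \<union>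
        (if \<alpha> i \<le> Suc (\<beta> i) \<and> \<beta> (Suc i) < \<alpha> i then {\<alpha> i - 1} else {})"
      by (auto simp: U_def)
    consider "Suc (\<beta> i) < \<alpha> i" | "\<alpha> i = Suc (\<beta> i)" | "\<alpha> i \<le> \<beta> i" by linarith
    then show ?thesis
    proof cases
      case 1
      then show ?thesis by (simp add: L_def R_def V U)
    next
      case 2
      have "\<beta> (Suc i) < \<alpha> i" using 2 dec\<beta> by simp
      moreover have "i = 0 \<or> \<beta> i < \<alpha> (i - 1)" using 2 dec\<alpha> by (cases "i = 0") auto
      ultimately show ?thesis using 2 by (auto simp: L_def R_def V U D_def)
    next
      case 3
      have "L i = x ^ (\<beta> i - \<alpha> i) * D i"
      proof -
        have pw: "x ^ (Suc (\<beta> i) - \<alpha> i) = x * x ^ (\<beta> i - \<alpha> i)"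
          using 3 by (simp add: Suc_diff_le)
        consider "i = 0 \<or> \<beta> i < \<alpha> (i - 1)" | "i \<noteq> 0" "\<beta> i = \<alpha> (i - 1)" | "i \<noteq> 0" "\<alpha> (i - 1) < \<beta> i"
          by linarith
        then show ?thesis
        proof cases
          case 1
          then have "V i = {\<beta> i, Suc (\<beta> i)}" "D i = 1 + x * y"
            using 3 V by (auto simp: D_def)
          then show ?thesis by (simp add: L_def pw algebra_simps)
        next
          case 2
          then have "V i = {\<beta> i}" "D i = 1" using 3 V by (auto simp: D_def)
          then show ?thesis by (simp add: L_def)
        next
          case h: 3
          then have "V i = {}" "D i = 0" using V by (auto simp: D_def)
          then show ?thesis by (simp add: L_def)
        qed
      qed
      moreover have "R i = x ^ (\<beta> i - \<alpha> i) * D (Suc i)"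
      proof -
        consider "\<beta> (Suc i) < \<alpha> i" | "\<beta> (Suc i) = \<alpha> i" | "\<alpha> i < \<beta> (Suc i)" by linarith
        then show ?thesis
        proof cases
          case 1
          then have "U i = {\<alpha> i, \<alpha> i - 1}" "D (Suc i) = 1 + x * y" "\<alpha> i \<noteq> 0"
            using 3 U by (auto simp: D_def)
          moreover from this 3 have "\<beta> i - (\<alpha> i - 1) = Suc (\<beta> i - \<alpha> i)" "\<alpha> i - (\<alpha> i - 1) = 1" by auto
          ultimately show ?thesis by (simp add: R_def algebra_simps)
        next
          case 2
          then have "U i = {\<alpha> i}" "D (Suc i) = 1" using 3 U by (auto simp: D_def)
          then show ?thesis by (simp add: R_def)
        next
          case h: 3
          then have "U i = {}" "D (Suc i) = 0" using U by (auto simp: D_def)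
          then show ?thesis by (simp add: R_def)
        qed
      qed
      ultimately show ?thesis by (simp add: mult_ac)
    qed
  qed
  have "(\<Prod>i<k. L i) * D k = (1 + x * y) * (\<Prod>i<k. R i)" for k
  proof (induction k)
    case 0
    then show ?case by (simp add: D_def)
  next
    case (Suc k)
    have "(\<Prod>i<Suc k. L i) * D (Suc k) = (\<Prod>i<k. L i) * (L k * D (Suc k))" by (simp add: mult.assoc)
    also have "\<dots> = ((\<Prod>i<k. L i) * D k) * R k" by (simp add: row mult_ac)
    also have "\<dots> = (1 + x * y) * (\<Prod>i<Suc k. R i)" by (simp only: Suc.IH) (simp add: mult_ac)
    finally show ?case .
  qed
  from this[of n] have "(\<Prod>i<n. L i) * D n = (1 + x * y) * (\<Prod>i<n. R i)" .
  moreover have "D n = 1"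
  proof -
    have "n \<noteq> 0" by (simp add: n_def)
    moreover have "\<alpha> (n - 1) = 0" "\<beta> n = 0" by (rule \<alpha>0, simp) (rule \<beta>0, simp)
    ultimately show ?thesis by (simp add: D_def)
  qed
  ultimately show ?thesis by (simp add: left right)
qed

lemma vstrip_conjugate_image:
  assumes "\<nu> \<in> int_partitions"
  shows "{\<mu> \<in> int_partitions. vstrip \<mu> \<nu>} = conjugate ` {\<kappa>. hstrip \<kappa> (conjugate \<nu>)}"
proof (intro equalityI subsetI)
  fix \<mu> assume "\<mu> \<in> {\<mu> \<in> int_partitions. vstrip \<mu> \<nu>}"
  then have "hstrip (conjugate \<mu>) (conjugate \<nu>)" "\<mu> = conjugate (conjugate \<mu>)"
    using assms by (auto simp: hstrip_conjugate_iff)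
  then show "\<mu> \<in> conjugate ` {\<kappa>. hstrip \<kappa> (conjugate \<nu>)}" by blast
next
  fix \<mu> assume "\<mu> \<in> conjugate ` {\<kappa>. hstrip \<kappa> (conjugate \<nu>)}"
  then obtain \<kappa> where \<kappa>: "hstrip \<kappa> (conjugate \<nu>)" "\<mu> = conjugate \<kappa>" by blast
  then have in1: "\<kappa> \<in> int_partitions" using hstrip_in assms by blast
  then have "vstrip \<mu> \<nu>" using \<kappa> hstrip_conjugate_iff[of \<mu> \<nu>] assms by simp
  then show "\<mu> \<in> {\<mu> \<in> int_partitions. vstrip \<mu> \<nu>}" using in1 \<kappa> by simp
qed

lemma finite_vstrips:
  "\<nu> \<in> int_partitions \<Longrightarrow> finite {\<mu> \<in> int_partitions. vstrip \<mu> \<nu>}"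
  by (simp add: vstrip_conjugate_image finite_hstrips)

text \<open>The branching rule, transposed: conjugation exchanges horizontal and vertical strips.\<close>

lemma schur_conjugate_branching:
  assumes \<nu>: "\<nu> \<in> int_partitions"
  shows "schur {..<Suc m} y (conjugate \<nu>) =
    (\<Sum>\<mu> | \<mu> \<in> int_partitions \<and> vstrip \<mu> \<nu>. y m ^ (part_size \<nu> - part_size \<mu>) * schur {..<m} y (conjugate \<mu>))"
proof -
  have inj: "inj_on conjugate {\<kappa>. hstrip \<kappa> (conjugate \<nu>)}"
    using hstrip_in[of _ "conjugate \<nu>"] \<nu> by (intro inj_on_inverseI[of _ conjugate]) auto
  have "(\<Sum>\<mu> | \<mu> \<in> int_partitions \<and> vstrip \<mu> \<nu>. y m ^ (part_size \<nu> - part_size \<mu>) * schur {..<m} y (conjugate \<mu>)) =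
    (\<Sum>\<kappa> | hstrip \<kappa> (conjugate \<nu>). y m ^ (part_size \<nu> - part_size (conjugate \<kappa>)) * schur {..<m} y (conjugate (conjugate \<kappa>)))"
    unfolding vstrip_conjugate_image[OF \<nu>] by (simp add: sum.reindex[OF inj])
  also have "\<dots> = (\<Sum>\<kappa> | hstrip \<kappa> (conjugate \<nu>). y m ^ (part_size (conjugate \<nu>) - part_size \<kappa>) * schur {..<m} y \<kappa>)"
    by (rule sum.cong[OF refl]) (use hstrip_in[of _ "conjugate \<nu>"] \<nu> in auto)
  finally show ?thesis using schur_branching[of "conjugate \<nu>" m y] \<nu> by simp
qed

lemma schur_conjugate_eq_0:
  assumes "\<mu> \<in> int_partitions" "m < \<mu> 0"
  shows "schur {..<m} y (conjugate \<mu>) = 0"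
  using assms by (intro schur_eq_0) (auto simp: less_conjugate_iff[of \<mu> 0 m, symmetric])

lemma finite_box: "finite {\<nu> \<in> int_partitions. \<nu> 0 \<le> w \<and> \<nu> n = 0}"
proof -
  let ?F = "{\<mu>. \<forall>i. (i \<in> {..<n} \<longrightarrow> \<mu> i \<in> {..w}) \<and> (i \<notin> {..<n} \<longrightarrow> \<mu> i = 0)}"
  have "finite ?F" by (rule finite_set_of_finite_funs) auto
  moreover have "{\<nu> \<in> int_partitions. \<nu> 0 \<le> w \<and> \<nu> n = 0} \<subseteq> ?F"
  proof clarify
    fix \<nu> i assume \<nu>: "\<nu> \<in> int_partitions" "\<nu> 0 \<le> w" "\<nu> n = 0"
    show "(i \<in> {..<n} \<longrightarrow> \<nu> i \<in> {..w}) \<and> (i \<notin> {..<n} \<longrightarrow> \<nu> i = 0)"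
      using int_partitionsD(1)[OF \<nu>(1), of 0 i] int_partitionsD(1)[OF \<nu>(1), of n i] \<nu>(2,3) by auto
  qed
  ultimately show ?thesis by (rule rev_finite_subset)
qed

text \<open>The last variable \<open>y m\<close> is split off by the branching rule, moved past \<open>x\<close> by the commutation
rule, which costs the factor \<open>1 + x * y m\<close>, and absorbed again. The bound \<open>w\<close> only makes the sum finite: shapes with
\<open>\<nu> 0 > m\<close> contribute nothing.\<close>

lemma sum_hstrip_schur_conjugate:
  assumes "\<alpha> \<in> int_partitions" "m \<le> w"
  shows "(\<Sum>\<nu> | \<nu> \<in> int_partitions \<and> \<nu> 0 \<le> w \<and> hstrip \<alpha> \<nu>.
            x ^ (part_size \<nu> - part_size \<alpha>) * schur {..<m} y (conjugate \<nu>)) =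
         (\<Prod>j<m. 1 + x * y j) * schur {..<m} y (conjugate \<alpha>)"
  using assms
proof (induction m arbitrary: \<alpha>)
  case (0 \<alpha>)
  define A where "A = {\<nu>. \<nu> \<in> int_partitions \<and> \<nu> 0 \<le> w \<and> hstrip \<alpha> \<nu>}"
  have conj0: "conjugate \<nu> = (\<lambda>_. 0) \<longleftrightarrow> \<nu> = (\<lambda>_. 0)" if "\<nu> \<in> int_partitions" for \<nu>
    using conjugate_conjugate[OF that] by (metis conjugate_zero)
  have hz: "hstrip \<alpha> (\<lambda>_. 0) \<longleftrightarrow> \<alpha> = (\<lambda>_. 0)" by (auto simp: hstrip_def fun_eq_iff)
  have s0: "schur {..<0} y (conjugate \<nu>) = (if \<nu> = (\<lambda>_. 0) then 1 else 0)" if "\<nu> \<in> int_partitions" for \<nu>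
    using that by (simp only: schur_empty conjugate_in conj0)
  show ?case
  proof (cases "\<alpha> = (\<lambda>_. 0)")
    case True
    have "(\<Sum>\<nu>\<in>A. x ^ (part_size \<nu> - part_size \<alpha>) * schur {..<0} y (conjugate \<nu>)) =
        (\<Sum>\<nu>\<in>{\<lambda>_. 0}. x ^ (part_size \<nu> - part_size \<alpha>) * schur {..<0} y (conjugate \<nu>))"
    proof (rule sum.mono_neutral_right)
      have "A \<subseteq> {\<nu> \<in> int_partitions. \<nu> 0 \<le> w \<and> \<nu> 1 = 0}"
        using True by (auto simp: A_def hstrip_def)
      then show "finite A" using finite_box finite_subset by blast
      show "{\<lambda>_. 0} \<subseteq> A" using True by (auto simp: A_def hstrip_def)
      show "\<forall>\<nu>\<in>A - {\<lambda>_. 0}. x ^ (part_size \<nu> - part_size \<alpha>) * schur {..<0} y (conjugate \<nu>) = 0"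
        by (auto simp: A_def s0 simp del: lessThan_0)
    qed
    then show ?thesis using True by (simp add: A_def)
  next
    case False
    have "schur {..<0} y (conjugate \<nu>) = 0" if "\<nu> \<in> A" for \<nu>
      using that hz False s0[of \<nu>] by (auto simp: A_def simp del: lessThan_0)
    then have "(\<Sum>\<nu>\<in>A. x ^ (part_size \<nu> - part_size \<alpha>) * schur {..<0} y (conjugate \<nu>)) = 0"
      by (simp del: lessThan_0)
    then show ?thesis using False s0[OF 0(1)] by (simp add: A_def)
  qed
next
  case (Suc m)
  note \<alpha> = Suc.prems(1)
  let ?s = "\<lambda>\<nu>. schur {..<m} y (conjugate \<nu>)" and ?d = "\<lambda>\<nu> \<mu>. part_size \<nu> - part_size \<mu>"
  obtain L where L: "\<And>i. L \<le> i \<Longrightarrow> \<alpha> i = 0" using int_partitions_bound[OF \<alpha>] by metis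
  \<comment> \<open>\<open>D\<close> is a box that contains all shapes that occur, so that the order of summation can be exchanged\<close>
  define A where "A \<mu> = {\<nu>. \<nu> \<in> int_partitions \<and> \<nu> 0 \<le> w \<and> hstrip \<mu> \<nu>}" for \<mu>
  define D where "D = {\<beta> \<in> int_partitions. \<beta> 0 \<le> w \<and> \<beta> (Suc L) = 0}"
  define M where "M = {\<mu> \<in> int_partitions. vstrip \<mu> \<alpha>}"
  have finD: "finite D" unfolding D_def by (rule finite_box)
  have finM: "finite M" unfolding M_def by (rule finite_vstrips[OF \<alpha>])
  have A_D: "A \<mu> = {\<beta> \<in> D. hstrip \<mu> \<beta>}" if "\<mu> L = 0" for \<mu>
    using that by (auto simp: A_def D_def hstrip_def) (metis le_zero_eq)
  have finA: "finite (A \<alpha>)" using A_D[of \<alpha>] L finD by simp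
  have v_D: "{\<beta>. \<beta> \<in> int_partitions \<and> vstrip \<beta> \<nu>} = {\<beta>. \<beta> \<in> D \<and> vstrip \<beta> \<nu>}" if "\<nu> \<in> A \<alpha>" for \<nu>
  proof -
    have "\<nu> \<in> D" using that A_D[of \<alpha>] L by auto
    then show ?thesis by (auto simp: D_def vstrip_def) (meson le_trans, metis le_zero_eq)
  qed
  have "(\<Sum>\<nu>\<in>A \<alpha>. x ^ (?d \<nu> \<alpha>) * schur {..<Suc m} y (conjugate \<nu>)) =
      (\<Sum>\<nu>\<in>A \<alpha>. \<Sum>\<beta> | \<beta> \<in> D \<and> vstrip \<beta> \<nu>. x ^ (?d \<nu> \<alpha>) *
         (y m ^ (?d \<nu> \<beta>) * ?s \<beta>))"
    by (intro sum.cong refl, subst schur_conjugate_branching)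
       (auto simp: A_def sum_distrib_left v_D[unfolded A_def])
  also have "\<dots> = (\<Sum>\<beta>\<in>D. \<Sum>\<nu> | \<nu> \<in> A \<alpha> \<and> vstrip \<beta> \<nu>. x ^ (?d \<nu> \<alpha>) *
         (y m ^ (?d \<nu> \<beta>) * ?s \<beta>))"
    by (rule sum.swap_restrict[OF finA finD])
  also have "\<dots> = (\<Sum>\<beta>\<in>D. \<Sum>\<mu> | \<mu> \<in> M \<and> hstrip \<mu> \<beta>. (1 + x * y m) * (y m ^ (?d \<alpha> \<mu>) *
         (x ^ (?d \<beta> \<mu>) * ?s \<beta>)))"
  proof (rule sum.cong[OF refl])
    fix \<beta> assume \<beta>: "\<beta> \<in> D"
    then have \<beta>in: "\<beta> \<in> int_partitions" by (simp add: D_def)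
    show "(\<Sum>\<nu> | \<nu> \<in> A \<alpha> \<and> vstrip \<beta> \<nu>. x ^ (?d \<nu> \<alpha>) *
         (y m ^ (?d \<nu> \<beta>) * ?s \<beta>)) =
      (\<Sum>\<mu> | \<mu> \<in> M \<and> hstrip \<mu> \<beta>. (1 + x * y m) * (y m ^ (?d \<alpha> \<mu>) *
         (x ^ (?d \<beta> \<mu>) * ?s \<beta>)))"
    proof (cases "m < \<beta> 0")
      case True
      then show ?thesis by (simp add: schur_conjugate_eq_0 \<beta>in)
    next
      case False
      have "\<nu> 0 \<le> w" if "vstrip \<beta> \<nu>" for \<nu>
        using that False Suc.prems(2) unfolding vstrip_def by (meson Suc_le_mono le_trans not_less)
      then have eq1: "{\<nu>. \<nu> \<in> A \<alpha> \<and> vstrip \<beta> \<nu>} = {\<nu>. \<nu> \<in> int_partitions \<and> hstrip \<alpha> \<nu> \<and> vstrip \<beta> \<nu>}"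
        by (auto simp: A_def)
      have eq2: "{\<mu>. \<mu> \<in> M \<and> hstrip \<mu> \<beta>} = {\<mu>. hstrip \<mu> \<beta> \<and> vstrip \<mu> \<alpha>}"
        using hstrip_in \<beta>in by (auto simp: M_def)
      have "(\<Sum>\<nu> | \<nu> \<in> A \<alpha> \<and> vstrip \<beta> \<nu>. x ^ (?d \<nu> \<alpha>) *
         (y m ^ (?d \<nu> \<beta>) * ?s \<beta>)) =
         (\<Sum>\<nu> | \<nu> \<in> int_partitions \<and> hstrip \<alpha> \<nu> \<and> vstrip \<beta> \<nu>.
            x ^ (?d \<nu> \<alpha>) * y m ^ (?d \<nu> \<beta>)) * ?s \<beta>"
        unfolding eq1 by (simp add: sum_distrib_right mult.assoc)
      also have "\<dots> = (1 + x * y m) * (\<Sum>\<mu> | hstrip \<mu> \<beta> \<and> vstrip \<mu> \<alpha>.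
            x ^ (?d \<beta> \<mu>) * y m ^ (?d \<alpha> \<mu>)) * ?s \<beta>"
        by (simp only: strip_commutation[OF \<alpha> \<beta>in])
      also have "\<dots> = (\<Sum>\<mu> | \<mu> \<in> M \<and> hstrip \<mu> \<beta>. (1 + x * y m) * (y m ^ (?d \<alpha> \<mu>) *
         (x ^ (?d \<beta> \<mu>) * ?s \<beta>)))"
        unfolding eq2 by (simp add: sum_distrib_left sum_distrib_right mult_ac)
      finally show ?thesis .
    qed
  qed
  also have "\<dots> = (\<Sum>\<mu>\<in>M. \<Sum>\<beta> | \<beta> \<in> D \<and> hstrip \<mu> \<beta>. (1 + x * y m) * (y m ^ (?d \<alpha> \<mu>) *
         (x ^ (?d \<beta> \<mu>) * ?s \<beta>)))"
    by (rule sum.swap_restrict[OF finD finM])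
  also have "\<dots> = (\<Sum>\<mu>\<in>M. (1 + x * y m) * (y m ^ (?d \<alpha> \<mu>) *
         ((\<Prod>j<m. 1 + x * y j) * ?s \<mu>)))"
  proof (rule sum.cong[OF refl])
    fix \<mu> assume \<mu>: "\<mu> \<in> M"
    then have "\<mu> L = 0" using L[of L] unfolding M_def vstrip_def by (metis (mono_tags, lifting) le_zero_eq mem_Collect_eq order_refl)
    then have "{\<beta>. \<beta> \<in> D \<and> hstrip \<mu> \<beta>} = A \<mu>" using A_D by simp
    moreover have "(\<Sum>\<beta>\<in>A \<mu>. x ^ (?d \<beta> \<mu>) * ?s \<beta>) =
        (\<Prod>j<m. 1 + x * y j) * ?s \<mu>"
      unfolding A_def using Suc.IH[of \<mu>] \<mu> Suc.prems(2) by (simp add: M_def)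
    ultimately show "(\<Sum>\<beta> | \<beta> \<in> D \<and> hstrip \<mu> \<beta>. (1 + x * y m) * (y m ^ (?d \<alpha> \<mu>) *
         (x ^ (?d \<beta> \<mu>) * ?s \<beta>))) =
       (1 + x * y m) * (y m ^ (?d \<alpha> \<mu>) * ((\<Prod>j<m. 1 + x * y j) * ?s \<mu>))"
      by (simp add: sum_distrib_left[symmetric])
  qed
  also have "\<dots> = (\<Prod>j<Suc m. 1 + x * y j) *
      (\<Sum>\<mu>\<in>M. y m ^ (?d \<alpha> \<mu>) * ?s \<mu>)"
    by (simp add: sum_distrib_left mult_ac)
  also have "(\<Sum>\<mu>\<in>M. y m ^ (?d \<alpha> \<mu>) * ?s \<mu>) = schur {..<Suc m} y (conjugate \<alpha>)"
    unfolding M_def by (rule schur_conjugate_branching[OF \<alpha>, symmetric])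
  finally show ?case by (simp add: A_def)
qed

text \<open>The variables \<open>x i\<close> are removed one at a time by the previous rule. Outside the
range of summation one of the two Schur polynomials is zero.\<close>

lemma dual_Cauchy_finite:
  "(\<Sum>\<nu> | \<nu> \<in> int_partitions \<and> \<nu> 0 \<le> m \<and> \<nu> n = 0. schur {..<n} x \<nu> * schur {..<m} y (conjugate \<nu>)) =
   (\<Prod>i<n. \<Prod>j<m. 1 + x i * y j)"
proof (induction n)
  case 0
  have "{\<nu> \<in> int_partitions. \<nu> 0 \<le> m \<and> \<nu> 0 = 0} = {\<lambda>_. 0}"
    using int_partitionsD(1)[of _ 0] by (auto simp: fun_eq_iff) (metis le_zero_eq zero_le)
  then show ?case by simp
next
  case (Suc n)
  let ?s = "\<lambda>\<nu>. schur {..<m} y (conjugate \<nu>)" and ?d = "\<lambda>\<nu> \<mu>. part_size \<nu> - part_size \<mu>"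
  define D where "D n = {\<nu>. \<nu> \<in> int_partitions \<and> \<nu> 0 \<le> m \<and> \<nu> n = 0}" for n
  have finD: "finite (D n)" for n using finite_box[of m n] by (simp add: D_def)
  have h_D: "{\<alpha>. hstrip \<alpha> \<nu>} = {\<alpha>. \<alpha> \<in> D (Suc n) \<and> hstrip \<alpha> \<nu>}" if "\<nu> \<in> D (Suc n)" for \<nu>
    using that hstrip_in[of _ \<nu>] by (auto simp: D_def hstrip_def) (meson le_trans, metis le_zero_eq)
  have "(\<Sum>\<nu>\<in>D (Suc n). schur {..<Suc n} x \<nu> * ?s \<nu>) =
      (\<Sum>\<nu>\<in>D (Suc n). \<Sum>\<alpha> | \<alpha> \<in> D (Suc n) \<and> hstrip \<alpha> \<nu>.
         schur {..<n} x \<alpha> * (x n ^ (?d \<nu> \<alpha>) * ?s \<nu>))"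
  proof (rule sum.cong[OF refl])
    fix \<nu> assume \<nu>: "\<nu> \<in> D (Suc n)"
    then have "\<nu> \<in> int_partitions" by (simp add: D_def)
    then show "schur {..<Suc n} x \<nu> * ?s \<nu> =
      (\<Sum>\<alpha> | \<alpha> \<in> D (Suc n) \<and> hstrip \<alpha> \<nu>.
         schur {..<n} x \<alpha> * (x n ^ (?d \<nu> \<alpha>) * ?s \<nu>))"
      unfolding h_D[OF \<nu>, symmetric] by (simp add: schur_branching sum_distrib_left sum_distrib_right mult_ac)
  qed
  also have "\<dots> = (\<Sum>\<alpha>\<in>D (Suc n). \<Sum>\<nu> | \<nu> \<in> D (Suc n) \<and> hstrip \<alpha> \<nu>.
         schur {..<n} x \<alpha> * (x n ^ (?d \<nu> \<alpha>) * ?s \<nu>))"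
    by (rule sum.swap_restrict[OF finD finD])
  also have "\<dots> = (\<Sum>\<alpha>\<in>D (Suc n). schur {..<n} x \<alpha> * ((\<Prod>j<m. 1 + x n * y j) * ?s \<alpha>))"
  proof (rule sum.cong[OF refl])
    fix \<alpha> assume "\<alpha> \<in> D (Suc n)"
    then have \<alpha>: "\<alpha> \<in> int_partitions" by (simp add: D_def)
    show "(\<Sum>\<nu> | \<nu> \<in> D (Suc n) \<and> hstrip \<alpha> \<nu>.
         schur {..<n} x \<alpha> * (x n ^ (?d \<nu> \<alpha>) * ?s \<nu>)) =
       schur {..<n} x \<alpha> * ((\<Prod>j<m. 1 + x n * y j) * ?s \<alpha>)"
    proof (cases "\<alpha> n = 0")
      case True
      then have "{\<nu>. \<nu> \<in> D (Suc n) \<and> hstrip \<alpha> \<nu>} = {\<nu>. \<nu> \<in> int_partitions \<and> \<nu> 0 \<le> m \<and> hstrip \<alpha> \<nu>}"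
        by (auto simp: D_def hstrip_def) (metis le_zero_eq)
      then show ?thesis using sum_hstrip_schur_conjugate[OF \<alpha> order_refl, of "x n" m y]
        by (simp add: sum_distrib_left[symmetric])
    next
      case False
      then show ?thesis by (simp add: schur_eq_0[OF \<alpha>])
    qed
  qed
  also have "\<dots> = (\<Sum>\<alpha>\<in>D n. schur {..<n} x \<alpha> * ((\<Prod>j<m. 1 + x n * y j) * ?s \<alpha>))"
  proof (rule sum.mono_neutral_right[OF finD])
    show "D n \<subseteq> D (Suc n)"
    proof
      fix \<alpha> assume "\<alpha> \<in> D n"
      then show "\<alpha> \<in> D (Suc n)" using int_partitionsD(1)[of \<alpha> n "Suc n"] by (auto simp: D_def)
    qed
    show "\<forall>\<alpha>\<in>D (Suc n) - D n. schur {..<n} x \<alpha> * ((\<Prod>j<m. 1 + x n * y j) * ?s \<alpha>) = 0"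
      using schur_eq_0 by (auto simp: D_def)
  qed
  also have "\<dots> = (\<Prod>j<m. 1 + x n * y j) * (\<Sum>\<alpha>\<in>D n. schur {..<n} x \<alpha> * ?s \<alpha>)"
    by (simp add: sum_distrib_left mult_ac)
  also have "\<dots> = (\<Prod>i<Suc n. \<Prod>j<m. 1 + x i * y j)"
    using Suc.IH by (simp add: D_def mult_ac)
  finally show ?case by (simp add: D_def)
qed

section \<open>The dual Cauchy identity in infinitely many variables\<close>

text \<open>The Schur function of the moduli of the variables. For \<open>I = UNIV\<close> it dominates the Schur
polynomials \<open>schur {..<n} x \<mu>\<close>, uniformly in \<open>n\<close>.\<close>

definition ssyt_norm_sum :: "nat set \<Rightarrow> (nat \<Rightarrow> complex) \<Rightarrow> (nat \<Rightarrow> nat) \<Rightarrow> real" where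
  "ssyt_norm_sum I x \<mu> = (\<Sum>\<^sub>\<infinity>T\<in>ssyt I \<mu>. \<Prod>c\<in>young_diagram \<mu>. norm (x (T c)))"

lemma ssyt_mono: "I \<subseteq> J \<Longrightarrow> ssyt I \<mu> \<subseteq> ssyt J \<mu>"
  by (auto simp: ssyt_def PiE_def)

text \<open>A tableau has finitely many entries, so it uses only finitely many variables. Hence truncating
the set of variables exhausts the set of tableaux, and an infinite Schur function is the limit of
Schur polynomials.\<close>

lemma filterlim_ssyt:
  assumes "\<mu> \<in> int_partitions"
  shows "filterlim (\<lambda>n. ssyt {..<n} \<mu>) (finite_subsets_at_top (ssyt UNIV \<mu>)) sequentially"
  unfolding filterlim_finite_subsets_at_top
proof (intro allI impI)
  fix X assume X: "finite X \<and> X \<subseteq> ssyt UNIV \<mu>"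
  have fin: "finite (\<Union>T\<in>X. T ` young_diagram \<mu>)" using X finite_young_diagram[OF assms] by blast
  then obtain N where N: "\<forall>k\<in>(\<Union>T\<in>X. T ` young_diagram \<mu>). k < N"
    using finite_nat_set_iff_bounded by blast
  have "finite (ssyt {..<n} \<mu>) \<and> X \<subseteq> ssyt {..<n} \<mu> \<and> ssyt {..<n} \<mu> \<subseteq> ssyt UNIV \<mu>" if "N \<le> n" for n
  proof (intro conjI)
    show "finite (ssyt {..<n} \<mu>)" using assms by blast
    show "ssyt {..<n} \<mu> \<subseteq> ssyt UNIV \<mu>" by (rule ssyt_mono) simp
    show "X \<subseteq> ssyt {..<n} \<mu>"
    proof
      fix T assume T: "T \<in> X"
      then have "T \<in> ssyt UNIV \<mu>" using X by blast
      moreover have "T c < n" if "c \<in> young_diagram \<mu>" for c using N T that \<open>N \<le> n\<close> by fastforce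
      ultimately show "T \<in> ssyt {..<n} \<mu>" by (auto simp: ssyt_def PiE_def)
    qed
  qed
  then show "eventually (\<lambda>n. finite (ssyt {..<n} \<mu>) \<and> X \<subseteq> ssyt {..<n} \<mu> \<and> ssyt {..<n} \<mu> \<subseteq> ssyt UNIV \<mu>) sequentially"
    by (auto simp: eventually_sequentially)
qed

lemma tendsto_sum_ssyt:
  assumes "\<mu> \<in> int_partitions" "f summable_on ssyt UNIV \<mu>"
  shows "(\<lambda>n. \<Sum>T\<in>ssyt {..<n} \<mu>. f T) \<longlonglongrightarrow> infsum f (ssyt UNIV \<mu>)"
proof -
  have "(sum f \<longlongrightarrow> infsum f (ssyt UNIV \<mu>)) (finite_subsets_at_top (ssyt UNIV \<mu>))"
    using has_sum_infsum[OF assms(2)] by (simp add: has_sum_def)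
  from filterlim_compose[OF this filterlim_ssyt[OF assms(1)]] show ?thesis .
qed

text \<open>Dropping the monotonicity conditions on tableaux bounds the sum by the power
\<open>(\<Sum>i. norm (x i)) ^ card (young_diagram \<mu>)\<close>.\<close>

lemma ssyt_norm_summable:
  fixes x :: "nat \<Rightarrow> complex"
  assumes \<mu>: "\<mu> \<in> int_partitions" and x: "summable (\<lambda>i. norm (x i))"
  shows "(\<lambda>T. \<Prod>c\<in>young_diagram \<mu>. norm (x (T c))) summable_on ssyt UNIV \<mu>"
proof (rule nonneg_bdd_above_summable_on)
  show "bdd_above (sum (\<lambda>T. \<Prod>c\<in>young_diagram \<mu>. norm (x (T c))) ` {F. F \<subseteq> ssyt UNIV \<mu> \<and> finite F})"
  proof (rule bdd_aboveI2)
    fix F assume F: "F \<in> {F. F \<subseteq> ssyt UNIV \<mu> \<and> finite F}"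
    have "eventually (\<lambda>n. F \<subseteq> ssyt {..<n} \<mu>) sequentially"
      using filterlim_ssyt[OF \<mu>] F unfolding filterlim_finite_subsets_at_top by (fastforce elim: eventually_mono)
    then obtain n where n: "F \<subseteq> ssyt {..<n} \<mu>" by (auto simp: eventually_sequentially)
    have sub: "F \<subseteq> young_diagram \<mu> \<rightarrow>\<^sub>E {..<n}" using n by (auto simp: ssyt_def)
    have "(\<Sum>T\<in>F. \<Prod>c\<in>young_diagram \<mu>. norm (x (T c))) \<le>
        (\<Sum>T\<in>young_diagram \<mu> \<rightarrow>\<^sub>E {..<n}. \<Prod>c\<in>young_diagram \<mu>. norm (x (T c)))"
      by (rule sum_mono2[OF _ sub]) (use \<mu> in \<open>auto intro!: finite_PiE prod_nonneg\<close>)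
    also have "\<dots> = (\<Prod>c\<in>young_diagram \<mu>. \<Sum>i<n. norm (x i))"
      by (rule prod_sum_PiE[symmetric]) (use \<mu> in auto)
    also have "\<dots> \<le> (\<Prod>c\<in>young_diagram \<mu>. \<Sum>i. norm (x i))"
      by (rule prod_mono) (auto intro!: sum_nonneg sum_le_suminf x)
    finally show "(\<Sum>T\<in>F. \<Prod>c\<in>young_diagram \<mu>. norm (x (T c))) \<le> (\<Prod>c\<in>young_diagram \<mu>. \<Sum>i. norm (x i))" .
  qed
qed (auto intro: prod_nonneg)

lemma schur_LIMSEQ:
  assumes \<mu>: "\<mu> \<in> int_partitions" and x: "summable (\<lambda>i. norm (x i))"
  shows "(\<lambda>n. schur {..<n} x \<mu>) \<longlonglongrightarrow> schur UNIV x \<mu>"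
proof -
  have "(\<lambda>T. \<Prod>c\<in>young_diagram \<mu>. x (T c)) summable_on ssyt UNIV \<mu>"
    by (rule abs_summable_summable) (use ssyt_norm_summable[OF assms] in \<open>simp add: prod_norm\<close>)
  from tendsto_sum_ssyt[OF \<mu> this] show ?thesis using \<mu> by (simp add: schur_finite schur_def[of UNIV])
qed

lemma ssyt_norm_sum_finite:
  assumes "\<mu> \<in> int_partitions"
  shows "complex_of_real (ssyt_norm_sum {..<n} x \<mu>) = schur {..<n} (\<lambda>i. of_real (norm (x i))) \<mu>"
  using assms finite_ssyt[OF assms, of "{..<n}"] by (simp add: schur_finite ssyt_norm_sum_def)

lemma ssyt_norm_sum_LIMSEQ:
  assumes \<mu>: "\<mu> \<in> int_partitions" and x: "summable (\<lambda>i. norm (x i))"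
  shows "(\<lambda>n. ssyt_norm_sum {..<n} x \<mu>) \<longlonglongrightarrow> ssyt_norm_sum UNIV x \<mu>"
  using tendsto_sum_ssyt[OF \<mu> ssyt_norm_summable[OF \<mu> x]] finite_ssyt[OF \<mu>]
  by (simp add: ssyt_norm_sum_def)

lemma ssyt_norm_sum_nonneg: "0 \<le> ssyt_norm_sum I x \<mu>"
  unfolding ssyt_norm_sum_def by (intro infsum_nonneg prod_nonneg) auto

lemma norm_schur_le:
  assumes \<mu>: "\<mu> \<in> int_partitions" and x: "summable (\<lambda>i. norm (x i))"
  shows "norm (schur {..<n} x \<mu>) \<le> ssyt_norm_sum UNIV x \<mu>"
proof -
  have "norm (schur {..<n} x \<mu>) \<le> (\<Sum>T\<in>ssyt {..<n} \<mu>. \<Prod>c\<in>young_diagram \<mu>. norm (x (T c)))"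
    using \<mu> norm_sum[of "\<lambda>T. \<Prod>c\<in>young_diagram \<mu>. x (T c)"] by (simp add: schur_finite prod_norm)
  also have "\<dots> \<le> ssyt_norm_sum UNIV x \<mu>"
    unfolding ssyt_norm_sum_def
    by (rule finite_sum_le_infsum) (use ssyt_norm_summable[OF assms] ssyt_mono[of "{..<n}" UNIV \<mu>] \<mu> in \<open>auto intro!: prod_nonneg\<close>)
  finally show ?thesis .
qed

text \<open>By the finite identity for the moduli, all partial sums are bounded by
\<open>\<Prod>i j. 1 + norm (x i) * norm (y j)\<close>, and this by \<open>exp ((\<Sum>i. norm (x i)) * (\<Sum>j. norm (y j)))\<close>.\<close>

lemma dual_Cauchy_norm_summable:
  fixes x y :: "nat \<Rightarrow> complex"
  assumes x: "summable (\<lambda>i. norm (x i))" and y: "summable (\<lambda>i. norm (y i))"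
  shows "(\<lambda>\<mu>. ssyt_norm_sum UNIV x \<mu> * ssyt_norm_sum UNIV y (conjugate \<mu>)) summable_on int_partitions"
proof (rule nonneg_bdd_above_summable_on)
  let ?X = "\<Sum>i. norm (x i)" and ?Y = "\<Sum>i. norm (y i)"
  let ?g = "\<lambda>I \<mu>. ssyt_norm_sum I x \<mu> * ssyt_norm_sum I y (conjugate \<mu>)"
  show "bdd_above (sum (\<lambda>\<mu>. ?g UNIV \<mu>) ` {F. F \<subseteq> int_partitions \<and> finite F})"
  proof (rule bdd_aboveI2)
    fix F assume F: "F \<in> {F. F \<subseteq> int_partitions \<and> finite F}"
    have "(\<lambda>n. \<Sum>\<mu>\<in>F. ?g {..<n} \<mu>) \<longlonglongrightarrow>
      (\<Sum>\<mu>\<in>F. ?g UNIV \<mu>)"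
      using F by (intro tendsto_sum tendsto_mult ssyt_norm_sum_LIMSEQ x y) auto
    moreover have "(\<Sum>\<mu>\<in>F. ?g {..<n} \<mu>) \<le> exp (?X * ?Y)" for n
    proof -
      let ?D = "{\<nu>. \<nu> \<in> int_partitions \<and> \<nu> 0 \<le> n \<and> \<nu> n = 0}"
      let ?f = "?g {..<n}"
      have z: "?f \<mu> = 0" if "\<mu> \<in> int_partitions - ?D" for \<mu>
      proof -
        have "schur {..<n} (\<lambda>i. of_real (norm (x i))) \<mu> * schur {..<n} (\<lambda>i. of_real (norm (y i))) (conjugate \<mu>) = 0"
          using that by (cases "\<mu> n = 0") (auto simp: schur_eq_0 schur_conjugate_eq_0)
        then have "complex_of_real (?f \<mu>) = 0" using that by (simp add: ssyt_norm_sum_finite)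
        then show ?thesis by (simp only: of_real_eq_0_iff)
      qed
      have finD: "finite ?D" using finite_box[of n n] by simp
      have "sum ?f F = sum ?f (F \<inter> ?D)"
        by (rule sum.mono_neutral_right) (use F z in blast)+
      also have "\<dots> \<le> sum ?f ?D"
        by (rule sum_mono2[OF finD]) (auto intro!: mult_nonneg_nonneg ssyt_norm_sum_nonneg)
      also have "sum ?f ?D = (\<Prod>i<n. \<Prod>j<n. 1 + norm (x i) * norm (y j))"
      proof -
        have "complex_of_real (sum ?f ?D) = (\<Sum>\<nu>\<in>?D. schur {..<n} (\<lambda>i. of_real (norm (x i))) \<nu> * schur {..<n} (\<lambda>i. of_real (norm (y i))) (conjugate \<nu>))"
          unfolding of_real_sum by (rule sum.cong) (auto simp: ssyt_norm_sum_finite)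
        also have "\<dots> = of_real (\<Prod>i<n. \<Prod>j<n. 1 + norm (x i) * norm (y j))"
          by (subst dual_Cauchy_finite) simp
        finally show ?thesis by (simp only: of_real_eq_iff)
      qed
      also have "\<dots> \<le> (\<Prod>i<n. exp (\<Sum>j<n. norm (x i) * norm (y j)))"
        by (intro prod_mono conjI prod_nonneg prod_le_exp_sum) (auto intro: add_nonneg_nonneg)
      also have "\<dots> = exp ((\<Sum>i<n. norm (x i)) * (\<Sum>j<n. norm (y j)))"
        by (simp add: exp_sum sum_product)
      also have "\<dots> \<le> exp (?X * ?Y)"
        by (auto intro!: mult_mono sum_le_suminf x y sum_nonneg suminf_nonneg)
      finally show ?thesis .
    qed
    ultimately show "(\<Sum>\<mu>\<in>F. ?g UNIV \<mu>) \<le> exp (?X * ?Y)"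
      by (intro LIMSEQ_le_const2) auto
  qed
qed (intro mult_nonneg_nonneg ssyt_norm_sum_nonneg)

text \<open>The finite identity with \<open>n\<close> variables of each kind, as \<open>n\<close> tends to infinity. Domination by
the sums for the moduli allows the limit to be taken inside the sum over all partitions.\<close>

theorem dual_Cauchy:
  fixes x y :: "nat \<Rightarrow> complex"
  assumes x: "summable (\<lambda>i. norm (x i))" and y: "summable (\<lambda>i. norm (y i))"
  shows "(\<lambda>n. \<Prod>i<n. \<Prod>j<n. 1 + x i * y j) \<longlonglongrightarrow>
    (\<Sum>\<^sub>\<infinity>\<mu>\<in>int_partitions. schur UNIV x \<mu> * schur UNIV y (conjugate \<mu>))"
proof (rule swap_uniform_limit')
  let ?f = "\<lambda>\<mu> n. schur {..<n} x \<mu> * schur {..<n} y (conjugate \<mu>)"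
  let ?g = "\<lambda>\<mu>. schur UNIV x \<mu> * schur UNIV y (conjugate \<mu>)"
  have lim: "?f \<mu> \<longlonglongrightarrow> ?g \<mu>" if "\<mu> \<in> int_partitions" for \<mu>
    using that by (intro tendsto_mult schur_LIMSEQ x y) auto
  show "\<forall>\<^sub>F X in finite_subsets_at_top int_partitions. ((\<lambda>n. \<Sum>\<mu>\<in>X. ?f \<mu> n) \<longlongrightarrow> (\<Sum>\<mu>\<in>X. ?g \<mu>)) sequentially"
    by (rule eventually_finite_subsets_at_top_weakI) (auto intro!: tendsto_sum lim)
  have bound: "norm (?f \<mu> n) \<le> ssyt_norm_sum UNIV x \<mu> * ssyt_norm_sum UNIV y (conjugate \<mu>)"
    if "\<mu> \<in> int_partitions" for \<mu> n
    unfolding norm_mult using that by (intro mult_mono norm_schur_le x y ssyt_norm_sum_nonneg) auto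
  note ul = Weierstrass_m_test_general[OF _ dual_Cauchy_norm_summable[OF x y], of UNIV ?f]
  have inf: "(\<Sum>\<^sub>\<infinity>\<mu>\<in>int_partitions. ?f \<mu> n) = (\<Prod>i<n. \<Prod>j<n. 1 + x i * y j)" for n
  proof -
    let ?D = "{\<nu>. \<nu> \<in> int_partitions \<and> \<nu> 0 \<le> n \<and> \<nu> n = 0}"
    have "finite ?D" using finite_box[of n n] by simp
    have "(\<Sum>\<^sub>\<infinity>\<mu>\<in>int_partitions. ?f \<mu> n) = (\<Sum>\<^sub>\<infinity>\<mu>\<in>?D. ?f \<mu> n)"
    proof (rule infsum_cong_neutral)
      fix \<mu> assume "\<mu> \<in> int_partitions - ?D"
      then show "?f \<mu> n = 0" by (cases "\<mu> n = 0") (auto simp: schur_eq_0 schur_conjugate_eq_0)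
    qed auto
    also have "\<dots> = (\<Prod>i<n. \<Prod>j<n. 1 + x i * y j)"
      using \<open>finite ?D\<close> by (simp add: dual_Cauchy_finite)
    finally show ?thesis .
  qed
  show "uniform_limit UNIV (\<lambda>X n. \<Sum>\<mu>\<in>X. ?f \<mu> n) (\<lambda>n. \<Prod>i<n. \<Prod>j<n. 1 + x i * y j) (finite_subsets_at_top int_partitions)"
    using ul bound by (simp add: inf)
  have "?g summable_on int_partitions"
  proof (rule abs_summable_summable, rule summable_on_comparison_test[OF dual_Cauchy_norm_summable[OF x y]])
    fix \<mu> assume \<mu>: "\<mu> \<in> int_partitions"
    show "norm (?g \<mu>) \<le> ssyt_norm_sum UNIV x \<mu> * ssyt_norm_sum UNIV y (conjugate \<mu>)"
      by (rule LIMSEQ_le_const2[OF tendsto_norm[OF lim[OF \<mu>]]]) (use bound[OF \<mu>] in auto)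
  qed auto
  then show "(sum ?g \<longlongrightarrow> (\<Sum>\<^sub>\<infinity>\<mu>\<in>int_partitions. ?g \<mu>)) (finite_subsets_at_top int_partitions)"
    using has_sum_infsum by (auto simp: has_sum_def)
qed auto

section \<open>The bialternant formula\<close>

definition alternant :: "nat \<Rightarrow> (nat \<Rightarrow> nat) \<Rightarrow> (nat \<Rightarrow> complex) \<Rightarrow> complex" where
  "alternant n l x = Determinant.det (Matrix.mat n n (\<lambda>(r, c). x c ^ l r))"

lemma det_mat_Leibniz:
  "Determinant.det (Matrix.mat n n (\<lambda>(r, c). f r c)) = (\<Sum>p | p permutes {..<n}. signof p * (\<Prod>r<n. f r (p r :: nat)))"
proof -
  have "Determinant.det (Matrix.mat n n (\<lambda>(r, c). f r c)) = (\<Sum>p | p permutes {0..<n}. signof p * (\<Prod>r=0..<n. Matrix.mat n n (\<lambda>(r, c). f r c) $$ (r, p r)))"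
    by (rule Determinant.det_def') simp
  also have "\<dots> = (\<Sum>p | p permutes {0..<n}. signof p * (\<Prod>r=0..<n. f r (p r)))"
  proof (intro sum.cong prod.cong refl arg_cong2[of _ _ _ _ "(*)"])
    fix p r assume "p \<in> {p. p permutes {0..<n}}" "r \<in> {0..<n}"
    then have "p r < n" "r < n" using permutes_in_image[of p "{0..<n}" r] by auto
    then show "Matrix.mat n n (\<lambda>(r, c). f r c) $$ (r, p r) = f r (p r)" by simp
  qed
  finally show ?thesis by (simp add: lessThan_atLeast0)
qed

lemma alternant_Leibniz:
  "alternant n l x = (\<Sum>p | p permutes {..<n}. signof p * (\<Prod>r<n. x (p r) ^ l r))"
  unfolding alternant_def by (rule det_mat_Leibniz)

text \<open>The geometric sum \<open>a\<^sup>d\<^sup>+\<^sup>1 - b\<^sup>d\<^sup>+\<^sup>1 = (a - b) \<Sum>i\<le>d. a\<^sup>i b\<^sup>d\<^sup>-\<^sup>i\<close> for \<open>d = l - l'\<close>, indexed by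
the possible parts \<open>v\<close> of an interlacing partition.\<close>

lemma power_diff_interval:
  fixes a b :: complex
  assumes "l' \<le> l"
  shows "a ^ (l + Suc m) - b ^ Suc (l - l') * a ^ (l' + m) = (a - b) * (\<Sum>v\<in>{l'..l}. a ^ (v + m) * b ^ (l - v))"
proof -
  define d where "d = l - l'"
  have l: "l = l' + d" using assms by (simp add: d_def)
  have "(\<Sum>v\<in>{l'..l}. a ^ (v + m) * b ^ (l - v)) = (\<Sum>i<Suc d. a ^ (l' + i + m) * b ^ (d - i))"
    by (rule sum.reindex_bij_witness[of _ "\<lambda>i. l' + i" "\<lambda>v. v - l'"]) (auto simp: l add.commute)
  also have "\<dots> = a ^ (l' + m) * (\<Sum>i<Suc d. a ^ i * b ^ (d - i))"
    by (simp add: sum_distrib_left power_add mult_ac del: sum.lessThan_Suc)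
  finally have "(a - b) * (\<Sum>v\<in>{l'..l}. a ^ (v + m) * b ^ (l - v)) = a ^ (l' + m) * (a ^ Suc d - b ^ Suc d)"
    unfolding diff_power_eq_sum by (simp add: mult_ac del: sum.lessThan_Suc)
  then show ?thesis unfolding l by (simp add: power_add algebra_simps)
qed

text \<open>Subtracting from each row a multiple of the next one, chosen to clear the last column, is
multiplication by a unitriangular matrix. Expanding along the last column leaves an \<open>n \<times> n\<close> matrix
whose entries are differences of powers, hence \<open>x c - x n\<close> times a geometric sum.\<close>

lemma alternant_eq_interval_det:
  fixes x :: "nat \<Rightarrow> complex"
  assumes dec: "\<And>i. \<nu> (Suc i) \<le> \<nu> i"
  shows "alternant (Suc n) (\<lambda>r. \<nu> r + (n - r)) x = x n ^ \<nu> n *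
    Determinant.det (Matrix.mat n n (\<lambda>(r, c). (x c - x n) * (\<Sum>v\<in>{\<nu> (Suc r)..\<nu> r}. x c ^ (v + (n - Suc r)) * x n ^ (\<nu> r - v))))"
    (is "_ = _ * Determinant.det ?C")
proof -
  define A where "A = Matrix.mat (Suc n) (Suc n) (\<lambda>(r, c). x c ^ (\<nu> r + (n - r)))"
  define w where "w r = - (x n ^ Suc (\<nu> r - \<nu> (Suc r)))" for r
  define U where "U = Matrix.mat (Suc n) (Suc n) (\<lambda>(r, k). if k = r then 1 else if k = Suc r then w r else 0)"
  define B where "B = Matrix.mat (Suc n) (Suc n) (\<lambda>(r, c). if r = n then x c ^ \<nu> n else
      x c ^ (\<nu> r + (n - r)) + w r * x c ^ (\<nu> (Suc r) + (n - Suc r)))"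
  have A: "A \<in> carrier_mat (Suc n) (Suc n)" and U: "U \<in> carrier_mat (Suc n) (Suc n)"
    and B: "B \<in> carrier_mat (Suc n) (Suc n)"
    by (simp_all add: A_def U_def B_def)
  have "Determinant.det U = prod_list (diag_mat U)"
    by (rule Determinant.det_upper_triangular[OF _ U]) (auto simp: U_def)
  also have "\<dots> = 1" unfolding prod_list_diag_prod by (simp add: U_def)
  finally have detU: "Determinant.det U = 1" .
  have "U * A = B"
  proof (rule eq_matI)
    fix r c assume "r < dim_row B" "c < dim_col B"
    then have rc: "r < Suc n" "c < Suc n" by (simp_all add: B_def)
    have "(U * A) $$ (r, c) = (\<Sum>k\<in>{0..<Suc n}. U $$ (r, k) * A $$ (k, c))"
      using rc A U by (simp add: scalar_prod_def del: sum.op_ivl_Suc)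
    also have "\<dots> = (\<Sum>k\<in>{0..<Suc n}. (if k = r then A $$ (r, c) else 0) + (if k = Suc r then w r * A $$ (Suc r, c) else 0))"
      using rc by (intro sum.cong) (auto simp: U_def)
    also have "\<dots> = A $$ (r, c) + (if Suc r < Suc n then w r * A $$ (Suc r, c) else 0)"
      using rc by (simp add: sum.distrib del: sum.op_ivl_Suc)
    also have "\<dots> = B $$ (r, c)" using rc by (auto simp: A_def B_def)
    finally show "(U * A) $$ (r, c) = B $$ (r, c)" .
  qed (use A B U in auto)
  then have "Determinant.det A = Determinant.det B" using Determinant.det_mult[OF U A] detU by simp
  also have "Determinant.det B = (\<Sum>i<Suc n. B $$ (i, n) * cofactor B i n)"
    by (rule laplace_expansion_column[OF B]) simp
  also have "\<dots> = B $$ (n, n) * cofactor B n n"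
  proof -
    have "B $$ (i, n) = 0" if "i < n" for i
    proof -
      have "\<nu> i + (n - i) = Suc (\<nu> i - \<nu> (Suc i)) + (\<nu> (Suc i) + (n - Suc i))"
        using dec[of i] that by simp
      then have "x n ^ (\<nu> i + (n - i)) = x n ^ Suc (\<nu> i - \<nu> (Suc i)) * x n ^ (\<nu> (Suc i) + (n - Suc i))"
        by (simp only: power_add)
      then show ?thesis using that by (simp add: B_def w_def)
    qed
    then show ?thesis by simp
  qed
  also have "B $$ (n, n) = x n ^ \<nu> n" by (simp add: B_def)
  also have "cofactor B n n = Determinant.det (mat_delete B n n)" by (simp add: cofactor_def)
  also have "mat_delete B n n = ?C"
  proof (rule eq_matI)
    fix r c assume "r < dim_row (?C)"
      "c < dim_col (?C)"
    then have rc: "r < n" "c < n" by simp_all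
    have "Suc (n - Suc r) = n - r" using rc by simp
    then show "mat_delete B n n $$ (r, c) = ?C $$ (r, c)"
      using power_diff_interval[OF dec[of r], of "x c" "n - Suc r" "x n"] rc
      by (simp add: mat_delete_def B_def w_def)
  qed (simp_all add: B_def)
  finally show ?thesis by (simp add: alternant_def A_def)
qed

text \<open>The interlacing sequences of length at most \<open>n\<close>, written as a product of intervals so that a
product of sums over these intervals expands into a sum over them.\<close>

definition interlacing :: "nat \<Rightarrow> (nat \<Rightarrow> nat) \<Rightarrow> (nat \<Rightarrow> nat) set" where
  "interlacing n \<nu> = {\<mu>. (\<forall>r<n. \<mu> r \<in> {\<nu> (Suc r)..\<nu> r}) \<and> (\<forall>r\<ge>n. \<mu> r = 0)}"

text \<open>Alternants obey the same branching rule as Schur polynomials, up to the factor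
\<open>\<Prod>c<n. x c - x n\<close>: expand the determinant of interval sums multilinearly in its rows.\<close>

lemma alternant_branching:
  fixes x :: "nat \<Rightarrow> complex"
  assumes dec: "\<And>i. \<nu> (Suc i) \<le> \<nu> i"
  shows "alternant (Suc n) (\<lambda>r. \<nu> r + (n - r)) x = (\<Prod>c<n. x c - x n) *
    (\<Sum>\<mu>\<in>interlacing n \<nu>. x n ^ (\<nu> n + (\<Sum>r<n. \<nu> r - \<mu> r)) * alternant n (\<lambda>r. \<mu> r + (n - Suc r)) x)"
proof -
  let ?g = "\<lambda>r c v. x c ^ (v + (n - Suc r)) * x n ^ (\<nu> r - v)"
  have "Determinant.det (Matrix.mat n n (\<lambda>(r, c). (x c - x n) * (\<Sum>v\<in>{\<nu> (Suc r)..\<nu> r}. ?g r c v))) =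
     (\<Sum>p | p permutes {..<n}. signof p * (\<Prod>r<n. (x (p r) - x n) * (\<Sum>v\<in>{\<nu> (Suc r)..\<nu> r}. ?g r (p r) v)))"
    by (rule det_mat_Leibniz)
  also have "\<dots> = (\<Sum>p | p permutes {..<n}. (\<Prod>c<n. x c - x n) * (\<Sum>\<mu>\<in>interlacing n \<nu>.
      (\<Prod>r<n. x n ^ (\<nu> r - \<mu> r)) * (signof p * (\<Prod>r<n. x (p r) ^ (\<mu> r + (n - Suc r))))))"
  proof (rule sum.cong[OF refl])
    fix p assume "p \<in> {p. p permutes {..<n}}"
    then have e1: "(\<Prod>r<n. x (p r) - x n) = (\<Prod>c<n. x c - x n)"
      using prod.permute[of p "{..<n}" "\<lambda>c. x c - x n"] by (simp add: o_def)
    have e2: "(\<Prod>r<n. \<Sum>v\<in>{\<nu> (Suc r)..\<nu> r}. ?g r (p r) v) = (\<Sum>\<mu>\<in>interlacing n \<nu>. \<Prod>r<n. ?g r (p r) (\<mu> r))"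
      unfolding interlacing_def by (rule sum_prod_rows[symmetric]) simp
    show "signof p * (\<Prod>r<n. (x (p r) - x n) * (\<Sum>v\<in>{\<nu> (Suc r)..\<nu> r}. ?g r (p r) v)) =
      (\<Prod>c<n. x c - x n) * (\<Sum>\<mu>\<in>interlacing n \<nu>.
      (\<Prod>r<n. x n ^ (\<nu> r - \<mu> r)) * (signof p * (\<Prod>r<n. x (p r) ^ (\<mu> r + (n - Suc r)))))"
      unfolding prod.distrib[of "\<lambda>r. x (p r) - x n"] e1 e2
      by (simp add: prod.distrib sum_distrib_left mult_ac)
  qed
  also have "\<dots> = (\<Prod>c<n. x c - x n) * (\<Sum>\<mu>\<in>interlacing n \<nu>. (\<Prod>r<n. x n ^ (\<nu> r - \<mu> r)) *
      alternant n (\<lambda>r. \<mu> r + (n - Suc r)) x)"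
    unfolding alternant_Leibniz sum_distrib_left[symmetric] by (subst sum.swap) (simp add: sum_distrib_left)
  finally show ?thesis
    unfolding alternant_eq_interval_det[where \<nu> = \<nu>, OF dec]
    by (simp add: sum_distrib_left power_add power_sum mult_ac)
qed

text \<open>Both sides obey the same branching rule. Stated without division, so that it also holds when
some of the variables coincide.\<close>

theorem schur_bialternant:
  assumes "\<nu> \<in> int_partitions" "\<nu> n = 0"
  shows "schur {..<n} x \<nu> * alternant n (\<lambda>r. n - Suc r) x = alternant n (\<lambda>r. \<nu> r + (n - Suc r)) x"
  using assms
proof (induction n arbitrary: \<nu>)
  case 0
  then have "\<nu> = (\<lambda>_. 0)" using int_partitionsD(1)[OF 0(1), of 0] by (auto simp: fun_eq_iff)
  then show ?case by (simp add: alternant_def)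
next
  case (Suc n)
  note \<nu> = Suc.prems(1)
  have dec: "\<And>i. \<nu> (Suc i) \<le> \<nu> i" using int_partitionsD(1)[OF \<nu>] by simp
  have \<nu>0: "\<nu> i = 0" if "Suc n \<le> i" for i using int_partitionsD(1)[OF \<nu> that] Suc.prems(2) by simp
  let ?V = "\<Prod>c<n. x c - x n"
  have 0: "interlacing n (\<lambda>_. 0) = {\<lambda>_. 0}" by (auto simp: interlacing_def fun_eq_iff) (meson not_less)
  have \<delta>: "alternant (Suc n) (\<lambda>r. n - r) x = ?V * alternant n (\<lambda>r. n - Suc r) x"
    using alternant_branching[of "\<lambda>_. 0" n x] by (simp add: 0)
  have I: "interlacing n \<nu> = {\<mu>. hstrip \<mu> \<nu> \<and> \<mu> n = 0}"
  proof (intro equalityI subsetI)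
    fix \<mu> assume \<mu>: "\<mu> \<in> interlacing n \<nu>"
    have "\<mu> i \<le> \<nu> i \<and> \<nu> (Suc i) \<le> \<mu> i" for i
      using \<mu> \<nu>0[of "Suc i"] by (cases "i < n") (auto simp: interlacing_def)
    then show "\<mu> \<in> {\<mu>. hstrip \<mu> \<nu> \<and> \<mu> n = 0}" using \<mu> by (auto simp: hstrip_def interlacing_def)
  next
    fix \<mu> assume \<mu>: "\<mu> \<in> {\<mu>. hstrip \<mu> \<nu> \<and> \<mu> n = 0}"
    then have "\<mu> \<in> int_partitions" using hstrip_in \<nu> by blast
    then have "\<mu> r = 0" if "n \<le> r" for r using int_partitionsD(1)[of \<mu> n r] \<mu> that by auto
    then show "\<mu> \<in> interlacing n \<nu>" using \<mu> by (auto simp: interlacing_def hstrip_def)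
  qed
  have "schur {..<Suc n} x \<nu> = (\<Sum>\<mu>\<in>interlacing n \<nu>. x n ^ (part_size \<nu> - part_size \<mu>) * schur {..<n} x \<mu>)"
    unfolding schur_branching[OF \<nu>] I
  proof (rule sum.mono_neutral_right[OF finite_hstrips[OF \<nu>]])
    show "\<forall>\<mu>\<in>{\<mu>. hstrip \<mu> \<nu>} - {\<mu>. hstrip \<mu> \<nu> \<and> \<mu> n = 0}. x n ^ (part_size \<nu> - part_size \<mu>) * schur {..<n} x \<mu> = 0"
      using schur_eq_0 hstrip_in[OF _ \<nu>] by auto
  qed auto
  then have "schur {..<Suc n} x \<nu> * alternant (Suc n) (\<lambda>r. n - r) x =
    ?V * (\<Sum>\<mu>\<in>interlacing n \<nu>. x n ^ (part_size \<nu> - part_size \<mu>) * (schur {..<n} x \<mu> * alternant n (\<lambda>r. n - Suc r) x))"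
    by (simp add: \<delta> sum_distrib_left sum_distrib_right mult_ac)
  also have "\<dots> = ?V * (\<Sum>\<mu>\<in>interlacing n \<nu>. x n ^ (\<nu> n + (\<Sum>r<n. \<nu> r - \<mu> r)) * alternant n (\<lambda>r. \<mu> r + (n - Suc r)) x)"
  proof (intro arg_cong2[of _ _ _ _ "(*)"] refl sum.cong)
    fix \<mu> assume \<mu>: "\<mu> \<in> interlacing n \<nu>"
    then have h: "hstrip \<mu> \<nu>" "\<mu> n = 0" using I by auto
    note \<mu>in = hstrip_in[OF h(1) \<nu>]
    have "part_size \<nu> = (\<Sum>r<n. \<nu> r) + \<nu> n" "part_size \<mu> = (\<Sum>r<n. \<mu> r)"
      using part_size_eq[of "Suc n" \<nu>] \<nu>0 part_size_eq[of n \<mu>] \<mu> by (auto simp: interlacing_def)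
    moreover have "(\<Sum>r<n. \<nu> r - \<mu> r) = (\<Sum>r<n. \<nu> r) - (\<Sum>r<n. \<mu> r)"
      by (rule sum_subtractf_nat) (use h in \<open>auto simp: hstrip_def\<close>)
    moreover have "(\<Sum>r<n. \<mu> r) \<le> (\<Sum>r<n. \<nu> r)" using h by (intro sum_mono) (auto simp: hstrip_def)
    ultimately have "part_size \<nu> - part_size \<mu> = \<nu> n + (\<Sum>r<n. \<nu> r - \<mu> r)" by linarith
    then show "x n ^ (part_size \<nu> - part_size \<mu>) = x n ^ (\<nu> n + (\<Sum>r<n. \<nu> r - \<mu> r))" by simp
    show "schur {..<n} x \<mu> * alternant n (\<lambda>r. n - Suc r) x = alternant n (\<lambda>r. \<mu> r + (n - Suc r)) x"
      by (rule Suc.IH[OF \<mu>in h(2)])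
  qed
  also have "\<dots> = alternant (Suc n) (\<lambda>r. \<nu> r + (n - r)) x"
    by (rule alternant_branching[where \<nu> = \<nu>, OF dec, symmetric])
  finally show ?case by simp
qed

text \<open>The branching rule for the empty shape has a single summand.\<close>

lemma alternant_vandermonde:
  "alternant n (\<lambda>r. n - Suc r) x = (\<Prod>m<n. \<Prod>c<m. x c - x m)"
proof (induction n)
  case 0
  then show ?case by (simp add: alternant_def)
next
  case (Suc n)
  have 0: "interlacing n (\<lambda>_. 0) = {\<lambda>_. 0}" by (auto simp: interlacing_def fun_eq_iff) (meson not_less)
  have "alternant (Suc n) (\<lambda>r. n - r) x = (\<Prod>c<n. x c - x n) * alternant n (\<lambda>r. n - Suc r) x"
    using alternant_branching[of "\<lambda>_. 0" n x] by (simp add: 0)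
  then show ?case using Suc by (simp add: mult.commute)
qed

section \<open>Orthogonality of alternants at roots of unity\<close>

lemma alternant_permute_rows:
  assumes "p permutes {..<n}"
  shows "alternant n (l \<circ> p) x = signof p * alternant n l x"
proof -
  have p: "p permutes {0..<n}" using assms by (simp add: lessThan_atLeast0)
  have "Matrix.mat n n (\<lambda>(i, j). Matrix.mat n n (\<lambda>(r, c). x c ^ l r) $$ (p i, j)) = Matrix.mat n n (\<lambda>(r, c). x c ^ (l \<circ> p) r)"
    using permutes_in_image[OF p] by (intro eq_matI) auto
  then show ?thesis
    using Determinant.det_permute_rows[OF _ p, of "Matrix.mat n n (\<lambda>(r, c). x c ^ l r)"] by (simp add: alternant_def)
qed

lemma alternant_permute_columns:
  assumes "p permutes {..<n}"
  shows "alternant n l (x \<circ> p) = signof p * alternant n l x"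
proof -
  have p: "p permutes {0..<n}" using assms by (simp add: lessThan_atLeast0)
  define A where "A = Matrix.mat n n (\<lambda>(r, c). x r ^ l c)"
  have t: "transpose_mat (Matrix.mat n n (\<lambda>(r, c). f c ^ l r)) = Matrix.mat n n (\<lambda>(r, c). f r ^ l c)" for f :: "nat \<Rightarrow> complex"
    by (intro eq_matI) auto
  have tr: "alternant n l f = Determinant.det (Matrix.mat n n (\<lambda>(r, c). f r ^ l c))" for f
    unfolding alternant_def t[symmetric] by (rule Determinant.det_transpose[where n = n, symmetric]) simp
  have "Matrix.mat n n (\<lambda>(i, j). A $$ (p i, j)) = Matrix.mat n n (\<lambda>(r, c). (x \<circ> p) r ^ l c)"
    using permutes_in_image[OF p] by (intro eq_matI) (auto simp: A_def)
  then show ?thesis using Determinant.det_permute_rows[OF _ p, of A] by (simp add: tr A_def)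
qed

lemma alternant_eq_0:
  assumes "i < n" "j < n" "i \<noteq> j" "l i = l j"
  shows "alternant n l x = 0"
  unfolding alternant_def
  by (rule Determinant.det_identical_rows[of _ n i j]) (use assms in \<open>auto intro!: eq_vecI\<close>)

lemma cnj_alternant: "cnj (alternant n l x) = alternant n l (cnj \<circ> x)"
  by (simp add: alternant_Leibniz)

text \<open>Orthogonality. Expand the squared modulus by the Leibniz formula as a double sum over
permutations \<open>p\<close>, \<open>p'\<close>. Each exponent \<open>l r\<close> with \<open>r < K\<close> runs over a full period \<open>M\<close>, so its sum
vanishes unless \<open>p r = p' r\<close>. The exponent \<open>l K\<close> is fixed to be 0, which costs nothing: permutations
of \<open>K + 1\<close> points that agree at \<open>K\<close> points are equal. So only the \<open>(K + 1)!\<close> diagonal terms remain,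
each of them \<open>M\<^sup>K\<close>.\<close>

lemma sum_norm_alternant:
  fixes u w :: complex
  assumes u: "norm u = 1" and w: "norm w = 1" and wM: "w ^ M = 1"
    and prim: "\<And>j. 0 < j \<Longrightarrow> j < M \<Longrightarrow> w ^ j \<noteq> 1" and K: "K < M"
  shows "(\<Sum>l | (\<forall>i<K. l i < M) \<and> (\<forall>i\<ge>K. l i = 0). (norm (alternant (Suc K) l (\<lambda>c. u * w ^ c)))\<^sup>2) =
    fact (Suc K) * real M ^ K"
proof -
  let ?L = "{l. (\<forall>i<K. l i \<in> {..<M}) \<and> (\<forall>i\<ge>K. l i = (0::nat))}"
  let ?P = "{p. p permutes {..<Suc K}}"
  define x where "x = (\<lambda>c. u * w ^ c)"
  have finP: "finite ?P" by (simp add: finite_permutations)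
  have uu: "u * cnj u = 1" "w * cnj w = 1" using u w by (simp_all flip: complex_norm_square)
  have cnjw: "w ^ a * cnj (w ^ b) = 1 \<longleftrightarrow> a = b" if "a < M" "b < M" for a b
  proof -
    have lt: "w ^ a * cnj (w ^ b) \<noteq> 1" if "a < b" "b < M" for a b
    proof
      assume "w ^ a * cnj (w ^ b) = 1"
      then have "w ^ b = w ^ b * (w ^ a * cnj (w ^ b))" by simp
      also have "\<dots> = w ^ a * (w * cnj w) ^ b" by (simp add: power_mult_distrib mult_ac)
      also have "\<dots> = w ^ a" using uu by simp
      finally have "w ^ b = w ^ a" .
      moreover have "w ^ b = w ^ a * w ^ (b - a)" using that by (simp flip: power_add)
      ultimately have "w ^ a * w ^ (b - a) = w ^ a * 1" by simp
      moreover have "w ^ a \<noteq> 0" using w by auto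
      ultimately have "w ^ (b - a) = 1" using mult_left_cancel by blast
      then show False using prim[of "b - a"] that by simp
    qed
    moreover have "w ^ a * cnj (w ^ b) \<noteq> 1" if "b < a" "a < M" for a b
      using lt[OF that] by (metis complex_cnj_cnj complex_cnj_mult complex_cnj_one mult.commute)
    moreover have "w ^ a * cnj (w ^ a) = (w * cnj w) ^ a" for a by (simp add: power_mult_distrib)
    ultimately show ?thesis using that uu lt[of a b] by (metis linorder_neqE_nat power_one)
  qed
  have geo: "(\<Sum>m<M. x a ^ m * cnj (x b ^ m)) = (if a = b then of_nat M else 0)" if "a < M" "b < M" for a b
  proof -
    define t where "t = w ^ a * cnj (w ^ b)"
    have "x a ^ m * cnj (x b ^ m) = t ^ m" for m
    proof -
      have "x a * cnj (x b) = (u * cnj u) * t" by (simp add: x_def t_def)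
      then have "x a * cnj (x b) = t" using uu by simp
      then show ?thesis by (simp flip: power_mult_distrib)
    qed
    moreover have "t ^ M = 1"
    proof -
      have "t ^ M = (w ^ M) ^ a * cnj ((w ^ M) ^ b)"
        unfolding t_def by (simp add: power_mult_distrib mult.commute flip: power_mult)
      then show ?thesis using wM by simp
    qed
    ultimately have "(\<Sum>m<M. x a ^ m * cnj (x b ^ m)) = (if t = 1 then of_nat M else 0)"
      by (simp add: sum_gp_strict)
    then show ?thesis using cnjw[OF that] by (simp add: t_def)
  qed
  have inner: "(\<Sum>l\<in>?L. \<Prod>r<Suc K. x (p r) ^ l r * cnj (x (p' r) ^ l r)) = (if p = p' then of_nat M ^ K else 0)"
    if p: "p \<in> ?P" and p': "p' \<in> ?P" for p p'
  proof -
    have lt: "p r < M" "p' r < M" if "r < K" for r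
      using permutes_in_image[of p "{..<Suc K}" r] permutes_in_image[of p' "{..<Suc K}" r] p p' K that by auto
    have "(\<Sum>l\<in>?L. \<Prod>r<Suc K. x (p r) ^ l r * cnj (x (p' r) ^ l r)) = (\<Sum>l\<in>?L. \<Prod>r<K. x (p r) ^ l r * cnj (x (p' r) ^ l r))"
      by (intro sum.cong) auto
    also have "\<dots> = (\<Prod>r<K. \<Sum>m<M. x (p r) ^ m * cnj (x (p' r) ^ m))"
      by (rule sum_prod_rows) simp
    also have "\<dots> = (\<Prod>r<K. if p r = p' r then of_nat M else 0)"
      by (intro prod.cong refl geo lt) auto
    also have "\<dots> = (if \<forall>r<K. p r = p' r then of_nat M ^ K else 0)"
      by auto
    also have "(\<forall>r<K. p r = p' r) \<longleftrightarrow> p = p'"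
    proof
      assume eq: "\<forall>r<K. p r = p' r"
      have bij: "bij_betw p {..<Suc K} {..<Suc K}" "bij_betw p' {..<Suc K} {..<Suc K}"
        using p p' permutes_imp_bij by auto
      have im: "f K \<in> {..<Suc K} - f ` {..<K}" "card ({..<Suc K} - f ` {..<K}) = 1"
        if "bij_betw f {..<Suc K} {..<Suc K}" for f :: "nat \<Rightarrow> nat"
      proof -
        have inj: "inj_on f {..<Suc K}" and img: "f ` {..<Suc K} = {..<Suc K}" using that by (auto simp: bij_betw_def)
        have sub: "f ` {..<K} \<subseteq> {..<Suc K}" using img by auto
        have "card (f ` {..<K}) = K" using inj by (subst card_image) (auto intro: inj_on_subset)
        then show "card ({..<Suc K} - f ` {..<K}) = 1" using sub by (subst card_Diff_subset) auto
        have "f K \<noteq> f r" if "r < K" for r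
          using inj_onD[OF inj, of K r] that by auto
        then have "f K \<notin> f ` {..<K}" by auto
        moreover have "f K \<in> {..<Suc K}" using img by (metis imageI lessI lessThan_iff)
        ultimately show "f K \<in> {..<Suc K} - f ` {..<K}" by simp
      qed
      have "p ` {..<K} = p' ` {..<K}" using eq by (intro image_cong) auto
      then have "p K = p' K" using im[OF bij(1)] im[OF bij(2)] by (metis card_1_singletonE singletonD)
      then have "p r = p' r" if "r < Suc K" for r using eq that by (auto simp: less_Suc_eq)
      moreover have "p r = p' r" if "\<not> r < Suc K" for r
        using p p' that permutes_not_in[of p "{..<Suc K}" r] permutes_not_in[of p' "{..<Suc K}" r] by simp
      ultimately show "p = p'" by blast
    qed simp
    finally show ?thesis .
  qed
  have sq: "complex_of_real ((norm (alternant (Suc K) l x))\<^sup>2) =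
      (\<Sum>p\<in>?P. \<Sum>p'\<in>?P. signof p * signof p' * (\<Prod>r<Suc K. x (p r) ^ l r * cnj (x (p' r) ^ l r)))" for l
    unfolding complex_norm_square alternant_Leibniz cnj_sum sum_product
    by (simp add: prod.distrib mult_ac del: prod.lessThan_Suc)
  have "complex_of_real (\<Sum>l\<in>?L. (norm (alternant (Suc K) l x))\<^sup>2) =
      (\<Sum>p\<in>?P. \<Sum>p'\<in>?P. signof p * signof p' * (\<Sum>l\<in>?L. \<Prod>r<Suc K. x (p r) ^ l r * cnj (x (p' r) ^ l r)))"
    unfolding of_real_sum sq sum_distrib_left by (subst sum.swap, rule sum.cong[OF refl], rule sum.swap)
  also have "\<dots> = (\<Sum>p\<in>?P. \<Sum>p'\<in>?P. if p = p' then signof p * signof p' * of_nat M ^ K else 0)"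
  proof (intro sum.cong refl)
    fix p p' assume "p \<in> ?P" "p' \<in> ?P"
    from inner[OF this]
    show "signof p * signof p' * (\<Sum>l\<in>?L. \<Prod>r<Suc K. x (p r) ^ l r * cnj (x (p' r) ^ l r)) =
        (if p = p' then signof p * signof p' * of_nat M ^ K else 0)"
      by (simp only:) simp
  qed
  also have "\<dots> = (\<Sum>p\<in>?P. of_nat M ^ K)"
    using finP by (intro sum.cong refl) (simp add: sign_def)
  also have "\<dots> = of_real (fact (Suc K) * real M ^ K)"
    using card_permutations[of "{..<Suc K}" "Suc K"] by (simp add: distrib_right)
  finally show ?thesis unfolding of_real_eq_iff x_def by simp
qed

text \<open>Both sequences, reversed, are the sorted list of the elements of the same set.\<close>

lemma strictly_decreasing_unique:
  fixes d d' :: "nat \<Rightarrow> nat"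
  assumes d: "\<And>i j. i < j \<Longrightarrow> j < K \<Longrightarrow> d j < d i" and d': "\<And>i j. i < j \<Longrightarrow> j < K \<Longrightarrow> d' j < d' i"
    and im: "d ` {..<K} = d' ` {..<K}" and i: "i < K"
  shows "d i = d' i"
proof -
  have list: "sorted (map f (rev [0..<K]))" "distinct (map f (rev [0..<K]))" "set (map f (rev [0..<K])) = f ` {..<K}"
    if "\<And>i j. i < j \<Longrightarrow> j < K \<Longrightarrow> f j < f i" for f :: "nat \<Rightarrow> nat"
  proof -
    have "sorted_wrt (<) (map f (rev [0..<K]))"
      by (auto simp: sorted_wrt_iff_nth_less rev_nth intro!: that)
    then show "sorted (map f (rev [0..<K]))" "distinct (map f (rev [0..<K]))"
      using strict_sorted_iff by blast+
  qed (auto simp: atLeast0LessThan)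
  have "map d (rev [0..<K]) = map d' (rev [0..<K])"
    by (rule sorted_distinct_set_unique) (use list[of d] list[of d'] d d' im in auto)
  then show ?thesis using i by auto
qed

lemma bounded_partitions_iff:
  "\<mu> \<in> bounded_partitions K k \<longleftrightarrow> \<mu> \<in> int_partitions \<and> \<mu> K = 0 \<and> \<mu> 0 \<le> k"
proof -
  have "part_length \<mu> \<le> K \<longleftrightarrow> \<mu> K = 0" if "\<mu> \<in> int_partitions"
  proof -
    have "part_length \<mu> = conjugate \<mu> 0" by (simp add: part_length_def conjugate_def)
    then show ?thesis using less_conjugate_iff[OF that, of K 0] by auto
  qed
  then show ?thesis by (auto simp: bounded_partitions_def)
qed

text \<open>Sorting: a sequence of distinct numbers below \<open>k + K + 1\<close>, the last of which is 0, is a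
permutation of a strictly decreasing one in a unique way, and subtracting the staircase \<open>K, K - 1, \<dots>, 0\<close> from the
latter gives a partition in the \<open>K \<times> k\<close> box.\<close>

lemma bij_betw_sorted_sequences:
  shows "bij_betw (\<lambda>(\<mu>, p). (\<lambda>r. \<mu> r + (K - r)) \<circ> p) (bounded_partitions K k \<times> {p. p permutes {..<K}})
    {l. (\<forall>i<K. l i < k + Suc K) \<and> (\<forall>i\<ge>K. l i = 0) \<and> inj_on l {..K}}"
    (is "bij_betw ?f ?A ?B")
proof (rule bij_betw_imageI)
  have dec: "\<mu> j + (K - j) < \<mu> i + (K - i)" if "\<mu> \<in> bounded_partitions K k" "i < j" "j \<le> K" for \<mu> i j
    using int_partitionsD(1)[of \<mu> i j] that by (auto simp: bounded_partitions_iff)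
  have inj_d: "inj_on (\<lambda>r. \<mu> r + (K - r)) {..K}" if "\<mu> \<in> bounded_partitions K k" for \<mu>
    by (rule linorder_inj_onI) (use dec[OF that] in fastforce)+
  have zero: "\<mu> r + (K - r) = 0" if "\<mu> \<in> bounded_partitions K k" "K \<le> r" for \<mu> r
    using that int_partitionsD(1)[of \<mu> K r] by (auto simp: bounded_partitions_iff)
  show "inj_on ?f ?A"
  proof (rule inj_onI, clarify)
    fix \<mu> p \<mu>' p'
    assume \<mu>: "\<mu> \<in> bounded_partitions K k" "\<mu>' \<in> bounded_partitions K k"
      and p: "p permutes {..<K}" "p' permutes {..<K}"
      and eq: "(\<lambda>r. \<mu> r + (K - r)) \<circ> p = (\<lambda>r. \<mu>' r + (K - r)) \<circ> p'"
    let ?d = "\<lambda>r. \<mu> r + (K - r)" and ?d' = "\<lambda>r. \<mu>' r + (K - r)"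
    have "?d ` {..<K} = (?d \<circ> p) ` {..<K}" by (simp only: image_comp[symmetric] permutes_image[OF p(1)])
    also have "\<dots> = ?d' ` {..<K}" unfolding eq by (simp only: image_comp[symmetric] permutes_image[OF p(2)])
    finally have im: "?d ` {..<K} = ?d' ` {..<K}" .
    have deq: "?d r = ?d' r" for r
    proof (cases "r < K")
      case True
      show ?thesis by (rule strictly_decreasing_unique[OF _ _ im True]) (use dec \<mu> in auto)
    next
      case False
      then show ?thesis using zero[OF \<mu>(1), of r] zero[OF \<mu>(2), of r] by simp
    qed
    then have "\<mu> = \<mu>'" by (simp add: fun_eq_iff)
    moreover have "p = p'"
    proof
      fix r
      show "p r = p' r"
      proof (cases "r < K")
        case True
        then have "p r < K" "p' r < K" using permutes_in_image[OF p(1), of r] permutes_in_image[OF p(2), of r] by auto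
        moreover have "?d (p r) = ?d (p' r)" using fun_cong[OF eq, of r] deq by simp
        ultimately show ?thesis using inj_onD[OF inj_d[OF \<mu>(1)], of "p r" "p' r"] by simp
      next
        case False
        then show ?thesis using permutes_not_in[OF p(1), of r] permutes_not_in[OF p(2), of r] by simp
      qed
    qed
    ultimately show "\<mu> = \<mu>' \<and> p = p'" by simp
  qed
  show "?f ` ?A = ?B"
  proof (intro equalityI subsetI)
    fix l assume "l \<in> ?f ` ?A"
    then obtain \<mu> p where l: "l = (\<lambda>r. \<mu> r + (K - r)) \<circ> p" and \<mu>: "\<mu> \<in> bounded_partitions K k" and p: "p permutes {..<K}"
      by auto
    have pK: "p permutes {..K}" by (rule permutes_subset[OF p]) auto
    have "l i < k + Suc K" if "i < K" for i
    proof -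
      have "\<mu> (p i) \<le> k" using \<mu> int_partitionsD(1)[of \<mu> 0 "p i"] by (auto simp: bounded_partitions_iff)
      then show ?thesis by (simp add: l)
    qed
    moreover have "l i = 0" if "K \<le> i" for i
      using zero[OF \<mu> that] permutes_not_in[OF p, of i] that by (simp add: l)
    moreover have "inj_on l {..K}"
      unfolding l using inj_d[OF \<mu>] permutes_image[OF pK] permutes_inj_on[OF pK] by (intro comp_inj_on) auto
    ultimately show "l \<in> ?B" by simp
  next
    fix l assume l: "l \<in> ?B"
    define S where "S = l ` {..<K}"
    have injK: "inj_on l {..<K}" using l by (auto intro: inj_on_subset)
    have cardS: "card S = K" and finS: "finite S" using injK by (simp_all add: S_def card_image)
    have posS: "0 < s" if "s \<in> S" for s
    proof (rule ccontr)
      assume "\<not> 0 < s"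
      then have "s = 0" by simp
      from that obtain i where i: "i < K" "s = l i" by (auto simp: S_def)
      then have "l i = l K" using \<open>s = 0\<close> l by simp
      moreover have "inj_on l {..K}" using l by simp
      ultimately have "i = K" using i by (auto dest: inj_onD)
      then show False using i by simp
    qed
    have bdS: "s < k + Suc K" if "s \<in> S" for s using that l by (auto simp: S_def)
    obtain h where h: "bij_betw h {..<K} S" "strict_mono_on {..<K} h"
      using ex_bij_betw_strict_mono_card[OF finS] cardS by metis
    have hS: "h i \<in> S" if "i < K" for i using h(1) that by (auto simp: bij_betw_def)
    have hless: "h i < h j" if "i < j" "j < K" for i j using h(2) that by (auto simp: strict_mono_on_def)
    have h_ge: "i < K \<Longrightarrow> Suc i \<le> h i" for i
    proof (induction i)
      case 0
      then show ?case using posS[OF hS[of 0]] by simp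
    next
      case (Suc i)
      then show ?case using hless[of i "Suc i"] by simp
    qed
    define d where "d r = (if r < K then h (K - Suc r) else 0)" for r
    define \<mu> where "\<mu> r = d r - (K - r)" for r
    have d_ge: "(K - r) \<le> d r" for r
      using h_ge[of "K - Suc r"] by (auto simp: d_def)
    then have d: "d r = \<mu> r + (K - r)" for r by (simp add: \<mu>_def)
    have "\<mu> (Suc r) \<le> \<mu> r" for r
    proof (cases "Suc r < K")
      case True
      then have "d (Suc r) < d r" using hless[of "K - Suc (Suc r)" "K - Suc r"] by (simp add: d_def)
      then show ?thesis using d[of r] d[of "Suc r"] True by simp
    next
      case False
      then show ?thesis using d[of "Suc r"] by (simp add: d_def)
    qed
    moreover have "\<mu> r = 0" if "K \<le> r" for r using d[of r] that by (simp add: d_def)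
    moreover have "\<mu> 0 \<le> k"
    proof (cases "K = 0")
      case False
      then have "d 0 < k + Suc K" using bdS[OF hS[of "K - 1"]] by (simp add: d_def)
      then show ?thesis by (simp add: \<mu>_def)
    qed (simp add: \<mu>_def d_def)
    ultimately have \<mu>: "\<mu> \<in> bounded_partitions K k" by (auto simp: bounded_partitions_iff int_partitions_iff)
    have bij_d: "bij_betw d {..<K} S"
    proof -
      have "bij_betw (\<lambda>r. K - Suc r) {..<K} {..<K}"
        by (rule bij_betwI[of _ _ _ "\<lambda>r. K - Suc r"]) auto
      then have "bij_betw (h \<circ> (\<lambda>r. K - Suc r)) {..<K} S" using h(1) by (rule bij_betw_trans)
      then show ?thesis by (rule bij_betw_cong[THEN iffD1, rotated]) (simp add: d_def)
    qed
    have bij_l: "bij_betw l {..<K} S" using injK by (simp add: S_def bij_betw_def)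
    define p where "p r = (if r < K then the_inv_into {..<K} d (l r) else r)" for r
    have "bij_betw (the_inv_into {..<K} d \<circ> l) {..<K} {..<K}"
      using bij_l bij_betw_the_inv_into[OF bij_d] by (rule bij_betw_trans)
    then have "bij_betw p {..<K} {..<K}"
      by (rule bij_betw_cong[THEN iffD1, rotated]) (simp add: p_def)
    then have p: "p permutes {..<K}" by (rule bij_imp_permutes) (simp add: p_def)
    have "l r = d (p r)" for r
    proof (cases "r < K")
      case True
      then have "l r \<in> d ` {..<K}" using bij_d by (simp add: bij_betw_def S_def)
      then show ?thesis using True bij_d by (simp add: p_def f_the_inv_into_f bij_betw_def)
    next
      case False
      then show ?thesis using l by (simp add: p_def d_def)
    qed
    then have "l = ?f (\<mu>, p)" by (auto simp: d)
    then show "l \<in> ?f ` ?A" using \<mu> p by blast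
  qed
qed

text \<open>The summand is symmetric in the exponents and vanishes if two of them coincide. So the sum over
all exponents is \<open>K!\<close> times the sum over strictly decreasing ones, and \<open>(K + 1)! / K! = K + 1\<close>.\<close>

lemma sum_norm_alternant_partitions:
  fixes u w :: complex
  assumes u: "norm u = 1" and w: "norm w = 1" and wM: "w ^ (k + Suc K) = 1"
    and prim: "\<And>j. 0 < j \<Longrightarrow> j < k + Suc K \<Longrightarrow> w ^ j \<noteq> 1"
  shows "(\<Sum>\<mu>\<in>bounded_partitions K k. (norm (alternant (Suc K) (\<lambda>r. \<mu> r + (K - r)) (\<lambda>c. u * w ^ c)))\<^sup>2) =
    real (Suc K) * real (k + Suc K) ^ K"
proof -
  define F where "F l = (norm (alternant (Suc K) l (\<lambda>c. u * w ^ c)))\<^sup>2" for l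
  let ?L = "{l. (\<forall>i<K. l i < k + Suc K) \<and> (\<forall>i\<ge>K. l i = 0)}"
  let ?L' = "{l. (\<forall>i<K. l i < k + Suc K) \<and> (\<forall>i\<ge>K. l i = 0) \<and> inj_on l {..K}}"
  let ?P = "{p. p permutes {..<K}}"
  have "finite ?L"
  proof -
    have "finite {f. \<forall>x. (x \<in> {..<K} \<longrightarrow> f x \<in> {..<k + Suc K}) \<and> (x \<notin> {..<K} \<longrightarrow> f x = 0)}"
      by (rule finite_set_of_finite_funs) auto
    moreover have "?L = {f. \<forall>x. (x \<in> {..<K} \<longrightarrow> f x \<in> {..<k + Suc K}) \<and> (x \<notin> {..<K} \<longrightarrow> f x = 0)}"
      by (auto simp: not_less)
    ultimately show ?thesis by simp
  qed
  have perm: "F (l \<circ> p) = F l" if "p permutes {..<K}" for l p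
  proof -
    have "p permutes {..<Suc K}" by (rule permutes_subset[OF that]) auto
    then show ?thesis by (simp add: F_def alternant_permute_rows norm_mult sign_def)
  qed
  have "fact (Suc K) * real (k + Suc K) ^ K = (\<Sum>l\<in>?L. F l)"
    unfolding F_def by (rule sum_norm_alternant[OF u w wM prim, symmetric]) auto
  also have "\<dots> = (\<Sum>l\<in>?L'. F l)"
  proof (rule sum.mono_neutral_right[OF \<open>finite ?L\<close>])
    show "\<forall>l\<in>?L - ?L'. F l = 0"
    proof
      fix l assume "l \<in> ?L - ?L'"
      then obtain i j where "i \<le> K" "j \<le> K" "i \<noteq> j" "l i = l j" by (auto simp: inj_on_def)
      then show "F l = 0" using alternant_eq_0[of i "Suc K" j l] by (simp add: F_def)
    qed
  qed auto
  also have "\<dots> = (\<Sum>(\<mu>, p)\<in>bounded_partitions K k \<times> ?P. F ((\<lambda>r. \<mu> r + (K - r)) \<circ> p))"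
    using sum.reindex_bij_betw[OF bij_betw_sorted_sequences, of F K k] by (simp add: case_prod_unfold)
  also have "\<dots> = (\<Sum>(\<mu>, p)\<in>bounded_partitions K k \<times> ?P. F (\<lambda>r. \<mu> r + (K - r)))"
    by (rule sum.cong) (auto simp: perm)
  also have "\<dots> = (\<Sum>\<mu>\<in>bounded_partitions K k. \<Sum>p\<in>?P. F (\<lambda>r. \<mu> r + (K - r)))"
    by (rule sum.cartesian_product[symmetric])
  also have "\<dots> = fact K * (\<Sum>\<mu>\<in>bounded_partitions K k. F (\<lambda>r. \<mu> r + (K - r)))"
    using card_permutations[of "{..<K}" K] by (simp add: sum_distrib_left)
  finally show ?thesis by (simp add: F_def)
qed

section \<open>Uniqueness of the multigamma hierarchy\<close>

text \<open>Iterated derivatives on the half-line can be computed from a chain of functions each of which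
has the next one as its derivative, since \<open>deriv\<close> only depends on the values near the point.\<close>

lemma higher_deriv_chain:
  fixes F :: "nat \<Rightarrow> real \<Rightarrow> real"
  assumes chain: "\<And>j x. j < n \<Longrightarrow> 0 < x \<Longrightarrow> (F j has_real_derivative F (Suc j) x) (at x)"
    and f: "\<And>x. 0 < x \<Longrightarrow> f x = F 0 x" and x: "0 < x"
  shows "(deriv ^^ n) f x = F n x"
proof -
  have "k \<le> n \<Longrightarrow> 0 < x \<Longrightarrow> (deriv ^^ k) f x = F k x" for k x
  proof (induction k arbitrary: x)
    case 0
    then show ?case by (simp add: f)
  next
    case (Suc k)
    have "eventually (\<lambda>y. y \<in> {0<..}) (nhds x)"
      using Suc.prems by (intro eventually_nhds_in_open) auto
    then have "eventually (\<lambda>y. (deriv ^^ k) f y = F k y) (nhds x)"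
      by eventually_elim (use Suc in auto)
    then have "deriv ((deriv ^^ k) f) x = deriv (F k) x" by (intro deriv_cong_ev) auto
    also have "\<dots> = F (Suc k) x" using Suc.prems by (intro DERIV_imp_deriv chain) auto
    finally show ?case by simp
  qed
  then show ?thesis using x by blast
qed

lemma DERIV_Re_of_real:
  assumes "(g has_field_derivative D) (at (complex_of_real x))"
  shows "((\<lambda>t. Re (g (of_real t))) has_real_derivative Re D) (at x)"
proof -
  have "((\<lambda>t. g (of_real t)) has_vector_derivative D) (at x)"
    using assms by (rule has_vector_derivative_real_field)
  then have "((\<lambda>t. Re (g (of_real t))) has_vector_derivative Re D) (at x)"
    by (rule bounded_linear.has_vector_derivative[OF bounded_linear_Re])
  then show ?thesis by (simp add: has_real_derivative_iff_has_vector_derivative)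
qed

text \<open>A function that is holomorphic and positive near the positive half-line has a holomorphic
logarithm there; hence the real logarithm is infinitely often differentiable.\<close>

lemma ln_derivative_chain:
  assumes "f analytic_on of_real ` {0<..}"
    and "\<And>x::real. 0 < x \<Longrightarrow> f (of_real x) \<in> \<real> \<and> 0 < Re (f (of_real x))"
  obtains F :: "nat \<Rightarrow> real \<Rightarrow> real"
  where "\<And>j x. 0 < x \<Longrightarrow> (F j has_real_derivative F (Suc j) x) (at x)"
    and "\<And>x. 0 < x \<Longrightarrow> F 0 x = ln (Re (f (of_real x)))"
proof
  define \<Phi> where "\<Phi> = (\<lambda>z. ln (f z))"
  have nonpos: "f (of_real x) \<notin> \<real>\<^sub>\<le>\<^sub>0" if "0 < x" for x
    using assms(2)[OF that] by (auto elim!: nonpos_Reals_cases)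
  have "\<Phi> analytic_on of_real ` {0<..}"
    unfolding \<Phi>_def by (rule analytic_on_ln[OF assms(1)]) (use nonpos in auto)
  then have an: "(deriv ^^ j) \<Phi> analytic_on of_real ` {0<..}" for j
    by (rule analytic_higher_deriv)
  define F where "F = (\<lambda>j x. Re ((deriv ^^ j) \<Phi> (of_real x)))"
  show "(F j has_real_derivative F (Suc j) x) (at x)" if "0 < x" for j x
  proof -
    have "(deriv ^^ j) \<Phi> field_differentiable at (of_real x)"
      using an[of j] that by (intro analytic_on_imp_differentiable_at[OF an]) auto
    then have "((deriv ^^ j) \<Phi> has_field_derivative (deriv ^^ Suc j) \<Phi> (of_real x)) (at (of_real x))"
      by (simp add: field_differentiable_derivI)
    then show ?thesis unfolding F_def by (rule DERIV_Re_of_real)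
  qed
  show "F 0 x = ln (Re (f (of_real x)))" if "0 < x" for x
  proof -
    have "f (of_real x) = of_real (Re (f (of_real x)))" using assms(2)[OF that] by simp
    then have "ln (f (of_real x)) = of_real (ln (Re (f (of_real x))))"
      using assms(2)[OF that] by (metis Ln_of_real)
    then show ?thesis by (simp add: F_def \<Phi>_def)
  qed
qed

text \<open>Such a function is non-decreasing, and by periodicity no later value can be larger.\<close>

lemma periodic_nondecreasing_imp_constant:
  fixes h :: "real \<Rightarrow> real"
  assumes der: "\<And>x. 0 < x \<Longrightarrow> (h has_real_derivative h' x) (at x)"
    and per: "\<And>x. 0 < x \<Longrightarrow> h (x + 1) = h x"
    and nn: "\<And>x. 0 < x \<Longrightarrow> 0 \<le> h' x"
    and xy: "0 < x" "0 < y"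
  shows "h x = h y"
proof -
  have le: "h x \<le> h y" if "0 < x" "x \<le> y" for x y
    using that(2)
  proof (rule DERIV_nonneg_imp_nondecreasing)
    fix z assume "x \<le> z" "z \<le> y"
    then show "\<exists>D. (h has_real_derivative D) (at z) \<and> 0 \<le> D"
      using that der[of z] nn[of z] by (intro exI[of _ "h' z"]) auto
  qed
  have pern: "h (x + real n) = h x" if "0 < x" for x n
    using that
  proof (induction n)
    case (Suc n)
    have "h (x + real n + 1) = h (x + real n)" using Suc.prems by (intro per) auto
    then show ?case using Suc by (simp add: algebra_simps)
  qed simp
  have ge: "h y \<le> h x" if "0 < x" "0 < y" for x y
  proof -
    obtain n :: nat where "y - x \<le> real n" using real_arch_simple by blast
    then have "h y \<le> h (x + real n)" using that by (intro le) auto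
    then show ?thesis using pern[OF that(1)] by simp
  qed
  show ?thesis using ge[of x y] ge[of y x] xy by simp
qed

lemma periodic_higher_deriv:
  fixes h :: "nat \<Rightarrow> real \<Rightarrow> real"
  assumes der: "\<And>j x. 0 < x \<Longrightarrow> (h j has_real_derivative h (Suc j) x) (at x)"
    and per: "\<And>x. 0 < x \<Longrightarrow> h 0 (x + 1) = h 0 x" and "0 < x"
  shows "h j (x + 1) = h j x"
  using assms(3)
proof (induction j arbitrary: x)
  case (Suc j)
  have "((\<lambda>x. h j (x + 1)) has_real_derivative h (Suc j) (x + 1)) (at x)"
    using der[of "x + 1" j] Suc.prems by (simp add: DERIV_shift)
  then have "(h j has_real_derivative h (Suc j) (x + 1)) (at x)"
    by (rule has_field_derivative_transform_within_open[of _ _ _ "{0<..}"]) (use Suc in auto)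
  then show ?case using der[OF Suc.prems] DERIV_unique by blast
qed (use per in auto)

text \<open>The function \<open>h n\<close> is periodic with a non-negative derivative, hence constant. It or its negative
is then non-negative, and the argument can be repeated for \<open>h n\<close>.\<close>

lemma periodic_higher_deriv_nonneg_imp_constant:
  fixes h :: "nat \<Rightarrow> real \<Rightarrow> real"
  assumes "\<And>j x. 0 < x \<Longrightarrow> (h j has_real_derivative h (Suc j) x) (at x)"
    and "\<And>x. 0 < x \<Longrightarrow> h 0 (x + 1) = h 0 x"
    and "\<And>x. 0 < x \<Longrightarrow> 0 \<le> h (Suc n) x"
    and "0 < x" "0 < y"
  shows "h 0 x = h 0 y"
  using assms
proof (induction n arbitrary: h x y)
  case 0
  show ?case
    by (rule periodic_nondecreasing_imp_constant[of "h 0" "h (Suc 0)"]) (use 0 in auto)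
next
  case (Suc n)
  have const: "h (Suc n) x = h (Suc n) 1" if "0 < x" for x
    by (rule periodic_nondecreasing_imp_constant[of "h (Suc n)" "h (Suc (Suc n))"])
       (use Suc.prems periodic_higher_deriv[OF Suc.prems(1,2)] that in auto)
  show ?case
  proof (cases "0 \<le> h (Suc n) 1")
    case True
    have "0 \<le> h (Suc n) x" if "0 < x" for x using True const[OF that] by linarith
    then show ?thesis using Suc.IH[of h] Suc.prems by blast
  next
    case False
    have "0 \<le> - h (Suc n) x" if "0 < x" for x using False const[OF that] by linarith
    moreover have "((\<lambda>x. - h j x) has_real_derivative - h (Suc j) x) (at x)" if "0 < x" for j x
      using Suc.prems(1)[OF that] by (rule DERIV_minus)
    moreover have "- h 0 (x + 1) = - h 0 x" if "0 < x" for x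
      using Suc.prems(2)[OF that] by simp
    ultimately have "- h 0 x = - h 0 y"
      using Suc.IH[of "\<lambda>j x. - h j x"] Suc.prems(4,5) by blast
    then show ?thesis by simp
  qed
qed

lemma multigamma_stepD:
  assumes "multigamma_step d g f"
  shows "f nicely_meromorphic_on UNIV" "f 1 = 1"
    "eventually (\<lambda>z. f (z + 1) = g z * f z) (cosparse UNIV)"
    "0 < x \<Longrightarrow> f (of_real x) \<in> \<real>" "0 < x \<Longrightarrow> 0 < Re (f (of_real x))"
    "0 < x \<Longrightarrow> 0 \<le> (deriv ^^ (d + 1)) (\<lambda>t. ln (Re (f (of_real t)))) x"
  using assms unfolding multigamma_step_def by blast+

lemma multigamma_step_analytic:
  assumes "multigamma_step d g f"
  shows "f analytic_on of_real ` {0<..}"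
proof -
  have "f analytic_on {of_real x}" if "0 < x" for x :: real
  proof (rule nicely_meromorphic_on_imp_analytic_at[of f UNIV])
    have "f (of_real x) \<noteq> 0" using multigamma_stepD(5)[OF assms that] by force
    then have "f \<midarrow>of_real x\<rightarrow> f (of_real x)"
      using multigamma_stepD(1)[OF assms] unfolding nicely_meromorphic_on_def by blast
    then show "\<not> is_pole f (of_real x)"
      unfolding is_pole_def by (meson at_neq_bot not_tendsto_and_filterlim_at_infinity)
  qed (use multigamma_stepD(1)[OF assms] in auto)
  then show ?thesis by (subst analytic_on_analytic_at) auto
qed

text \<open>The functional equation is only given off a sparse set, but both sides are continuous at the
positive reals.\<close>

lemma multigamma_step_recurrence:
  assumes f: "multigamma_step d g f" and g: "g analytic_on of_real ` {0<..}" and x: "0 < (x::real)"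
  shows "f (of_real (x + 1)) = g (of_real x) * f (of_real x)"
proof (rule tendsto_unique[of "at (complex_of_real x)"])
  have cont: "isCont h (complex_of_real y)" if "h analytic_on of_real ` {0<..}" "0 < y" for h and y :: real
    using that by (intro analytic_at_imp_isCont) (auto intro: analytic_on_subset)
  have "isCont f (complex_of_real x + 1)"
    using cont[OF multigamma_step_analytic[OF f], of "x + 1"] x by simp
  then have "isCont (\<lambda>z. f (z + 1)) (complex_of_real x)"
    by (intro isCont_o2[of _ "\<lambda>z. z + 1" f]) (auto intro!: continuous_intros)
  then show "((\<lambda>z. f (z + 1)) \<longlongrightarrow> f (of_real (x + 1))) (at (of_real x))"
    by (simp add: isCont_def)
  have "((\<lambda>z. g z * f z) \<longlongrightarrow> g (of_real x) * f (of_real x)) (at (of_real x))"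
    using cont[OF g x] cont[OF multigamma_step_analytic[OF f] x] by (intro tendsto_mult) (auto simp: isCont_def)
  moreover have "eventually (\<lambda>z. f (z + 1) = g z * f z) (at (complex_of_real x))"
    using multigamma_stepD(3)[OF f] by (rule eventually_cosparse_imp_eventually_at) simp
  ultimately show "((\<lambda>z. f (z + 1)) \<longlongrightarrow> g (of_real x) * f (of_real x)) (at (of_real x))"
    by (simp add: tendsto_cong)
qed auto

text \<open>The identity theorem. The normalisation at the poles makes the values of a nicely meromorphic
function at single points determined by its values nearby.\<close>

lemma nicely_meromorphic_eqI:
  assumes f: "f nicely_meromorphic_on UNIV" and g: "g nicely_meromorphic_on UNIV"
    and eq: "frequently (\<lambda>z. f z = g z) (at a)"
  shows "f = g"
proof
  fix z
  define h where "h = (\<lambda>z. f z - g z)"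
  have mero: "h meromorphic_on UNIV"
    unfolding h_def using f g by (intro meromorphic_intros) (auto simp: nicely_meromorphic_on_def)
  have nice: "remove_sings h nicely_meromorphic_on UNIV"
    using mero by (rule remove_sings_nicely_meromorphic)
  have ev: "eventually (\<lambda>w. remove_sings h w = h w) (at w')" for w'
    using eventually_remove_sings_eq[OF mero] by (rule eventually_cosparse_imp_eventually_at) auto
  have fr: "frequently (\<lambda>z. remove_sings h z = 0) (at a)"
    by (rule frequently_rev_mp[OF eq]) (use ev[of a] in \<open>auto elim!: eventually_mono simp: h_def\<close>)
  have "remove_sings h w = 0" for w
    by (rule frequently_eq_meromorphic_imp_constant[OF fr nice]) auto
  with ev[of z] have *: "eventually (\<lambda>w. f w = g w) (at z)" by (simp add: h_def)
  have "is_pole f z \<longleftrightarrow> is_pole g z"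
    by (rule is_pole_cong) (use * in auto)
  moreover have "(f \<midarrow>z\<rightarrow> c) \<longleftrightarrow> (g \<midarrow>z\<rightarrow> c)" for c
    using * by (rule tendsto_cong)
  moreover have "is_pole f z \<and> f z = 0 \<or> f \<midarrow>z\<rightarrow> f z" "is_pole g z \<and> g z = 0 \<or> g \<midarrow>z\<rightarrow> g z"
    using f g by (auto simp: nicely_meromorphic_on_def)
  ultimately show "f z = g z"
    using LIM_unique[of f _ z] not_tendsto_and_filterlim_at_infinity[of "at z"]
    unfolding is_pole_def by (metis at_neq_bot)
qed

text \<open>Let \<open>h\<close> be the difference of the logarithms of \<open>f1\<close> and \<open>f2\<close>. The recurrence makes it
1-periodic. Its derivative of order \<open>d + 2\<close> at \<open>x\<close> equals that at \<open>x + n\<close>, which is at least minus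
the derivative for \<open>f2\<close> there; this tends to 0. So that derivative of \<open>h\<close> is non-negative, \<open>h\<close> is
constant, and \<open>h(1) = 0\<close>.\<close>

lemma multigamma_step_unique:
  assumes f1: "multigamma_step (Suc d) g f1" and f2: "multigamma_step (Suc d) g f2"
    and g: "g analytic_on of_real ` {0<..}"
    and lim: "\<And>x. 0 < x \<Longrightarrow>
      (\<lambda>n. (deriv ^^ (Suc d + 1)) (\<lambda>t. ln (Re (f2 (of_real t)))) (x + real n)) \<longlonglongrightarrow> 0"
  shows "f1 = f2"
proof -
  have pos: "f (of_real x) \<in> \<real> \<and> 0 < Re (f (of_real x))"
    and conv: "0 \<le> (deriv ^^ (Suc d + 1)) (\<lambda>t. ln (Re (f (of_real t)))) x"
    if "multigamma_step (Suc d) g f" "0 < x" for f and x :: real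
    using multigamma_stepD(4-6)[OF that] by auto
  obtain F1 where F1: "\<And>j x. 0 < x \<Longrightarrow> (F1 j has_real_derivative F1 (Suc j) x) (at x)"
    "\<And>x. 0 < x \<Longrightarrow> F1 0 x = ln (Re (f1 (of_real x)))"
    using ln_derivative_chain[OF multigamma_step_analytic[OF f1] pos[OF f1]] by metis
  obtain F2 where F2: "\<And>j x. 0 < x \<Longrightarrow> (F2 j has_real_derivative F2 (Suc j) x) (at x)"
    "\<And>x. 0 < x \<Longrightarrow> F2 0 x = ln (Re (f2 (of_real x)))"
    using ln_derivative_chain[OF multigamma_step_analytic[OF f2] pos[OF f2]] by metis
  define n where "n = Suc d + 1"
  have F1n: "0 \<le> F1 n x" if "0 < x" for x
    using conv[OF f1 that] higher_deriv_chain[of n F1 "\<lambda>t. ln (Re (f1 (of_real t)))" x] F1 that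
    by (simp add: n_def)
  have F2n: "(\<lambda>k. F2 n (x + real k)) \<longlonglongrightarrow> 0" if "0 < x" for x
  proof -
    have "(deriv ^^ n) (\<lambda>t. ln (Re (f2 (of_real t)))) (x + real k) = F2 n (x + real k)" for k
      by (rule higher_deriv_chain) (use F2 that in auto)
    then show ?thesis using lim[OF that] by (simp add: n_def)
  qed
  define h where "h = (\<lambda>j x. F1 j x - F2 j x)"
  have h: "(h j has_real_derivative h (Suc j) x) (at x)" if "0 < x" for j x
    unfolding h_def using F1(1) F2(1) that by (intro derivative_intros) auto
  have ln_rec: "ln (Re (f (of_real (x + 1)))) = ln (Re (g (of_real x))) + ln (Re (f (of_real x)))"
    if "multigamma_step (Suc d) g f" "0 < x" for f and x :: real
  proof -
    note e = multigamma_step_recurrence[OF that(1) g that(2)]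
    note p = pos[OF that] pos[OF that(1), of "x + 1"]
    from p that have "g (of_real x) = f (of_real (x + 1)) / f (of_real x)" unfolding e by auto
    then have r: "g (of_real x) \<in> \<real>" using p that by auto
    have m: "Re (f (of_real (x + 1))) = Re (g (of_real x)) * Re (f (of_real x))"
      using e r p that by (auto elim!: Reals_cases)
    have "0 < Re (f (of_real (x + 1)))" "0 < Re (f (of_real x))" using p that by simp_all
    moreover from this have "0 < Re (g (of_real x))" unfolding m by (rule zero_less_mult_pos2)
    ultimately show ?thesis unfolding m by (intro ln_mult_pos)
  qed
  have per: "h 0 (x + 1) = h 0 x" if "0 < x" for x
    using ln_rec[OF f1 that] ln_rec[OF f2 that] that by (simp add: h_def F1 F2)
  have perk: "h n (x + real k) = h n x" if "0 < x" for x k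
  proof (induction k)
    case (Suc k)
    then show ?case using periodic_higher_deriv[OF h per, of "x + real k" n] that by (simp add: algebra_simps)
  qed simp
  have "0 \<le> h n x" if "0 < x" for x
  proof -
    have "(\<lambda>k. - F2 n (x + real k)) \<longlonglongrightarrow> - 0" by (intro tendsto_minus F2n that)
    moreover have "- F2 n (x + real k) \<le> h n x" for k
      using perk[OF that, of k] F1n[of "x + real k"] that by (simp add: h_def)
    ultimately show ?thesis by (auto intro: LIMSEQ_le_const2)
  qed
  then have nn: "0 \<le> h (Suc (Suc d)) x" if "0 < x" for x using that by (simp add: n_def)
  have "h 0 x = h 0 1" if "0 < x" for x
    by (rule periodic_higher_deriv_nonneg_imp_constant[of h "Suc d", OF h per nn that]) simp_all
  moreover have "h 0 1 = 0" using multigamma_stepD(2)[OF f1] multigamma_stepD(2)[OF f2] F1(2)[of 1] F2(2)[of 1]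
    by (simp add: h_def)
  ultimately have "ln (Re (f1 (of_real x))) = ln (Re (f2 (of_real x)))" if "0 < x" for x
    using that by (simp add: h_def F1 F2)
  then have eq: "f1 (of_real x) = f2 (of_real x)" if "0 < x" for x
    using that pos[OF f1 that] pos[OF f2 that] by (metis ln_inj_iff of_real_Re)
  show ?thesis
  proof (rule nicely_meromorphic_eqI[where a = 1])
    have "(1::complex) islimpt of_real ` {0<..}"
      unfolding islimpt_approachable
    proof (intro allI impI)
      fix e :: real assume "0 < e"
      then show "\<exists>w\<in>of_real ` {0<..}. w \<noteq> 1 \<and> dist w (1::complex) < e"
        by (intro bexI[of _ "of_real (1 + e / 2)"] imageI) (auto simp: dist_norm)
    qed
    then show "frequently (\<lambda>z. f1 z = f2 z) (at 1)"
      by (auto simp: islimpt_conv_frequently_at eq elim!: frequently_elim1)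
  qed (use multigamma_stepD(1) f1 f2 in blast)+
qed

section \<open>Infinite products\<close>

lemma norm_power_minus_1_le:
  fixes u :: "'a :: {real_normed_div_algebra, comm_ring_1}"
  shows "norm ((1 + u) ^ k - 1) \<le> real k * norm u * exp (real k * norm u)"
proof -
  have "norm ((1 + u) ^ k - 1) \<le> (1 + norm u) ^ k - 1"
    using norm_prod_minus1_le_prod_minus1[of "\<lambda>_. u" "{..<k}"] by simp
  also have "(1 + norm u) ^ k \<le> exp (norm u) ^ k"
    by (intro power_mono exp_ge_add_one_self_aux) auto
  also have "exp (norm u) ^ k = exp (real k * norm u)" by (simp add: exp_of_nat_mult)
  also have "exp (real k * norm u) - 1 \<le> real k * norm u * exp (real k * norm u)"
  proof -
    define t where "t = real k * norm u"
    have "1 - t \<le> exp (- t)" using exp_ge_add_one_self[of "- t"] by simp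
    then have "(1 - t) * exp t \<le> exp (- t) * exp t" by (intro mult_right_mono) auto
    then show ?thesis by (simp add: t_def[symmetric] algebra_simps flip: exp_add)
  qed
  finally show ?thesis by simp
qed

text \<open>The partial products converge locally uniformly.\<close>

lemma holomorphic_prodinf:
  fixes f :: "nat \<Rightarrow> complex \<Rightarrow> complex"
  assumes U: "open U" and hol: "\<And>n. f n holomorphic_on U"
    and bound: "\<And>K. compact K \<Longrightarrow> K \<subseteq> U \<Longrightarrow> \<exists>M. summable M \<and> (\<forall>n. \<forall>x\<in>K. norm (f n x - 1) \<le> M n)"
  shows "(\<lambda>x. \<Prod>n. f n x) holomorphic_on U"
proof (rule holomorphic_uniform_sequence[OF U])
  show "(\<lambda>x. \<Prod>k<n. f k x) holomorphic_on U" for n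
    by (intro holomorphic_intros hol)
  fix z assume "z \<in> U"
  then obtain d where d: "0 < d" "cball z d \<subseteq> U" using U open_contains_cball by blast
  obtain M where M: "summable M" "\<And>n x. x \<in> cball z d \<Longrightarrow> norm (f n x - 1) \<le> M n"
    using bound[of "cball z d"] d by auto
  have "uniformly_convergent_on (cball z d) (\<lambda>N x. \<Sum>n<N. norm (f n x - 1))"
    by (rule Weierstrass_m_test'[of _ _ M]) (use M in auto)
  then have uc: "uniformly_convergent_on (cball z d) (\<lambda>N x. \<Prod>n<N. f n x)"
    using d hol by (intro uniformly_convergent_on_prod')
      (auto intro: holomorphic_on_imp_continuous_on holomorphic_on_subset)
  then obtain l where l: "uniform_limit (cball z d) (\<lambda>N x. \<Prod>n<N. f n x) l sequentially"
    by (auto simp: uniformly_convergent_on_def)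
  have "l x = (\<Prod>n. f n x)" if x: "x \<in> cball z d" for x
  proof -
    have "summable (\<lambda>n. norm (f n x - 1))"
      by (rule summable_comparison_test[OF _ M(1)]) (use M(2)[OF x] in auto)
    then have "convergent_prod (\<lambda>n. f n x)"
      by (intro abs_convergent_prod_imp_convergent_prod summable_imp_abs_convergent_prod)
    then have "(\<lambda>N. \<Prod>n\<le>N. f n x) \<longlonglongrightarrow> (\<Prod>n. f n x)" by (rule convergent_prod_LIMSEQ)
    moreover have "(\<lambda>N. \<Prod>n<Suc N. f n x) \<longlonglongrightarrow> l x"
      using tendsto_uniform_limitI[OF l x] by (rule LIMSEQ_Suc)
    ultimately show ?thesis using LIMSEQ_unique by (simp add: lessThan_Suc_atMost)
  qed
  then have "uniform_limit (cball z d) (\<lambda>N x. \<Prod>n<N. f n x) (\<lambda>x. \<Prod>n. f n x) sequentially"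
    using uniform_limit_cong'[of "cball z d" "\<lambda>N x. \<Prod>n<N. f n x" "\<lambda>N x. \<Prod>n<N. f n x" l "\<lambda>x. \<Prod>n. f n x"] l by auto
  then show "\<exists>d>0. cball z d \<subseteq> U \<and> uniform_limit (cball z d) (\<lambda>N x. \<Prod>n<N. f n x) (\<lambda>x. \<Prod>n. f n x) sequentially"
    using d by blast
qed

lemma summable_linear_power:
  fixes r :: real assumes "\<bar>r\<bar> < 1" shows "summable (\<lambda>n. real (Suc n) * r ^ n)"
proof -
  have "summable (\<lambda>n. diffs (\<lambda>_. 1) n * r ^ n)"
    by (rule termdiff_converges[of r 1]) (use assms in \<open>auto intro: summable_geometric\<close>)
  then show ?thesis by (simp add: diffs_def)
qed

text \<open>The infinite \<open>q\<close>-Pochhammer symbol \<open>(a;q)\<^sub>\<infinity>\<close>.\<close>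

definition qpochhammer :: "complex \<Rightarrow> complex \<Rightarrow> complex" where
  "qpochhammer a q = (\<Prod>n. 1 - a * q ^ n)"

text \<open>At \<open>a = 1\<close> this is the reciprocal of the MacMahon function.\<close>

definition macmahon :: "complex \<Rightarrow> complex \<Rightarrow> complex" where
  "macmahon a q = (\<Prod>n. (1 - a * q ^ Suc n) ^ Suc n)"

text \<open>A bound for the factors of both kinds of products that does not depend on \<open>a\<close> and \<open>q\<close>, for
\<open>a\<close> in a bounded set and \<open>q\<close> bounded away from the unit circle.\<close>

lemma macmahon_factor_bound:
  fixes a q :: complex
  assumes "norm a \<le> A" "norm q \<le> r" "r < 1" "j \<le> Suc n"
  shows "norm ((1 - a * q ^ n) ^ j - 1) \<le> (A * exp (A * (\<Sum>i. real (Suc i) * r ^ i))) * (real (Suc n) * r ^ n)"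
proof -
  have A: "0 \<le> A" using norm_ge_zero assms(1) by (rule order_trans)
  have "0 \<le> r" using norm_ge_zero assms(2) by (rule order_trans)
  then have r: "0 \<le> r" "\<bar>r\<bar> < 1" using assms(3) by auto
  let ?S = "\<Sum>i. real (Suc i) * r ^ i"
  have u: "norm (- (a * q ^ n)) \<le> A * r ^ n"
    unfolding norm_minus_cancel norm_mult norm_power using assms A r by (intro mult_mono power_mono) auto
  have t: "real j * norm (- (a * q ^ n)) \<le> A * (real (Suc n) * r ^ n)"
  proof -
    have "real j * norm (- (a * q ^ n)) \<le> real (Suc n) * (A * r ^ n)"
      using u assms(4) by (intro mult_mono) auto
    then show ?thesis by (simp add: mult_ac)
  qed
  have "real (Suc n) * r ^ n \<le> ?S"
    using sum_le_suminf[OF summable_linear_power[OF r(2)], of "{n}"] r by simp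
  then have "A * (real (Suc n) * r ^ n) \<le> A * ?S" using A by (rule mult_left_mono)
  then have e: "exp (real j * norm (- (a * q ^ n))) \<le> exp (A * ?S)" using t by (simp del: of_nat_Suc)
  have "norm ((1 - a * q ^ n) ^ j - 1) \<le> real j * norm (- (a * q ^ n)) * exp (real j * norm (- (a * q ^ n)))"
    using norm_power_minus_1_le[of "- (a * q ^ n)" j] by simp
  also have "\<dots> \<le> (A * (real (Suc n) * r ^ n)) * exp (A * ?S)"
    by (rule mult_mono[OF t e]) (use A r in auto)
  finally show ?thesis by (simp add: mult_ac)
qed

text \<open>The exponents \<open>j n\<close> cover \<open>qpochhammer\<close> (with \<open>j n = 1\<close>) and \<open>macmahon\<close> (with
\<open>j n = Suc n\<close>) at once.\<close>

lemma holomorphic_weighted_prod: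
  assumes U: "open U" and a: "a holomorphic_on U" and q: "q holomorphic_on U"
    and q1: "\<And>u. u \<in> U \<Longrightarrow> norm (q u) < 1" and j: "\<And>n. j n \<le> Suc n"
  shows "(\<lambda>u. \<Prod>n. (1 - a u * q u ^ n) ^ j n) holomorphic_on U"
proof (rule holomorphic_prodinf[OF U])
  show "(\<lambda>u. (1 - a u * q u ^ n) ^ j n) holomorphic_on U" for n
    by (intro holomorphic_intros a q)
  fix K assume K: "compact K" "K \<subseteq> U"
  show "\<exists>M. summable M \<and> (\<forall>n. \<forall>x\<in>K. norm ((1 - a x * q x ^ n) ^ j n - 1) \<le> M n)"
  proof (cases "K = {}")
    case False
    have "compact (a ` K)" using K a by (meson compact_continuous_image continuous_on_subset holomorphic_on_imp_continuous_on)
    then obtain A where A: "\<And>u. u \<in> K \<Longrightarrow> norm (a u) \<le> A"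
      using compact_imp_bounded bounded_iff by (metis image_eqI)
    have "continuous_on K (\<lambda>u. norm (q u))"
      using K q by (intro continuous_on_norm) (meson continuous_on_subset holomorphic_on_imp_continuous_on)
    then obtain u0 where u0: "u0 \<in> K" "\<And>u. u \<in> K \<Longrightarrow> norm (q u) \<le> norm (q u0)"
      using continuous_attains_sup[OF K(1) False] by blast
    define r where "r = norm (q u0)"
    have r: "r < 1" using q1 u0 K by (auto simp: r_def)
    let ?M = "\<lambda>n. (A * exp (A * (\<Sum>i. real (Suc i) * r ^ i))) * (real (Suc n) * r ^ n)"
    have "summable ?M" using r by (intro summable_mult summable_linear_power) (auto simp: r_def)
    moreover have "norm ((1 - a x * q x ^ n) ^ j n - 1) \<le> ?M n" if "x \<in> K" for x n
      using that A u0 r j by (intro macmahon_factor_bound) (auto simp: r_def)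
    ultimately show ?thesis by blast
  qed (use summable_zero in auto)
qed

lemma convergent_weighted_prod:
  fixes a q :: complex
  assumes "norm q < 1" "\<And>n. j n \<le> Suc n"
  shows "convergent_prod (\<lambda>n. (1 - a * q ^ n) ^ j n)"
proof -
  have "summable (\<lambda>n. norm ((1 - a * q ^ n) ^ j n - 1))"
  proof (rule summable_comparison_test)
    show "summable (\<lambda>n. (norm a * exp (norm a * (\<Sum>i. real (Suc i) * norm q ^ i))) * (real (Suc n) * norm q ^ n))"
      using assms by (intro summable_mult summable_linear_power) auto
    show "\<exists>N. \<forall>n\<ge>N. norm (norm ((1 - a * q ^ n) ^ j n - 1)) \<le> (norm a * exp (norm a * (\<Sum>i. real (Suc i) * norm q ^ i))) * (real (Suc n) * norm q ^ n)"
      using macmahon_factor_bound[OF order_refl order_refl assms(1,2)]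
      by (simp only: real_norm_def abs_norm_cancel) blast
  qed
  then show ?thesis by (intro abs_convergent_prod_imp_convergent_prod summable_imp_abs_convergent_prod)
qed

lemma convergent_qpochhammer: "norm (q :: complex) < 1 \<Longrightarrow> convergent_prod (\<lambda>n. 1 - a * q ^ n)"
  using convergent_weighted_prod[of q "\<lambda>_. 1" a] by simp

lemma convergent_macmahon: "norm (q :: complex) < 1 \<Longrightarrow> convergent_prod (\<lambda>n. (1 - a * q ^ Suc n) ^ Suc n)"
  using convergent_weighted_prod[of q Suc "a * q"] by (simp add: mult_ac)

lemma holomorphic_qpochhammer:
  assumes "open U" "a holomorphic_on U" "q holomorphic_on U" "\<And>u. u \<in> U \<Longrightarrow> norm (q u) < 1"
  shows "(\<lambda>u. qpochhammer (a u) (q u)) holomorphic_on U"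
  using holomorphic_weighted_prod[OF assms, of "\<lambda>_. 1"] by (simp add: qpochhammer_def)

lemma holomorphic_macmahon:
  assumes "open U" "a holomorphic_on U" "q holomorphic_on U" "\<And>u. u \<in> U \<Longrightarrow> norm (q u) < 1"
  shows "(\<lambda>u. macmahon (a u) (q u)) holomorphic_on U"
  using holomorphic_weighted_prod[OF assms(1) _ assms(3,4), of "\<lambda>u. a u * q u" Suc] assms(2,3)
  by (simp add: macmahon_def mult_ac holomorphic_on_mult)

lemma prodinf_split_first:
  fixes f :: "nat \<Rightarrow> complex"
  assumes "convergent_prod f" shows "prodinf f = f 0 * (\<Prod>n. f (Suc n))"
  using has_prod_ignore_initial_segment'[OF assms, of 1] has_prod_unique by (fastforce simp: has_prod_iff)

lemma qpochhammer_rec: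
  assumes "norm q < 1" shows "qpochhammer a q = (1 - a) * qpochhammer (a * q) q"
  using prodinf_split_first[OF convergent_qpochhammer[OF assms, of a]]
  by (simp only: qpochhammer_def power_0 mult_1_right power_Suc mult.assoc)

text \<open>Splitting one factor off each power \<open>(1 - a q\<^sup>n\<^sup>+\<^sup>1)\<^sup>n\<^sup>+\<^sup>1\<close> leaves the product for \<open>aq\<close>.\<close>

lemma macmahon_rec:
  assumes "norm q < 1" shows "macmahon a q = qpochhammer (a * q) q * macmahon (a * q) q"
proof -
  have conv: "convergent_prod (\<lambda>n. (1 - a * q * q ^ n) ^ n)"
    by (rule convergent_weighted_prod) (use assms in auto)
  have "macmahon (a * q) q = (\<Prod>n. (1 - a * q * q ^ n) ^ n)"
    using prodinf_split_first[OF conv] by (simp add: macmahon_def mult_ac)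
  then have "qpochhammer (a * q) q * macmahon (a * q) q = (\<Prod>n. (1 - a * q * q ^ n) * (1 - a * q * q ^ n) ^ n)"
    unfolding qpochhammer_def by (simp add: prodinf_mult[OF convergent_qpochhammer[OF assms] conv])
  then show ?thesis by (simp add: macmahon_def mult_ac)
qed

lemma qpochhammer_nonzero:
  assumes "norm q < 1" "\<And>n. a * q ^ n \<noteq> 1" shows "qpochhammer a q \<noteq> 0"
  unfolding qpochhammer_def
  by (rule prodinf_nonzero[OF convergent_qpochhammer[OF assms(1)]]) (metis assms(2) right_minus_eq)

lemma macmahon_nonzero:
  assumes "norm q < 1" "\<And>n. a * q ^ Suc n \<noteq> 1" shows "macmahon a q \<noteq> 0"
  unfolding macmahon_def
proof (rule prodinf_nonzero[OF convergent_macmahon[OF assms(1)]])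
  show "(1 - a * q ^ Suc n) ^ Suc n \<noteq> 0" for n using assms(2)[of n] by simp
qed

lemma norm_power_Suc_less_1: "norm (q :: complex) < 1 \<Longrightarrow> norm (q ^ Suc n) < 1"
  unfolding norm_power by (intro power_less_one_iff[THEN iffD2]) auto

lemma power_Suc_neq_1: "norm (q :: complex) < 1 \<Longrightarrow> q ^ Suc n \<noteq> 1"
  using norm_power_Suc_less_1[of q n] by force

lemma macmahon_1_nonzero: "norm q < 1 \<Longrightarrow> macmahon 1 q \<noteq> 0"
  using macmahon_nonzero[of q 1] power_Suc_neq_1[of q] by simp

lemma qpochhammer_self_nonzero: "norm q < 1 \<Longrightarrow> qpochhammer q q \<noteq> 0"
  using qpochhammer_nonzero[of q q] power_Suc_neq_1[of q] by simp

lemma qpochhammer_0 [simp]: "qpochhammer 0 q = 1" by (simp add: qpochhammer_def)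
lemma macmahon_0 [simp]: "macmahon 0 q = 1" by (simp add: macmahon_def)

lemma Ln_one_minus_power_bound:
  assumes r: "0 \<le> r" "r < 1"
  shows "eventually (\<lambda>n. \<forall>u. norm u \<le> r \<longrightarrow> norm (Ln (1 - u ^ Suc n)) \<le> 2 * r ^ Suc n) sequentially"
proof -
  have "(\<lambda>n. r ^ Suc n) \<longlonglongrightarrow> 0" 
    using tendsto_mult_right_zero[OF LIMSEQ_realpow_zero[OF r], of r] by (simp add: mult.commute)
  then have "eventually (\<lambda>n. r ^ Suc n < 1 / 2) sequentially" by (rule order_tendstoD) simp
  then show ?thesis
  proof eventually_elim
    case (elim n)
    show ?case
    proof (intro allI impI)
      fix u :: complex assume "norm u \<le> r"
      then have *: "norm (- (u ^ Suc n)) \<le> r ^ Suc n"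
        unfolding norm_minus_cancel norm_power by (intro power_mono) auto
      then have "norm (Ln (1 + - (u ^ Suc n))) \<le> 2 * norm (- (u ^ Suc n))" using elim by (intro norm_Ln_le) linarith
      also have "\<dots> \<le> 2 * r ^ Suc n" using * by simp
      finally show "norm (Ln (1 - u ^ Suc n)) \<le> 2 * r ^ Suc n" by simp
    qed
  qed
qed

lemma summable_twice_power_Suc: "0 \<le> r \<Longrightarrow> r < 1 \<Longrightarrow> summable (\<lambda>n. 2 * r ^ Suc n :: real)"
  by (intro summable_mult) (simp add: summable_geometric summable_mult)

lemma Ln_one_minus_power_summable:
  assumes "norm q < 1" shows "summable (\<lambda>n. Ln (1 - q ^ Suc n))"
proof (rule summable_comparison_test_ev)
  show "eventually (\<lambda>n. norm (Ln (1 - q ^ Suc n)) \<le> 2 * norm q ^ Suc n) sequentially"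
    using Ln_one_minus_power_bound[OF norm_ge_zero assms] by (rule eventually_mono) blast
  show "summable (\<lambda>n. 2 * norm q ^ Suc n)" using assms by (intro summable_twice_power_Suc) auto
qed

lemma holomorphic_suminf_Ln: "(\<lambda>q. \<Sum>n. Ln (1 - q ^ Suc n)) holomorphic_on ball 0 1"
proof (rule holomorphic_uniform_sequence)
  have ne: "1 - q ^ Suc n \<notin> \<real>\<^sub>\<le>\<^sub>0" if "q \<in> ball 0 1" for q :: complex and n
  proof -
    have "norm (q ^ Suc n) < 1"
      using that by (intro norm_power_Suc_less_1) simp
    then have "Re (q ^ Suc n) < 1" using complex_Re_le_cmod le_less_trans by blast
    then show ?thesis by (auto simp: complex_nonpos_Reals_iff simp del: power_Suc)
  qed
  show "(\<lambda>q. \<Sum>k<n. Ln (1 - q ^ Suc k)) holomorphic_on ball 0 1" for n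
    using ne by (intro holomorphic_intros) auto
  fix z :: complex assume "z \<in> ball 0 1"
  then obtain d where d: "0 < d" "cball z d \<subseteq> ball 0 1" using open_contains_cball open_ball by blast
  obtain u0 where u0: "u0 \<in> cball z d" "\<And>u. u \<in> cball z d \<Longrightarrow> norm u \<le> norm u0"
    using continuous_attains_sup[of "cball z d" norm, OF _ _ continuous_on_norm[OF continuous_on_id]] d by auto
  define r where "r = norm u0"
  have r: "0 \<le> r" "r < 1" using u0 d by (auto simp: r_def)
  have "eventually (\<lambda>n. \<forall>u\<in>cball z d. norm (Ln (1 - u ^ Suc n)) \<le> 2 * r ^ Suc n) sequentially"
    using Ln_one_minus_power_bound[OF r] by (rule eventually_mono) (use u0 in \<open>auto simp: r_def\<close>)
  moreover have "summable (\<lambda>n. 2 * r ^ Suc n)" using r by (rule summable_twice_power_Suc)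
  ultimately have "uniform_limit (cball z d) (\<lambda>n u. \<Sum>k<n. Ln (1 - u ^ Suc k)) (\<lambda>u. \<Sum>n. Ln (1 - u ^ Suc n)) sequentially"
    by (rule Weierstrass_m_test_ev)
  then show "\<exists>d>0. cball z d \<subseteq> ball 0 1 \<and> uniform_limit (cball z d) (\<lambda>n u. \<Sum>k<n. Ln (1 - u ^ Suc k)) (\<lambda>u. \<Sum>n. Ln (1 - u ^ Suc n)) sequentially"
    using d by blast
qed auto

text \<open>So \<open>qpoch_inf_powr q s\<close> is one of the values of the power \<open>((q;q)\<^sub>\<infinity>)\<^sup>s\<close>.\<close>

lemma exp_suminf_Ln:
  assumes "norm q < 1" shows "exp (\<Sum>n. Ln (1 - q ^ Suc n)) = qpochhammer q q"
proof -
  have "exp (Ln (1 - q ^ Suc n)) = 1 - q * q ^ n" for n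
    using power_Suc_neq_1[OF assms, of n] by simp
  then show ?thesis
    using prodinf_exp[OF Ln_one_minus_power_summable[OF assms]] by (simp add: qpochhammer_def)
qed

section \<open>Logarithms of the products for real arguments\<close>

text \<open>The term for \<open>m = 0\<close> is \<open>0\<close> by the convention for division by zero, as it should be for a
logarithm.\<close>

definition qlog_coeff :: "nat \<Rightarrow> real \<Rightarrow> nat \<Rightarrow> real" where
  "qlog_coeff d r m = 1 / (real m * (1 - r ^ m) ^ d)"

text \<open>The series of \<open>- ln (1 - b)\<close>, \<open>- ln (b;r)\<^sub>\<infinity>\<close> and \<open>- ln (\<Prod>n. (1 - b r\<^sup>n)\<^sup>n\<^sup>+\<^sup>1)\<close> for
\<open>d = 0, 1, 2\<close>: each factor \<open>1 / (1 - r\<^sup>m)\<close> is a sum over a further geometric series.\<close>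

definition qlog :: "nat \<Rightarrow> real \<Rightarrow> real \<Rightarrow> real" where
  "qlog d r b = (\<Sum>m. qlog_coeff d r m * b ^ m)"

lemma qlog_coeff_0 [simp]: "qlog_coeff d r 0 = 0"
  by (simp add: qlog_coeff_def)

lemma one_minus_power_ge:
  fixes r :: real assumes "0 < r" "r < 1" "0 < m" shows "1 - r \<le> 1 - r ^ m"
  using power_decreasing[of 1 m r] assms by simp

lemma qlog_coeff_nonneg: "0 < r \<Longrightarrow> r < 1 \<Longrightarrow> 0 \<le> qlog_coeff d r m"
  unfolding qlog_coeff_def
  by (intro divide_nonneg_nonneg mult_nonneg_nonneg zero_le_power) (auto simp: power_le_one)

lemma summable_qlog:
  assumes r: "0 < r" "r < 1" and b: "\<bar>b\<bar> < 1"
  shows "summable (\<lambda>m. qlog_coeff d r m * b ^ m)"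
proof (rule summable_comparison_test')
  show "summable (\<lambda>m. 1 / (1 - r) ^ d * \<bar>b\<bar> ^ m)"
    using b by (intro summable_mult summable_geometric) auto
  show "norm (qlog_coeff d r m * b ^ m) \<le> 1 / (1 - r) ^ d * \<bar>b\<bar> ^ m" for m
  proof -
    have "qlog_coeff d r m \<le> 1 / (1 - r) ^ d"
    proof (cases "m = 0")
      case False
      have "1 * (1 - r) ^ d \<le> real m * (1 - r ^ m) ^ d"
        using False r one_minus_power_ge[of r m] by (intro mult_mono power_mono) auto
      then show ?thesis unfolding qlog_coeff_def using r by (intro frac_le) auto
    qed (use r in simp)
    then show ?thesis
      unfolding real_norm_def abs_mult power_abs using qlog_coeff_nonneg[OF r, of d m]
      by (intro mult_right_mono) auto
  qed
qed

lemma qlog_at_0 [simp]: "qlog d r 0 = 0"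
  unfolding qlog_def by (subst powser_zero) simp

text \<open>Replacing \<open>b\<close> by \<open>br\<close> multiplies the coefficient of \<open>b\<^sup>m\<close> by \<open>r\<^sup>m\<close>, and \<open>1 - r\<^sup>m\<close> cancels one of the
factors of the denominator.\<close>

lemma qlog_rec:
  assumes r: "0 < r" "r < 1" and b: "\<bar>b\<bar> < 1"
  shows "qlog (Suc d) r b = qlog (Suc d) r (b * r) + qlog d r b"
proof -
  have br: "\<bar>b * r\<bar> < 1" using b r by (simp add: abs_mult) (metis abs_ge_zero less_trans mult_less_cancel_left2 mult_zero_left not_less order_le_less)
  have "qlog (Suc d) r (b * r) + qlog d r b = (\<Sum>m. qlog_coeff (Suc d) r m * (b * r) ^ m + qlog_coeff d r m * b ^ m)"
    unfolding qlog_def by (rule suminf_add) (intro summable_qlog r b br)+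
  also have "\<dots> = qlog (Suc d) r b"
    unfolding qlog_def
  proof (rule suminf_cong)
    fix m
    show "qlog_coeff (Suc d) r m * (b * r) ^ m + qlog_coeff d r m * b ^ m = qlog_coeff (Suc d) r m * b ^ m"
    proof (cases "m = 0")
      case False
      then have "1 - r ^ m \<noteq> 0" using one_minus_power_ge[of r m] r by simp
      then have e: "qlog_coeff d r m = (1 - r ^ m) * qlog_coeff (Suc d) r m"
        by (simp add: qlog_coeff_def)
      show ?thesis unfolding e by (simp add: power_mult_distrib algebra_simps)
    qed simp
  qed
  finally show ?thesis by simp
qed

lemma qlog_0_eq_ln:
  assumes b: "\<bar>b\<bar> < 1" shows "qlog 0 r b = - ln (1 - b)"
proof -
  have "(\<lambda>n. - ((- (- b)) ^ n) / of_nat n) sums ln (1 + - b)"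
    by (rule ln_series') (use b in simp)
  then have "(\<lambda>n. - (- (b ^ n / real n))) sums - ln (1 - b)" by (intro sums_minus) simp
  then show ?thesis by (simp add: qlog_def qlog_coeff_def sums_iff)
qed

lemma isCont_qlog:
  assumes r: "0 < r" "r < 1" shows "isCont (qlog d r) 0"
proof -
  have "isCont (\<lambda>b. \<Sum>m. qlog_coeff d r m * b ^ m) 0"
    by (rule isCont_powser[of _ "1/2"]) (use summable_qlog[OF r, of "1/2"] in auto)
  then show ?thesis by (simp add: qlog_def[abs_def])
qed

text \<open>Functions with the same \<open>q\<close>-difference equation and the same value at 0 agree: their quotient is
invariant under \<open>b \<mapsto> br\<close>, and \<open>b r\<^sup>n\<close> tends to 0. This replaces expanding the logarithms of the
products into double series.\<close>

lemma eq_of_q_shift_ratio: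
  fixes F G :: "real \<Rightarrow> complex"
  assumes r: "0 < r" "r < 1" and cont: "isCont F 0" "isCont G 0" and one: "F 0 = 1" "G 0 = 1"
    and ratio: "\<And>b. \<bar>b\<bar> < 1 \<Longrightarrow> G b \<noteq> 0 \<and> F b * G (b * r) = F (b * r) * G b"
    and b: "\<bar>b\<bar> < 1"
  shows "F b = G b"
proof -
  have small: "\<bar>b * r ^ n\<bar> < 1" for n
  proof -
    have "\<bar>b * r ^ n\<bar> \<le> \<bar>b\<bar> * 1" unfolding abs_mult using r by (intro mult_left_mono) (auto simp: power_le_one power_abs)
    then show ?thesis using b by simp
  qed
  have const: "F (b * r ^ n) / G (b * r ^ n) = F b / G b" for n
  proof (induction n)
    case (Suc n)
    have "F (b * r ^ n * r) / G (b * r ^ n * r) = F (b * r ^ n) / G (b * r ^ n)"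
      using ratio[OF small[of n]] ratio[OF small[of "Suc n"]] by (simp add: field_simps)
    then show ?case using Suc by (simp add: mult_ac)
  qed simp
  have "(\<lambda>n. b * r ^ n) \<longlonglongrightarrow> b * 0" using r by (intro tendsto_mult LIMSEQ_realpow_zero tendsto_const) auto
  moreover have "isCont (\<lambda>b. F b / G b) 0" using cont one by (intro isCont_divide) auto
  ultimately have "(\<lambda>n. F (b * r ^ n) / G (b * r ^ n)) \<longlonglongrightarrow> F 0 / G 0"
    by (intro isCont_tendsto_compose[where g = "\<lambda>b. F b / G b"]) auto
  then have "F b / G b = 1" unfolding const one by (simp add: LIMSEQ_const_iff)
  then show ?thesis using ratio[OF b] by simp
qed

lemma isCont_of_real_compose:
  assumes "f holomorphic_on UNIV" shows "isCont (\<lambda>b. f (of_real b)) x"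
proof -
  have "continuous_on UNIV f" using assms holomorphic_on_imp_continuous_on by blast
  then have "isCont f (of_real x)" by (simp add: continuous_on_eq_continuous_at)
  then show ?thesis by (intro isCont_o2[of _ of_real f]) auto
qed

lemma qpochhammer_of_real:
  assumes r: "0 < r" "r < 1" and b: "\<bar>b\<bar> < 1"
  shows "qpochhammer (of_real b) (of_real r) = of_real (exp (- qlog 1 r b))"
proof (rule eq_of_q_shift_ratio[OF r _ _ _ _ _ b, where F = "\<lambda>b. qpochhammer (of_real b) (of_real r)"])
  show "isCont (\<lambda>b. qpochhammer (of_real b) (of_real r)) 0"
    by (rule isCont_of_real_compose, rule holomorphic_qpochhammer) (use r in auto)
  show "isCont (\<lambda>b. complex_of_real (exp (- qlog 1 r b))) 0"
    by (intro continuous_intros isCont_qlog r)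
  fix b :: real assume b: "\<bar>b\<bar> < 1"
  have "exp (- qlog 1 r b) = (1 - b) * exp (- qlog 1 r (b * r))"
  proof -
    have "- qlog 1 r b = ln (1 - b) + - qlog 1 r (b * r)"
      using qlog_rec[OF r b, of 0] b by (simp add: qlog_0_eq_ln)
    then have "exp (- qlog 1 r b) = exp (ln (1 - b)) * exp (- qlog 1 r (b * r))" by (simp only: exp_add)
    then show ?thesis using b by simp
  qed
  moreover have "qpochhammer (of_real b) (of_real r) = (1 - of_real b) * qpochhammer (of_real (b * r)) (of_real r)"
    using qpochhammer_rec[of "of_real r" "of_real b"] r by simp
  ultimately show "complex_of_real (exp (- qlog 1 r b)) \<noteq> 0 \<and>
      qpochhammer (of_real b) (of_real r) * of_real (exp (- qlog 1 r (b * r))) =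
      qpochhammer (of_real (b * r)) (of_real r) * of_real (exp (- qlog 1 r b))"
    using b by auto
qed auto

text \<open>The argument is \<open>b / r\<close> because the first factor of \<open>macmahon a r\<close> is \<open>1 - ar\<close>.\<close>

lemma macmahon_of_real:
  assumes r: "0 < r" "r < 1" and b: "\<bar>b\<bar> < 1"
  shows "macmahon (of_real (b / r)) (of_real r) = of_real (exp (- qlog 2 r b))"
proof (rule eq_of_q_shift_ratio[OF r _ _ _ _ _ b, where F = "\<lambda>b. macmahon (of_real (b / r)) (of_real r)"])
  have "isCont (\<lambda>b. (\<lambda>a. macmahon (a / of_real r) (of_real r)) (of_real b)) 0"
    by (rule isCont_of_real_compose, rule holomorphic_macmahon) (use r in \<open>auto intro!: holomorphic_intros\<close>)
  then show "isCont (\<lambda>b. macmahon (of_real (b / r)) (of_real r)) 0" by simp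
  show "isCont (\<lambda>b. complex_of_real (exp (- qlog 2 r b))) 0"
    by (intro continuous_intros isCont_qlog r)
  fix b :: real assume b: "\<bar>b\<bar> < 1"
  have "exp (- qlog 2 r b) = exp (- qlog 1 r b) * exp (- qlog 2 r (b * r))"
    using qlog_rec[OF r b, of 1] by (simp add: exp_add[symmetric] numeral_2_eq_2)
  moreover have "macmahon (of_real (b / r)) (of_real r) =
      of_real (exp (- qlog 1 r b)) * macmahon (of_real (b * r / r)) (of_real r)"
    using macmahon_rec[of "of_real r" "of_real (b / r)"] qpochhammer_of_real[OF r b] r by simp
  ultimately show "complex_of_real (exp (- qlog 2 r b)) \<noteq> 0 \<and>
      macmahon (of_real (b / r)) (of_real r) * of_real (exp (- qlog 2 r (b * r))) =
      macmahon (of_real (b * r / r)) (of_real r) * of_real (exp (- qlog 2 r b))"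
    by simp
qed auto

text \<open>The \<open>k\<close>-th derivative of \<open>x \<mapsto> qlog d r (r powr x)\<close>, term by term.\<close>

definition qlog_deriv :: "nat \<Rightarrow> nat \<Rightarrow> real \<Rightarrow> real \<Rightarrow> real" where
  "qlog_deriv d k r x = (\<Sum>m. (real m * ln r) ^ k * qlog_coeff d r m * (r powr x) ^ m)"

lemma powser_powr_deriv:
  fixes c :: "nat \<Rightarrow> real"
  assumes r: "0 < r" "r < 1" and c: "\<And>u. \<bar>u\<bar> < 1 \<Longrightarrow> summable (\<lambda>m. c m * u ^ m)"
  shows "0 < x \<Longrightarrow> ((\<lambda>x. \<Sum>m. c m * (r powr x) ^ m) has_real_derivative
      (\<Sum>m. (real m * ln r * c m) * (r powr x) ^ m)) (at x)"
    and "\<bar>u\<bar> < 1 \<Longrightarrow> summable (\<lambda>m. real m * ln r * c m * u ^ m)"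
proof -
  have diffs: "summable (\<lambda>m. diffs c m * u ^ m)" if "\<bar>u\<bar> < 1" for u
    by (rule termdiff_converges[of u 1]) (use c that in auto)
  have sums: "(\<lambda>m. real m * ln r * c m * u ^ m) sums (u * ln r * (\<Sum>m. diffs c m * u ^ m))" if "\<bar>u\<bar> < 1" for u
  proof -
    have "(\<lambda>m. (u * ln r) * (of_nat m * c m * u ^ (m - Suc 0))) sums ((u * ln r) * (\<Sum>m. diffs c m * u ^ m))"
      by (intro sums_mult diffs_equiv diffs that)
    moreover have "(u * ln r) * (of_nat m * c m * u ^ (m - Suc 0)) = real m * ln r * c m * u ^ m" for m
      by (cases m) auto
    ultimately show ?thesis by simp
  qed
  show "summable (\<lambda>m. real m * ln r * c m * u ^ m)" if "\<bar>u\<bar> < 1" using sums[OF that] sums_summable by blast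
  show "((\<lambda>x. \<Sum>m. c m * (r powr x) ^ m) has_real_derivative
      (\<Sum>m. (real m * ln r * c m) * (r powr x) ^ m)) (at x)" if x: "0 < x"
  proof -
    have u: "\<bar>r powr x\<bar> < 1" using r x by (simp add: powr01_less_one)
    obtain K where K: "r powr x < K" "K < 1" using u dense[of "r powr x" 1] by auto
    have 1: "((\<lambda>u. \<Sum>m. c m * u ^ m) has_real_derivative (\<Sum>m. diffs c m * (r powr x) ^ m)) (at (r powr x))"
      by (rule termdiffs_strong[of _ K]) (use c[of K] K powr_ge_zero[of r x] in auto)
    have 2: "((\<lambda>x. r powr x) has_real_derivative (r powr x * ln r)) (at x)"
      using r unfolding powr_def by (auto intro!: derivative_eq_intros)
    have "((\<lambda>x. \<Sum>m. c m * (r powr x) ^ m) has_real_derivative (\<Sum>m. diffs c m * (r powr x) ^ m) * (r powr x * ln r)) (at x)"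
      using DERIV_chain2[OF 1 2] .
    then show ?thesis using sums[OF u] by (simp add: sums_iff mult_ac)
  qed
qed

lemma summable_qlog_deriv:
  assumes r: "0 < r" "r < 1" and u: "\<bar>u\<bar> < 1"
  shows "summable (\<lambda>m. (real m * ln r) ^ k * qlog_coeff d r m * u ^ m)"
  using u
proof (induction k arbitrary: u)
  case 0
  then show ?case using summable_qlog[OF r] by simp
next
  case (Suc k)
  show ?case
    using powser_powr_deriv(2)[OF r Suc.IH Suc.prems] by (simp add: mult_ac)
qed

lemma qlog_deriv_chain:
  assumes r: "0 < r" "r < 1" and x: "0 < x"
  shows "(qlog_deriv d k r has_real_derivative qlog_deriv d (Suc k) r x) (at x)"
  using powser_powr_deriv(1)[OF r summable_qlog_deriv[OF r] x, of k d]
  by (simp add: qlog_deriv_def[abs_def] mult_ac)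

lemma qlog_deriv_0: "qlog_deriv d 0 r x = qlog d r (r powr x)"
  by (simp add: qlog_deriv_def qlog_def)

text \<open>A power series without constant term, at the argument \<open>r powr (x + n)\<close>.\<close>

lemma qlog_deriv_tendsto_0:
  assumes r: "0 < r" "r < 1"
  shows "(\<lambda>n. qlog_deriv d k r (x + real n)) \<longlonglongrightarrow> 0"
proof -
  let ?c = "\<lambda>m. (real m * ln r) ^ k * qlog_coeff d r m"
  have "isCont (\<lambda>u. \<Sum>m. ?c m * u ^ m) 0"
    by (rule isCont_powser[of _ "1/2"]) (use summable_qlog_deriv[OF r, of "1/2"] in auto)
  moreover have "(\<lambda>n. r powr (x + real n)) \<longlonglongrightarrow> 0"
  proof -
    have "(\<lambda>n. r powr x * r ^ n) \<longlonglongrightarrow> r powr x * 0" using r by (intro tendsto_mult LIMSEQ_realpow_zero tendsto_const) auto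
    then show ?thesis using r by (simp add: powr_add powr_realpow)
  qed
  ultimately have "(\<lambda>n. \<Sum>m. ?c m * (r powr (x + real n)) ^ m) \<longlonglongrightarrow> (\<Sum>m. ?c m * 0 ^ m)"
    by (rule isCont_tendsto_compose)
  then show ?thesis by (simp only: powser_zero qlog_deriv_def) simp
qed

lemma qlog_deriv_even_nonneg:
  assumes r: "0 < r" "r < 1" and x: "0 < x" and k: "even k"
  shows "0 \<le> qlog_deriv d k r x"
  unfolding qlog_deriv_def
proof (intro suminf_nonneg summable_qlog_deriv r)
  show "\<bar>r powr x\<bar> < 1" using r x by (simp add: powr01_less_one)
  fix m
  have "0 \<le> (real m * ln r) ^ k" using k by (rule zero_le_even_power)
  then show "0 \<le> (real m * ln r) ^ k * qlog_coeff d r m * (r powr x) ^ m"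
    using qlog_coeff_nonneg[OF r, of d m] by simp
qed

text \<open>The sign comes from the power of \<open>ln r < 0\<close>.\<close>

lemma qlog_deriv_odd_nonpos:
  assumes r: "0 < r" "r < 1" and x: "0 < x" and k: "odd k"
  shows "qlog_deriv d k r x \<le> 0"
proof -
  have "0 \<le> (\<Sum>m. - ((real m * ln r) ^ k * qlog_coeff d r m * (r powr x) ^ m))"
  proof (intro suminf_nonneg summable_minus summable_qlog_deriv r)
    show "\<bar>r powr x\<bar> < 1" using r x by (simp add: powr01_less_one)
    fix m
    have "real m * ln r \<le> 0" using r by (simp add: mult_nonneg_nonpos)
    then have "(real m * ln r) ^ k \<le> 0" using k by (simp add: power_le_zero_eq odd_pos)
    then show "0 \<le> - ((real m * ln r) ^ k * qlog_coeff d r m * (r powr x) ^ m)"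
      using qlog_coeff_nonneg[OF r, of d m] by (simp add: mult_nonpos_nonneg)
  qed
  also have "\<dots> = - qlog_deriv d k r x"
    unfolding qlog_deriv_def
    by (rule suminf_minus) (use summable_qlog_deriv[OF r] r x in \<open>auto simp: powr01_less_one\<close>)
  finally show ?thesis by simp
qed

section \<open>The q-gamma and q-Barnes functions\<close>

text \<open>Jackson's \<open>q\<close>-gamma function.\<close>

definition qGamma :: "complex \<Rightarrow> complex \<Rightarrow> complex" where
  "qGamma q z = (1 - q) powr (1 - z) * qpochhammer q q / qpochhammer (q powr z) q"

text \<open>Nishizawa's product formula for the \<open>q\<close>-Barnes function.\<close>

definition qBarnes :: "complex \<Rightarrow> complex \<Rightarrow> complex" where
  "qBarnes q z = (1 - q) powr (- ((z - 1) * (z - 2) / 2)) * qpoch_inf_powr q (z - 1) *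
     macmahon (q powr (z - 1)) q / macmahon 1 q"

lemma qpoch_inf_powr_1: "norm q < 1 \<Longrightarrow> qpoch_inf_powr q 1 = qpochhammer q q"
  using exp_suminf_Ln[of q] by (simp add: qpoch_inf_powr_def)

lemma qpoch_inf_powr_add: "qpoch_inf_powr q (s + t) = qpoch_inf_powr q s * qpoch_inf_powr q t"
  by (simp add: qpoch_inf_powr_def exp_add distrib_right)

lemma qpoch_inf_powr_of_real:
  assumes r: "0 < r" "r < 1"
  shows "qpoch_inf_powr (of_real r) (of_real x) = of_real (exp (- x * qlog 1 r r))"
proof -
  have "Ln (1 - of_real r ^ Suc n) = of_real (ln (1 - r ^ Suc n))" for n
  proof -
    have "r ^ Suc n < 1" using r by (intro power_Suc_less_one)
    then have "Ln (of_real (1 - r ^ Suc n)) = of_real (ln (1 - r ^ Suc n))" by (intro Ln_of_real) simp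
    then show ?thesis by simp
  qed
  moreover have "summable (\<lambda>n. Ln (1 - complex_of_real r ^ Suc n))"
    using r by (intro Ln_one_minus_power_summable) simp
  ultimately have S: "(\<Sum>n. Ln (1 - complex_of_real r ^ Suc n)) = of_real (\<Sum>n. ln (1 - r ^ Suc n))"
    by (simp add: suminf_of_real summable_complex_of_real del: power_Suc)
  have "of_real (exp (\<Sum>n. ln (1 - r ^ Suc n))) = complex_of_real (exp (- qlog 1 r r))"
    using exp_suminf_Ln[of "of_real r"] qpochhammer_of_real[OF r, of r] r S by (simp add: exp_of_real)
  then have L: "(\<Sum>n. ln (1 - r ^ Suc n)) = - qlog 1 r r" by (simp only: of_real_eq_iff exp_inj_iff)
  show ?thesis unfolding qpoch_inf_powr_def S L by (simp flip: exp_of_real)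
qed

lemma of_real_powr_of_real: "0 < r \<Longrightarrow> complex_of_real r powr of_real x = of_real (r powr x)"
  by (rule powr_of_real) simp

lemma qGamma_of_real:
  assumes r: "0 < r" "r < 1" and x: "0 < x"
  shows "qGamma (of_real r) (of_real x) =
    of_real (exp ((1 - x) * ln (1 - r) - qlog 1 r r + qlog 1 r (r powr x)))"
proof -
  have u: "\<bar>r powr x\<bar> < 1" using r x by (simp add: powr01_less_one)
  have 1: "(1 - complex_of_real r) powr (1 - of_real x) = of_real (exp ((1 - x) * ln (1 - r)))"
    using of_real_powr_of_real[of "1 - r" "1 - x"] r by (simp add: powr_def)
  have 2: "qpochhammer (of_real r powr of_real x) (of_real r) = of_real (exp (- qlog 1 r (r powr x)))"
    by (simp only: of_real_powr_of_real[OF r(1)] qpochhammer_of_real[OF r u])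
  have 3: "qpochhammer (of_real r) (of_real r) = of_real (exp (- qlog 1 r r))"
    using r by (intro qpochhammer_of_real) auto
  show ?thesis unfolding qGamma_def 1 2 3
    by (simp only: of_real_mult[symmetric] of_real_divide[symmetric] exp_add[symmetric] exp_diff[symmetric])
       (simp add: algebra_simps)
qed

lemma qBarnes_of_real:
  assumes r: "0 < r" "r < 1" and x: "0 < x"
  shows "qBarnes (of_real r) (of_real x) =
    of_real (exp (- ((x - 1) * (x - 2) / 2) * ln (1 - r) - (x - 1) * qlog 1 r r - qlog 2 r (r powr x) + qlog 2 r r))"
proof -
  have u: "\<bar>r powr x\<bar> < 1" using r x by (simp add: powr01_less_one)
  have 1: "(1 - complex_of_real r) powr (- ((of_real x - 1) * (of_real x - 2) / 2)) =
      of_real (exp (- ((x - 1) * (x - 2) / 2) * ln (1 - r)))"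
    using of_real_powr_of_real[of "1 - r" "- ((x - 1) * (x - 2) / 2)"] r by (simp add: powr_def)
  have 2: "qpoch_inf_powr (of_real r) (of_real x - 1) = of_real (exp (- (x - 1) * qlog 1 r r))"
    using qpoch_inf_powr_of_real[OF r, of "x - 1"] by simp
  have 3: "macmahon 1 (of_real r) = of_real (exp (- qlog 2 r r))"
    using macmahon_of_real[OF r, of r] r by simp
  have "complex_of_real r powr (of_real x - 1) = of_real (r powr x / r)"
    using of_real_powr_of_real[of r "x - 1"] r by (simp add: powr_diff)
  then have 4: "macmahon (of_real r powr (of_real x - 1)) (of_real r) = of_real (exp (- qlog 2 r (r powr x)))"
    using macmahon_of_real[OF r u] by simp
  show ?thesis unfolding qBarnes_def 1 2 3 4
    by (simp only: of_real_mult[symmetric] of_real_divide[symmetric] exp_add[symmetric] exp_diff[symmetric])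
       (simp add: algebra_simps)
qed

lemma holomorphic_qpochhammer_powr:
  assumes "norm q < 1" shows "(\<lambda>z. qpochhammer (q powr z) q) holomorphic_on UNIV"
  by (rule holomorphic_qpochhammer) (use assms in \<open>auto intro!: holomorphic_intros\<close>)

text \<open>The recurrence of \<open>qBarnes\<close> involves \<open>qGamma\<close>, whose poles are the zeros of this entire function;
so they are isolated.\<close>

lemma qpochhammer_powr_nonzero_cosparse:
  assumes r: "0 < r" "r < 1"
  shows "\<forall>\<^sub>\<approx>z\<in>UNIV. qpochhammer (of_real r powr z) (of_real r) \<noteq> 0"
proof -
  have hol: "(\<lambda>z. qpochhammer (of_real r powr z) (of_real r)) holomorphic_on UNIV"
    by (rule holomorphic_qpochhammer_powr) (use r in simp)
  have "qpochhammer (of_real r powr 1) (of_real r) \<noteq> 0"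
    using qpochhammer_self_nonzero[of "of_real r"] r by simp
  moreover have "(\<forall>z\<in>UNIV. qpochhammer (of_real r powr z) (of_real r) = 0) \<or> (\<forall>\<^sub>\<approx>z\<in>UNIV. qpochhammer (of_real r powr z) (of_real r) \<noteq> 0)"
    using hol by (intro nicely_meromorphic_imp_constant_or_avoid analytic_on_imp_nicely_meromorphic_on)
      (auto simp: analytic_on_open)
  ultimately show ?thesis by blast
qed

lemma powr_neq_1_cosparse:
  assumes r: "0 < r" "r < 1" shows "\<forall>\<^sub>\<approx>z\<in>UNIV. complex_of_real r powr z \<noteq> 1"
proof -
  have hol: "(\<lambda>z. complex_of_real r powr z) holomorphic_on UNIV" by (intro holomorphic_intros)
  have "complex_of_real r powr 1 \<noteq> 1" using r by simp
  moreover have "(\<forall>z\<in>UNIV. complex_of_real r powr z = 1) \<or> (\<forall>\<^sub>\<approx>z\<in>UNIV. complex_of_real r powr z \<noteq> 1)"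
    using hol by (intro nicely_meromorphic_imp_constant_or_avoid analytic_on_imp_nicely_meromorphic_on)
      (auto simp: analytic_on_open)
  ultimately show ?thesis by blast
qed

text \<open>Two derivatives kill the polynomial part of the logarithm, which has degree 1.\<close>

lemma ln_Re_qGamma_derivs:
  assumes r: "0 < r" "r < 1" and x: "0 < x"
  shows "(deriv ^^ (1 + 1)) (\<lambda>t. ln (Re (qGamma (of_real r) (of_real t)))) x = qlog_deriv 1 2 r x"
proof -
  let ?F = "\<lambda>j x. [(1 - x) * ln (1 - r) - qlog 1 r r + qlog_deriv 1 0 r x,
      - ln (1 - r) + qlog_deriv 1 1 r x, qlog_deriv 1 2 r x] ! j"
  have "(deriv ^^ 2) (\<lambda>t. ln (Re (qGamma (of_real r) (of_real t)))) x = ?F 2 x"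
  proof (rule higher_deriv_chain[where F = ?F and n = 2, OF _ _ x])
    fix j :: nat and x :: real assume "j < 2" and x: "0 < x"
    note D = qlog_deriv_chain[OF r x, of 1 0] qlog_deriv_chain[OF r x, of 1 1]
    from \<open>j < 2\<close> consider "j = 0" | "j = 1" by linarith
    then show "(?F j has_real_derivative ?F (Suc j) x) (at x)"
      by cases (use D in \<open>auto intro!: derivative_eq_intros simp: numeral_2_eq_2\<close>)
  next
    fix x :: real assume "0 < x"
    then show "ln (Re (qGamma (of_real r) (of_real x))) = ?F 0 x"
      using r by (simp add: qGamma_of_real qlog_deriv_0)
  qed
  then show ?thesis by (simp add: numeral_2_eq_2)
qed

text \<open>Three derivatives kill the polynomial part of the logarithm, which has degree 2.\<close>

lemma ln_Re_qBarnes_derivs: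
  assumes r: "0 < r" "r < 1" and x: "0 < x"
  shows "(deriv ^^ (2 + 1)) (\<lambda>t. ln (Re (qBarnes (of_real r) (of_real t)))) x = - qlog_deriv 2 3 r x"
proof -
  let ?F = "\<lambda>j x. [- ((x - 1) * (x - 2) / 2) * ln (1 - r) - (x - 1) * qlog 1 r r - qlog_deriv 2 0 r x + qlog 2 r r,
      - ((2 * x - 3) / 2) * ln (1 - r) - qlog 1 r r - qlog_deriv 2 1 r x,
      - ln (1 - r) - qlog_deriv 2 2 r x, - qlog_deriv 2 3 r x] ! j"
  have "(deriv ^^ 3) (\<lambda>t. ln (Re (qBarnes (of_real r) (of_real t)))) x = ?F 3 x"
  proof (rule higher_deriv_chain[where F = ?F and n = 3, OF _ _ x])
    fix j :: nat and x :: real assume "j < 3" and x: "0 < x"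
    note D = qlog_deriv_chain[OF r x, of 2 0] qlog_deriv_chain[OF r x, of 2 1] qlog_deriv_chain[OF r x, of 2 2]
    from \<open>j < 3\<close> consider "j = 0" | "j = 1" | "j = 2" by linarith
    then show "(?F j has_real_derivative ?F (Suc j) x) (at x)"
      by cases (use D in \<open>auto intro!: derivative_eq_intros simp: numeral_2_eq_2 numeral_3_eq_3 algebra_simps diff_divide_distrib\<close>)
  next
    fix x :: real assume "0 < x"
    then show "ln (Re (qBarnes (of_real r) (of_real x))) = ?F 0 x"
      using r by (simp add: qBarnes_of_real qlog_deriv_0)
  qed
  then show ?thesis by (simp add: numeral_3_eq_3)
qed

text \<open>\<open>qGamma\<close> is the inverse of an entire function, which makes it vanish at its poles as
required.\<close>

lemma multigamma_step_qGamma: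
  assumes r: "0 < r" "r < 1"
  shows "multigamma_step 1 (quantum_multigamma r 0) (qGamma (of_real r))"
  unfolding multigamma_step_def
proof (intro conjI allI impI)
  let ?q = "complex_of_real r"
  have q: "norm ?q < 1" "1 - ?q \<noteq> 0" "?q \<noteq> 0" using r by auto
  define D where "D = (\<lambda>z. qpochhammer (?q powr z) ?q / ((1 - ?q) powr (1 - z) * qpochhammer ?q ?q))"
  have nz: "(1 - ?q) powr w \<noteq> 0" for w using q by (simp add: powr_def)
  have C: "qpochhammer ?q ?q \<noteq> 0" using qpochhammer_self_nonzero q by simp
  have "D holomorphic_on UNIV"
    unfolding D_def using nz C by (intro holomorphic_intros holomorphic_qpochhammer_powr q) auto
  then have "D nicely_meromorphic_on UNIV"
    by (intro analytic_on_imp_nicely_meromorphic_on) (simp add: analytic_on_open)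
  then have "(\<lambda>z. inverse (D z)) nicely_meromorphic_on UNIV" by (rule nicely_meromorphic_on_inverse)
  moreover have "(\<lambda>z. inverse (D z)) = qGamma ?q" by (auto simp: D_def qGamma_def)
  ultimately show "qGamma ?q nicely_meromorphic_on UNIV" by simp
  show "qGamma ?q 1 = 1" using C q by (simp add: qGamma_def)
  show "\<forall>\<^sub>\<approx>z\<in>UNIV. qGamma ?q (z + 1) = quantum_multigamma r 0 z * qGamma ?q z"
    using powr_neq_1_cosparse[OF r]
  proof eventually_elim
    case (elim z)
    have "(1 - ?q) powr (1 - z) = (1 - ?q) * (1 - ?q) powr (- z)"
      using q powr_add[of "1 - ?q" 1 "- z"] by simp
    moreover have "qpochhammer (?q powr z) ?q = (1 - ?q powr z) * qpochhammer (?q powr (z + 1)) ?q"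
      using qpochhammer_rec[OF q(1), of "?q powr z"] q by (simp add: powr_add)
    ultimately show ?case using elim q by (simp add: qGamma_def)
  qed
  fix x :: real assume x: "0 < x"
  show "qGamma ?q (of_real x) \<in> \<real>" "0 < Re (qGamma ?q (of_real x))"
    by (simp_all add: qGamma_of_real[OF r x])
  show "0 \<le> (deriv ^^ (1 + 1)) (\<lambda>t. ln (Re (qGamma ?q (of_real t)))) x"
    unfolding ln_Re_qGamma_derivs[OF r x] by (rule qlog_deriv_even_nonneg[OF r x]) simp
qed

lemma multigamma_step_qBarnes:
  assumes r: "0 < r" "r < 1"
  shows "multigamma_step 2 (qGamma (of_real r)) (qBarnes (of_real r))"
  unfolding multigamma_step_def
proof (intro conjI allI impI)
  let ?q = "complex_of_real r"
  have q: "norm ?q < 1" "1 - ?q \<noteq> 0" "?q \<noteq> 0" using r by auto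
  have M: "macmahon 1 ?q \<noteq> 0" using macmahon_1_nonzero q by simp
  have "(\<lambda>z. macmahon (?q powr (z - 1)) ?q) holomorphic_on UNIV"
    by (rule holomorphic_macmahon) (use q in \<open>auto intro!: holomorphic_intros\<close>)
  then have "qBarnes ?q holomorphic_on UNIV"
    unfolding qBarnes_def[abs_def] qpoch_inf_powr_def using M by (intro holomorphic_intros) auto
  then show "qBarnes ?q nicely_meromorphic_on UNIV"
    by (intro analytic_on_imp_nicely_meromorphic_on) (simp add: analytic_on_open)
  show "qBarnes ?q 1 = 1" using M q by (simp add: qBarnes_def qpoch_inf_powr_def)
  show "\<forall>\<^sub>\<approx>z\<in>UNIV. qBarnes ?q (z + 1) = qGamma ?q z * qBarnes ?q z"
    using qpochhammer_powr_nonzero_cosparse[OF r]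
  proof eventually_elim
    case (elim z)
    have e: "- ((z + 1 - 1) * (z + 1 - 2) / 2) = (1 - z) + - ((z - 1) * (z - 2) / 2)"
      by (simp add: field_simps)
    have 1: "(1 - ?q) powr (- ((z + 1 - 1) * (z + 1 - 2) / 2)) = (1 - ?q) powr (1 - z) * (1 - ?q) powr (- ((z - 1) * (z - 2) / 2))"
      unfolding e by (rule powr_add)
    have 2: "qpoch_inf_powr ?q (z + 1 - 1) = qpochhammer ?q ?q * qpoch_inf_powr ?q (z - 1)"
      using qpoch_inf_powr_add[of ?q 1 "z - 1"] qpoch_inf_powr_1[OF q(1)] by simp
    have "?q powr (z - 1) * ?q = ?q powr z" using q by (simp add: powr_diff)
    then have 3: "macmahon (?q powr (z - 1)) ?q = qpochhammer (?q powr z) ?q * macmahon (?q powr (z + 1 - 1)) ?q"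
      using macmahon_rec[OF q(1), of "?q powr (z - 1)"] by simp
    show ?case using elim unfolding qBarnes_def 1 2 3 qGamma_def by simp
  qed
  fix x :: real assume x: "0 < x"
  show "qBarnes ?q (of_real x) \<in> \<real>" "0 < Re (qBarnes ?q (of_real x))"
    by (simp_all add: qBarnes_of_real[OF r x])
  show "0 \<le> (deriv ^^ (2 + 1)) (\<lambda>t. ln (Re (qBarnes ?q (of_real t)))) x"
    unfolding ln_Re_qBarnes_derivs[OF r x] using qlog_deriv_odd_nonpos[OF r x, of 3 2] by simp
qed

lemma multigamma_0_analytic: "quantum_multigamma r 0 analytic_on of_real ` {0<..}"
proof -
  have "(\<lambda>z. (1 - complex_of_real r powr z) / (1 - of_real r)) holomorphic_on UNIV"
    by (cases "r = 1") (auto intro!: holomorphic_intros)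
  then have "(\<lambda>z. (1 - complex_of_real r powr z) / (1 - of_real r)) analytic_on UNIV" by (simp add: analytic_on_open)
  then show ?thesis by (simp, rule analytic_on_subset) auto
qed

lemma quantum_multigamma_1:
  assumes r: "0 < r" "r < 1"
  shows "quantum_multigamma r 1 = qGamma (of_real r)"
proof -
  have "(THE f. multigamma_step (Suc 0) (quantum_multigamma r 0) f) = qGamma (of_real r)"
  proof (rule the_equality)
    show "multigamma_step (Suc 0) (quantum_multigamma r 0) (qGamma (of_real r))"
      using multigamma_step_qGamma[OF r] by simp
    fix f assume f: "multigamma_step (Suc 0) (quantum_multigamma r 0) f"
    show "f = qGamma (of_real r)"
    proof (rule multigamma_step_unique[OF f _ multigamma_0_analytic])
      show "multigamma_step (Suc 0) (quantum_multigamma r 0) (qGamma (of_real r))"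
        using multigamma_step_qGamma[OF r] by simp
      fix x :: real assume "0 < x"
      then have "(deriv ^^ (Suc 0 + 1)) (\<lambda>t. ln (Re (qGamma (of_real r) (of_real t)))) (x + real n) = qlog_deriv 1 2 r (x + real n)" for n
        using ln_Re_qGamma_derivs[OF r, of "x + real n"] by simp
      then show "(\<lambda>n. (deriv ^^ (Suc 0 + 1)) (\<lambda>t. ln (Re (qGamma (of_real r) (of_real t)))) (x + real n)) \<longlonglongrightarrow> 0"
        using qlog_deriv_tendsto_0[OF r] by (simp only:)
    qed
  qed
  then show ?thesis by simp
qed

lemma quantum_multigamma_2:
  assumes r: "0 < r" "r < 1"
  shows "quantum_multigamma r 2 = qBarnes (of_real r)"
proof -
  have step: "multigamma_step (Suc 1) (qGamma (of_real r)) (qBarnes (of_real r))"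
    using multigamma_step_qBarnes[OF r] by (simp only: Suc_1)
  have "(THE f. multigamma_step (Suc 1) (qGamma (of_real r)) f) = qBarnes (of_real r)"
  proof (rule the_equality)
    show "multigamma_step (Suc 1) (qGamma (of_real r)) (qBarnes (of_real r))" by (rule step)
    fix f assume f: "multigamma_step (Suc 1) (qGamma (of_real r)) f"
    show "f = qBarnes (of_real r)"
    proof (rule multigamma_step_unique[OF f step multigamma_step_analytic[OF multigamma_step_qGamma[OF r]]])
      fix x :: real assume "0 < x"
      then have "(deriv ^^ (Suc 1 + 1)) (\<lambda>t. ln (Re (qBarnes (of_real r) (of_real t)))) (x + real n) = - qlog_deriv 2 3 r (x + real n)" for n
        unfolding Suc_1 by (intro ln_Re_qBarnes_derivs[OF r]) auto
      moreover have "(\<lambda>n. - qlog_deriv 2 3 r (x + real n)) \<longlonglongrightarrow> - 0"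
        by (intro tendsto_minus qlog_deriv_tendsto_0 r)
      ultimately show "(\<lambda>n. (deriv ^^ (Suc 1 + 1)) (\<lambda>t. ln (Re (qBarnes (of_real r) (of_real t)))) (x + real n)) \<longlonglongrightarrow> 0"
        by (simp only: minus_zero)
    qed
  qed
  then have "quantum_multigamma r (Suc 1) = qBarnes (of_real r)"
    by (simp only: quantum_multigamma.simps(2) quantum_multigamma_1[OF r])
  then show ?thesis by (simp only: Suc_1)
qed

section \<open>Analytic continuation in q\<close>

lemma open_slit_disc: "open slit_disc"
  unfolding slit_disc_def by (intro open_Diff open_ball closed_nonpos_Reals_complex)

text \<open>It is star-shaped around \<open>1/2\<close>.\<close>

lemma connected_slit_disc: "connected slit_disc"
proof (rule starlike_imp_connected)
  have half: "(1/2 :: complex) \<in> slit_disc"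
    by (auto simp: slit_disc_def complex_nonpos_Reals_iff norm_divide)
  moreover have "closed_segment (1/2) w \<subseteq> slit_disc" if w: "w \<in> slit_disc" for w
  proof
    fix z assume z: "z \<in> closed_segment (1/2) w"
    then have "z \<in> ball 0 1"
      using closed_segment_subset[of "1/2" "ball 0 1" w] half w convex_ball by (auto simp: slit_disc_def)
    moreover have "z \<notin> \<real>\<^sub>\<le>\<^sub>0"
    proof
      assume n: "z \<in> \<real>\<^sub>\<le>\<^sub>0"
      obtain t where t: "0 \<le> t" "t \<le> 1" "z = (1 - t) *\<^sub>R (1/2) + t *\<^sub>R w"
        using z by (auto simp: closed_segment_def)
      have "t * Im w = 0" "(1 - t) / 2 + t * Re w \<le> 0"
        using n t by (auto simp: complex_nonpos_Reals_iff)
      moreover have "t \<noteq> 0" using \<open>(1 - t) / 2 + t * Re w \<le> 0\<close> by auto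
      moreover have "t * Re w \<le> 0"
      proof -
        have "0 \<le> (1 - t) / 2" using \<open>t \<le> 1\<close> by simp
        then show ?thesis using \<open>(1 - t) / 2 + t * Re w \<le> 0\<close> by argo
      qed
      ultimately have "Im w = 0" "t * Re w \<le> 0" by auto
      then have "Re w \<le> 0" using \<open>t \<noteq> 0\<close> t by (simp add: mult_le_0_iff)
      then show False using w \<open>Im w = 0\<close> by (simp add: slit_disc_def complex_nonpos_Reals_iff)
    qed
    ultimately show "z \<in> slit_disc" by (simp add: slit_disc_def)
  qed
  ultimately show "starlike slit_disc" by (auto simp: starlike_def)
qed

lemma of_real_in_slit_disc: "0 < x \<Longrightarrow> x < 1 \<Longrightarrow> complex_of_real x \<in> slit_disc"
  by (auto simp: slit_disc_def complex_nonpos_Reals_iff)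

lemma half_islimpt: "(1/2 :: complex) islimpt of_real ` {0<..<1}"
  unfolding islimpt_approachable
proof (intro allI impI)
  fix e :: real assume e: "0 < e"
  define x where "x = 1 / 2 + min (e / 2) (1 / 4)"
  have x: "x \<in> {0<..<1}" "x \<noteq> 1 / 2" "\<bar>x - 1 / 2\<bar> < e" using e by (auto simp: x_def)
  have "dist (complex_of_real x) (of_real (1 / 2)) < e" unfolding dist_of_real using x by (simp add: dist_real_def)
  moreover have "complex_of_real x \<noteq> of_real (1 / 2)" using x by (simp only: of_real_eq_iff) simp
  ultimately show "\<exists>w\<in>of_real ` {0<..<1}. w \<noteq> 1 / 2 \<and> dist w (1 / 2 :: complex) < e"
    using x(1) by (intro bexI[of _ "of_real x"] imageI) auto
qed

lemma holomorphic_qBarnes: "(\<lambda>q. qBarnes q z) holomorphic_on slit_disc"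
proof -
  have n: "norm q < 1" "q \<notin> \<real>\<^sub>\<le>\<^sub>0" if "q \<in> slit_disc" for q using that by (auto simp: slit_disc_def)
  have n': "1 - q \<notin> \<real>\<^sub>\<le>\<^sub>0" if "q \<in> slit_disc" for q
  proof -
    have "Re q < 1" using n(1)[OF that] complex_Re_le_cmod le_less_trans by blast
    then show ?thesis by (simp add: complex_nonpos_Reals_iff)
  qed
  have S: "(\<lambda>q. \<Sum>n. Ln (1 - q ^ Suc n)) holomorphic_on slit_disc"
    by (rule holomorphic_on_subset[OF holomorphic_suminf_Ln]) (auto simp: slit_disc_def)
  have "(\<lambda>q. macmahon (q powr (z - 1)) q) holomorphic_on slit_disc"
    using n by (intro holomorphic_macmahon open_slit_disc holomorphic_intros) auto
  moreover have "(\<lambda>q. macmahon 1 q) holomorphic_on slit_disc"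
    using n by (intro holomorphic_macmahon open_slit_disc holomorphic_intros) auto
  ultimately show ?thesis
    unfolding qBarnes_def qpoch_inf_powr_def
    using n n' S macmahon_1_nonzero by (intro holomorphic_intros) auto
qed

text \<open>The product formula is one analytic continuation, and by the identity theorem on the slit disc
the only one.\<close>

lemma quantum_Barnes_slit_disc:
  assumes q: "q \<in> slit_disc" shows "quantum_Barnes q z = qBarnes q z"
proof -
  have "(THE w. \<exists>h. h holomorphic_on slit_disc \<and>
      (\<forall>x\<in>{0<..<1}. h (of_real x) = quantum_multigamma x 2 z) \<and> w = h q) = qBarnes q z"
  proof (rule the_equality)
    show "\<exists>h. h holomorphic_on slit_disc \<and>
      (\<forall>x\<in>{0<..<1}. h (of_real x) = quantum_multigamma x 2 z) \<and> qBarnes q z = h q"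
      using holomorphic_qBarnes quantum_multigamma_2 by (intro exI[of _ "\<lambda>q. qBarnes q z"]) auto
    fix w assume "\<exists>h. h holomorphic_on slit_disc \<and>
      (\<forall>x\<in>{0<..<1}. h (of_real x) = quantum_multigamma x 2 z) \<and> w = h q"
    then obtain h where h: "h holomorphic_on slit_disc"
      "\<And>x. x \<in> {0<..<1} \<Longrightarrow> h (of_real x) = quantum_multigamma x 2 z" "w = h q" by blast
    have "h q - qBarnes q z = 0"
    proof (rule analytic_continuation[of "\<lambda>q. h q - qBarnes q z" slit_disc "of_real ` {0<..<1}" "1/2"])
      show "(\<lambda>q. h q - qBarnes q z) holomorphic_on slit_disc" by (intro holomorphic_intros h holomorphic_qBarnes)
      show "1 / 2 \<in> slit_disc" using of_real_in_slit_disc[of "1/2"] by simp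
      show "h w - qBarnes w z = 0" if "w \<in> of_real ` {0<..<1}" for w
        using that h(2) quantum_multigamma_2 by auto
    qed (use q of_real_in_slit_disc open_slit_disc connected_slit_disc half_islimpt in auto)
    then show "w = qBarnes q z" using h by simp
  qed
  then show ?thesis using q by (simp add: quantum_Barnes_def)
qed

section \<open>Values at positive integers\<close>

lemma qGamma_nat:
  assumes r: "0 < r" "r < 1"
  shows "qGamma (of_real r) (of_nat (Suc n)) = (\<Prod>i=1..n. (1 - of_real r ^ i) / (1 - of_real r))"
proof (induction n)
  case 0
  then show ?case using multigamma_stepD(2)[OF multigamma_step_qGamma[OF r]] by simp
next
  case (Suc n)
  have "qGamma (of_real r) (of_real (real (Suc n) + 1)) =
      quantum_multigamma r 0 (of_real (real (Suc n))) * qGamma (of_real r) (of_real (real (Suc n)))"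
    by (rule multigamma_step_recurrence[OF multigamma_step_qGamma[OF r] multigamma_0_analytic]) simp
  moreover have "complex_of_real (real (Suc n) + 1) = of_nat (Suc (Suc n))" by simp
  moreover have "quantum_multigamma r 0 (of_real (real (Suc n))) = (1 - of_real r ^ Suc n) / (1 - of_real r)"
    using powr_nat'[of "of_real r" "Suc n"] by (simp del: of_nat_Suc power_Suc)
  ultimately show ?case
    using Suc.IH by (simp only: of_real_of_nat_eq) (simp del: of_nat_Suc power_Suc add: mult.commute)
qed

lemma qBarnes_nat:
  assumes r: "0 < r" "r < 1"
  shows "qBarnes (of_real r) (of_nat N + 1) = (\<Prod>n<N. \<Prod>i=1..n. (1 - of_real r ^ i) / (1 - of_real r))"
proof (induction N)
  case 0
  then show ?case using multigamma_stepD(2)[OF multigamma_step_qBarnes[OF r]] by simp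
next
  case (Suc N)
  have "qBarnes (of_real r) (of_real (real (Suc N) + 1)) =
      qGamma (of_real r) (of_real (real (Suc N))) * qBarnes (of_real r) (of_real (real (Suc N)))"
    by (rule multigamma_step_recurrence[OF multigamma_step_qBarnes[OF r] multigamma_step_analytic[OF multigamma_step_qGamma[OF r]]]) simp
  moreover have "complex_of_real (real (Suc N) + 1) = of_nat (Suc N) + 1" by simp
  moreover have "complex_of_real (real (Suc N)) = of_nat N + 1" by simp
  ultimately have "qBarnes (of_real r) (of_nat (Suc N) + 1) =
      qGamma (of_real r) (of_nat (Suc N)) * qBarnes (of_real r) (of_nat N + 1)"
    by (metis of_real_of_nat_eq)
  then show ?case unfolding qGamma_nat[OF r] Suc.IH by (simp del: of_nat_Suc power_Suc add: mult.commute)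
qed

text \<open>By the recurrences, the \<open>q\<close>-gamma function at \<open>n + 1\<close> is a \<open>q\<close>-factorial, and the \<open>q\<close>-Barnes function
at \<open>N + 1\<close> is the product of the first \<open>N\<close> of these.\<close>

lemma quantum_Barnes_nat:
  assumes q: "q \<notin> slit_disc" "q \<noteq> 1"
  shows "quantum_Barnes q (of_nat N + 1) = (\<Prod>n<N. \<Prod>i=1..n. (1 - q ^ i) / (1 - q))"
proof -
  define P :: "complex poly" where "P = (\<Prod>n<N. \<Prod>i=1..n. \<Sum>j<i. monom 1 j)"
  have P: "poly P x = (\<Prod>n<N. \<Prod>i=1..n. (1 - x ^ i) / (1 - x))" if "x \<noteq> 1" for x
    using that by (simp add: P_def poly_prod poly_sum poly_monom sum_gp_strict)
  have "(THE p. \<forall>x\<in>{0<..<1}. poly p (of_real x) = quantum_multigamma x 2 (of_nat N + 1)) = P"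
  proof (rule the_equality)
    show *: "\<forall>x\<in>{0<..<1}. poly P (of_real x) = quantum_multigamma x 2 (of_nat N + 1)"
      by (auto simp: quantum_multigamma_2 qBarnes_nat P)
    fix p assume p: "\<forall>x\<in>{0<..<1}. poly p (of_real x) = quantum_multigamma x 2 (of_nat N + 1)"
    show "p = P"
    proof (rule ccontr)
      assume "p \<noteq> P"
      then have "finite {x. poly (p - P) x = 0}" by (intro poly_roots_finite) simp
      moreover have "complex_of_real ` {0<..<1} \<subseteq> {x. poly (p - P) x = 0}" using p * by auto
      ultimately have "finite (complex_of_real ` {0<..<1})" by (rule rev_finite_subset)
      then have "finite {0<..<1::real}" by (rule finite_imageD) (simp add: inj_on_def)
      then show False using infinite_Ioo[of 0 "1::real"] by simp
    qed
  qed
  then show ?thesis using q P[of q] by (simp add: quantum_Barnes_def)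
qed

section \<open>The resolved conifold\<close>

lemma schur_scale: 
  assumes "\<mu> \<in> int_partitions"
  shows "schur I (\<lambda>i. c * x i) \<mu> = c ^ part_size \<mu> * schur I x \<mu>"
  by (simp add: schur_def prod.distrib card_young_diagram[OF assms] infsum_cmult_right')

lemma quadratic_power_tendsto_0:
  fixes r :: real assumes "0 \<le> r" "r < 1"
  shows "(\<lambda>n. (real n)\<^sup>2 * r ^ n) \<longlonglongrightarrow> 0"
proof -
  have "norm (sqrt r) < 1" using assms by simp
  then have "(\<lambda>n. real n * sqrt r ^ n) \<longlonglongrightarrow> 0" by (rule powser_times_n_limit_0)
  then have "(\<lambda>n. (real n * sqrt r ^ n)\<^sup>2) \<longlonglongrightarrow> 0\<^sup>2" by (rule tendsto_power)
  moreover have "(real n * sqrt r ^ n)\<^sup>2 = (real n)\<^sup>2 * r ^ n" for n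
  proof -
    have "(sqrt r ^ n)\<^sup>2 = (sqrt r ^ 2) ^ n" by (simp only: power_mult[symmetric] mult.commute)
    then show ?thesis using assms by (simp add: power_mult_distrib)
  qed
  ultimately show ?thesis by simp
qed

lemma norm_prod_one_plus_le:
  fixes f :: "'b \<Rightarrow> complex"
  assumes "finite A"
  shows "norm ((\<Prod>p\<in>A. 1 + f p) - 1) \<le> exp (\<Sum>p\<in>A. norm (f p)) - 1"
proof -
  obtain h where h: "bij_betw h {..<card A} A"
    using ex_bij_betw_nat_finite[OF assms] by (auto simp: lessThan_atLeast0)
  have "norm ((\<Prod>i<card A. 1 + f (h i)) - 1) \<le> (\<Prod>i<card A. 1 + norm (f (h i))) - 1"
    by (rule norm_prod_minus1_le_prod_minus1)
  also have "(\<Prod>i<card A. 1 + norm (f (h i))) \<le> exp (\<Sum>i<card A. norm (f (h i)))"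
    by (rule prod_le_exp_sum) simp
  finally show ?thesis
    using prod.reindex_bij_betw[OF h, of "\<lambda>p. 1 + f p"] sum.reindex_bij_betw[OF h, of "\<lambda>p. norm (f p)"] by simp
qed

text \<open>There are \<open>d + 1\<close> pairs with \<open>i + j = d\<close>, so the factors with \<open>i + j < n\<close> form a partial product of
\<open>macmahon a q\<close>. At most \<open>n\<^sup>2\<close> factors remain, and each differs from 1 by at most
\<open>norm a * norm q ^ n\<close>.\<close>

lemma square_prod_tendsto_macmahon:
  assumes q: "norm q < 1"
  shows "(\<lambda>n. \<Prod>i<n. \<Prod>j<n. 1 - a * q ^ Suc (i + j)) \<longlonglongrightarrow> macmahon a q"
proof -
  define g where "g = (\<lambda>(i, j). 1 - a * q ^ Suc (i + j))"
  define T where "T n = {(i, j). i + j < n}" for n :: nat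
  define R where "R n = {..<n} \<times> {..<n} - T n" for n
  have sub: "T n \<subseteq> {..<n} \<times> {..<n}" for n by (auto simp: T_def)
  have split: "(\<Prod>i<n. \<Prod>j<n. 1 - a * q ^ Suc (i + j)) = (\<Prod>p\<in>R n. g p) * (\<Prod>p\<in>T n. g p)" for n
  proof -
    have "(\<Prod>i<n. \<Prod>j<n. 1 - a * q ^ Suc (i + j)) = (\<Prod>p\<in>{..<n} \<times> {..<n}. g p)"
      unfolding g_def by (rule prod.cartesian_product)
    then show ?thesis unfolding R_def using prod.subset_diff[OF sub[of n], of g] by simp
  qed
  have "(\<Prod>p\<in>T n. g p) = (\<Prod>d<n. (1 - a * q ^ Suc d) ^ Suc d)" for n
  proof -
    have "(\<Prod>p\<in>T n. g p) = (\<Prod>d<n. \<Prod>i\<le>d. 1 - a * q ^ Suc (i + (d - i)))"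
      unfolding T_def g_def by (rule prod.triangle_reindex)
    also have "\<dots> = (\<Prod>d<n. (1 - a * q ^ Suc d) ^ Suc d)" by (intro prod.cong refl) simp
    finally show ?thesis .
  qed
  moreover have "(\<lambda>n. \<Prod>d<n. (1 - a * q ^ Suc d) ^ Suc d) \<longlonglongrightarrow> macmahon a q"
    using convergent_prod_LIMSEQ[OF convergent_macmahon[OF q, of a]]
    unfolding macmahon_def lessThan_Suc_atMost[symmetric] by (rule LIMSEQ_imp_Suc)
  ultimately have lim1: "(\<lambda>n. \<Prod>p\<in>T n. g p) \<longlonglongrightarrow> macmahon a q" by simp
  have bound: "norm ((\<Prod>p\<in>R n. g p) - 1) \<le> exp (norm a * ((real n)\<^sup>2 * norm q ^ n)) - 1" for n
  proof -
    let ?f = "\<lambda>p. - (a * q ^ Suc (fst p + snd p))"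
    have "norm ((\<Prod>p\<in>R n. 1 + ?f p) - 1) \<le> exp (\<Sum>p\<in>R n. norm (?f p)) - 1"
      by (rule norm_prod_one_plus_le) (simp add: R_def)
    moreover have "(\<Prod>p\<in>R n. 1 + ?f p) = (\<Prod>p\<in>R n. g p)" by (simp add: g_def case_prod_unfold)
    moreover have "(\<Sum>p\<in>R n. norm (?f p)) \<le> real (card (R n)) * (norm a * norm q ^ n)"
    proof (rule sum_bounded_above)
      fix p assume "p \<in> R n"
      then have "n \<le> Suc (fst p + snd p)" by (auto simp: R_def T_def)
      then have "norm q ^ Suc (fst p + snd p) \<le> norm q ^ n" using q by (intro power_decreasing) auto
      then show "norm (?f p) \<le> norm a * norm q ^ n"
        unfolding norm_minus_cancel norm_mult norm_power by (intro mult_left_mono) auto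
    qed
    moreover have "real (card (R n)) * (norm a * norm q ^ n) \<le> norm a * ((real n)\<^sup>2 * norm q ^ n)"
    proof -
      have "card (R n) \<le> card ({..<n} \<times> {..<n})" unfolding R_def by (intro card_mono) auto
      then have "real (card (R n)) \<le> real (n * n)" by (simp only: of_nat_le_iff) (simp add: card_cartesian_product)
      then have "real (card (R n)) * (norm a * norm q ^ n) \<le> real (n * n) * (norm a * norm q ^ n)"
        by (intro mult_right_mono) auto
      then show ?thesis by (simp add: power2_eq_square mult_ac)
    qed
    ultimately show ?thesis by (smt (verit) exp_le_cancel_iff)
  qed
  have "(\<lambda>n. exp (norm a * ((real n)\<^sup>2 * norm q ^ n)) - 1) \<longlonglongrightarrow> exp (norm a * 0) - 1"
    using q by (intro tendsto_intros quadratic_power_tendsto_0) auto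
  then have "(\<lambda>n. exp (norm a * ((real n)\<^sup>2 * norm q ^ n)) - 1) \<longlonglongrightarrow> 0" by simp
  then have "(\<lambda>n. (\<Prod>p\<in>R n. g p) - 1) \<longlonglongrightarrow> 0"
    by (rule Lim_null_comparison[rotated]) (use bound in auto)
  then have "(\<lambda>n. \<Prod>p\<in>R n. g p) \<longlonglongrightarrow> 1" by (simp add: LIM_zero_iff)
  from tendsto_mult[OF this lim1] show ?thesis by (simp only: split mult_1_left)
qed

text \<open>The signs of the two vertices cancel, and \<open>(- a) ^ part_size \<mu>\<close> is absorbed into the variables of
one of the Schur functions by homogeneity.\<close>

lemma conifold_Z_reduced_eq_macmahon:
  assumes q: "norm q < 1" "q \<noteq> 0"
  shows "conifold_Z_reduced a q = macmahon a q"
proof -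
  define x where "x = (\<lambda>i. q powr (of_nat i + 1 / 2))"
  have x: "x i = q powr (1 / 2) * q ^ i" for i
    using q by (simp add: x_def powr_add powr_nat' mult.commute)
  have "q powr (1 / 2) * q powr (1 / 2) = q"
    using q by (simp flip: powr_add)
  then have xx: "x i * x j = q ^ Suc (i + j)" for i j
    unfolding x by (simp add: power_add mult_ac)
  have sx: "summable (\<lambda>i. norm (x i))"
    unfolding x norm_mult norm_power using q by (intro summable_mult summable_geometric) auto
  then have sax: "summable (\<lambda>i. norm (- a * x i))" unfolding norm_mult by (rule summable_mult)
  have "(\<lambda>n. \<Prod>i<n. \<Prod>j<n. 1 + (- a * x i) * x j) \<longlonglongrightarrow>
      (\<Sum>\<^sub>\<infinity>\<mu>\<in>int_partitions. schur UNIV (\<lambda>i. - a * x i) \<mu> * schur UNIV x (conjugate \<mu>))"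
    by (rule dual_Cauchy[OF sax sx])
  also have "(\<lambda>n. \<Prod>i<n. \<Prod>j<n. 1 + (- a * x i) * x j) = (\<lambda>n. \<Prod>i<n. \<Prod>j<n. 1 - a * q ^ Suc (i + j))"
    by (simp add: mult.assoc xx)
  finally have "(\<Sum>\<^sub>\<infinity>\<mu>\<in>int_partitions. schur UNIV (\<lambda>i. - a * x i) \<mu> * schur UNIV x (conjugate \<mu>)) = macmahon a q"
    using square_prod_tendsto_macmahon[OF q(1), of a] LIMSEQ_unique by blast
  moreover have "(- a) ^ part_size \<mu> * vertex_W \<mu> q * vertex_W (conjugate \<mu>) q =
      schur UNIV (\<lambda>i. - a * x i) \<mu> * schur UNIV x (conjugate \<mu>)" if "\<mu> \<in> int_partitions" for \<mu>
  proof -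
    have "vertex_W \<mu> q * vertex_W (conjugate \<mu>) q = schur UNIV x (conjugate \<mu>) * schur UNIV x \<mu>"
      using that by (simp add: vertex_W_def x_def mult_ac flip: power_mult_distrib)
    then show ?thesis using schur_scale[OF that, of UNIV "- a" x] by (simp add: mult_ac)
  qed
  then have "conifold_Z_reduced a q = (\<Sum>\<^sub>\<infinity>\<mu>\<in>int_partitions. schur UNIV (\<lambda>i. - a * x i) \<mu> * schur UNIV x (conjugate \<mu>))"
    unfolding conifold_Z_reduced_def by (intro infsum_cong)
  ultimately show ?thesis by simp
qed

lemma conifold_Z0_eq: "norm q < 1 \<Longrightarrow> conifold_Z0 q = inverse (macmahon 1 q)"
  using prodinf_inverse[OF convergent_macmahon[of q 1]] by (simp add: conifold_Z0_def macmahon_def)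

text \<open>With \<open>M = macmahon (q powr z) q\<close>, both sides are \<open>(1 - q)\<close> to the power \<open>- z (z - 1) / 2\<close>, times
\<open>M / macmahon 1 q\<close>.\<close>

theorem conifold_Barnes:
  assumes q: "q \<notin> \<real>\<^sub>\<le>\<^sub>0" "norm q < 1"
  shows "(1 - q) powr (- (z * (z - 1) / 2)) * conifold_Z (q powr z) q =
    qpoch_inf_powr q (- z) * quantum_Barnes q (z + 1)"
proof -
  have "q \<noteq> 0" "q \<in> slit_disc" using q by (auto simp: slit_disc_def)
  have e: "- ((z + 1 - 1) * (z + 1 - 2) / 2) = - (z * (z - 1) / 2)" by simp
  have one: "qpoch_inf_powr q (- z) * qpoch_inf_powr q (z + 1 - 1) = 1"
    by (simp add: qpoch_inf_powr_def flip: exp_add)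
  have "qpoch_inf_powr q (- z) * quantum_Barnes q (z + 1) =
      (qpoch_inf_powr q (- z) * qpoch_inf_powr q (z + 1 - 1)) *
      ((1 - q) powr (- (z * (z - 1) / 2)) * macmahon (q powr (z + 1 - 1)) q / macmahon 1 q)"
    unfolding quantum_Barnes_slit_disc[OF \<open>q \<in> slit_disc\<close>] qBarnes_def e by (simp add: mult_ac)
  also have "\<dots> = (1 - q) powr (- (z * (z - 1) / 2)) * conifold_Z (q powr z) q"
    unfolding one using \<open>q \<noteq> 0\<close> q
    by (simp add: conifold_Z_def conifold_Z0_eq conifold_Z_reduced_eq_macmahon field_simps)
  finally show ?thesis by simp
qed

section \<open>The 3-sphere\<close>

text \<open>Since \<open>1 - cis \<phi> = - 2 \<i> cis (\<phi> / 2) sin (\<phi> / 2)\<close>, where the sine is positive.\<close>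

lemma one_minus_cis:
  assumes "0 < \<phi>" "\<phi> < 2 * pi"
  shows "complex_of_real (norm (1 - cis \<phi>)) = \<i> * cis (- (\<phi> / 2)) * (1 - cis \<phi>)"
    and "0 < norm (1 - cis \<phi>)"
proof -
  have v: "\<i> * cis (- (\<phi> / 2)) * (1 - cis \<phi>) = of_real (2 * sin (\<phi> / 2))"
  proof -
    have "cis (- (\<phi> / 2)) * cis \<phi> = cis (\<phi> / 2)" by (simp add: cis_mult)
    then have "\<i> * cis (- (\<phi> / 2)) * (1 - cis \<phi>) = \<i> * (cis (- (\<phi> / 2)) - cis (\<phi> / 2))"
      by (simp add: algebra_simps)
    also have "\<dots> = of_real (2 * sin (\<phi> / 2))" by (simp add: complex_eq_iff)
    finally show ?thesis .
  qed
  have s: "0 < sin (\<phi> / 2)" using assms by (intro sin_gt_zero) auto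
  have "norm (1 - cis \<phi>) = norm (\<i> * cis (- (\<phi> / 2)) * (1 - cis \<phi>))" by (simp add: norm_mult)
  also have "\<dots> = 2 * sin (\<phi> / 2)" unfolding v using s by (simp only: norm_of_real)
  finally have n: "norm (1 - cis \<phi>) = 2 * sin (\<phi> / 2)" .
  show "complex_of_real (norm (1 - cis \<phi>)) = \<i> * cis (- (\<phi> / 2)) * (1 - cis \<phi>)" unfolding v n ..
  show "0 < norm (1 - cis \<phi>)" unfolding n using s by simp
qed

lemma cis_powr_of_real:
  assumes "- pi < \<theta>" "\<theta> \<le> pi" shows "cis \<theta> powr of_real s = cis (s * \<theta>)"
proof -
  have "Ln (cis \<theta>) = \<i> * of_real \<theta>" unfolding cis_conv_exp by (rule Ln_exp) (use assms in auto)
  then show ?thesis by (simp add: powr_def cis_conv_exp mult_ac)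
qed

lemma alternant_cong:
  "(\<And>c. c < n \<Longrightarrow> x c = y c) \<Longrightarrow> alternant n l x = alternant n l y"
  unfolding alternant_def by (intro arg_cong[of _ _ Determinant.det] eq_matI) auto

text \<open>The exponent of \<open>q\<close> that results from one phase \<open>q\<^sup>-\<^sup>i\<^sup>/\<^sup>2\<close> for each factor of the Barnes polynomial.\<close>

lemma sum_of_phase_exponents: "(\<Sum>n<N. \<Sum>i=1..n. real i / 2) = real N * ((real N)\<^sup>2 - 1) / 12"
proof (induction N)
  case (Suc N)
  have row: "(\<Sum>i=1..n. real i / 2) = real n * (real n + 1) / 4" for n
    by (induction n) (auto simp: field_simps)
  show ?case
    by (simp only: sum.lessThan_Suc Suc.IH row[of N]) (simp add: field_simps power2_eq_square)
qed simp

text \<open>The phases of the factors multiply to the power of \<open>\<i>\<close> and the power of \<open>q\<close> in the formula for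
the sphere.\<close>

lemma norm_prod_one_minus_cis:
  assumes \<theta>: "0 < \<theta>" "real K * \<theta> < 2 * pi"
  shows "complex_of_real (\<Prod>n<Suc K. \<Prod>i=1..n. norm (1 - cis \<theta> ^ i)) =
    \<i> ^ (\<Sum>n<Suc K. n) * cis (- (real (Suc K) * ((real (Suc K))\<^sup>2 - 1) / 12) * \<theta>) * (\<Prod>n<Suc K. \<Prod>i=1..n. 1 - cis \<theta> ^ i)"
proof -
  have "complex_of_real (\<Prod>n<Suc K. \<Prod>i=1..n. norm (1 - cis \<theta> ^ i)) =
      (\<Prod>n<Suc K. \<Prod>i=1..n. \<i> * exp (\<i> * of_real (- (real i / 2) * \<theta>)) * (1 - cis \<theta> ^ i))"
    unfolding of_real_prod
  proof (intro prod.cong refl)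
    fix n i assume "n \<in> {..<Suc K}" "i \<in> {1..n}"
    then have i: "0 < i" "i \<le> K" by auto
    have "real i * \<theta> \<le> real K * \<theta>" using i \<theta> by (intro mult_right_mono) auto
    then have "real i * \<theta> < 2 * pi" using \<theta> by linarith
    then have "complex_of_real (norm (1 - cis (real i * \<theta>))) = \<i> * cis (- (real i * \<theta> / 2)) * (1 - cis (real i * \<theta>))"
      using i \<theta> by (intro one_minus_cis) auto
    moreover have "exp (\<i> * of_real (- (real i / 2) * \<theta>)) = cis (- (real i * \<theta> / 2))" by (simp add: cis_conv_exp)
    ultimately show "complex_of_real (norm (1 - cis \<theta> ^ i)) = \<i> * exp (\<i> * of_real (- (real i / 2) * \<theta>)) * (1 - cis \<theta> ^ i)"
      by (simp only: Complex.DeMoivre)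
  qed
  also have "\<dots> = (\<Prod>n<Suc K. \<i> ^ n) * exp (\<Sum>n<Suc K. \<Sum>i=1..n. \<i> * of_real (- (real i / 2) * \<theta>)) * (\<Prod>n<Suc K. \<Prod>i=1..n. 1 - cis \<theta> ^ i)"
    by (simp add: prod.distrib exp_sum del: prod.lessThan_Suc sum.lessThan_Suc)
  also have "(\<Sum>n<Suc K. \<Sum>i=1..n. \<i> * complex_of_real (- (real i / 2) * \<theta>)) =
      \<i> * of_real (- (\<Sum>n<Suc K. \<Sum>i=1..n. real i / 2) * \<theta>)"
    by (simp add: sum_distrib_left sum_distrib_right sum_negf del: sum.lessThan_Suc)
  also have "exp \<dots> = cis (- (real (Suc K) * ((real (Suc K))\<^sup>2 - 1) / 12) * \<theta>)"
    unfolding sum_of_phase_exponents cis_conv_exp ..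
  also have "(\<Prod>n<Suc K. \<i> ^ n) = \<i> ^ (\<Sum>n<Suc K. n)" by (rule power_sum[symmetric])
  finally show ?thesis .
qed

text \<open>The set of variables is closed under conjugation, which permutes the columns of both alternants
in the same way; so the quantum dimensions are real and their squares are squared moduli.\<close>

lemma sphere_sum:
  fixes k K :: nat
  defines "M \<equiv> k + Suc K"
  defines "\<theta> \<equiv> 2 * pi / real M"
  assumes k: "0 < k"
  shows "(\<Sum>\<mu>\<in>bounded_partitions K k. (quantum_W (Suc K) \<mu> (cis \<theta>))\<^sup>2) =
    of_real (real (Suc K) * real M ^ K / (\<Prod>n<Suc K. \<Prod>i=1..n. norm (1 - cis \<theta> ^ i))\<^sup>2)"
proof -
  have M: "2 \<le> M" using k by (simp add: M_def)
  have M0: "0 < real M" using M by simp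
  have \<theta>: "0 < \<theta>" "\<theta> \<le> pi" using M by (auto simp: \<theta>_def field_simps)
  have M\<theta>: "real M * \<theta> = 2 * pi" using M by (simp add: \<theta>_def)
  have lt: "0 < real j * \<theta>" "real j * \<theta> < 2 * pi" if "0 < j" "j < M" for j
  proof -
    show "0 < real j * \<theta>" using that \<theta> by simp
    have "real j * \<theta> < real M * \<theta>" using that \<theta> by (intro mult_strict_right_mono) auto
    then show "real j * \<theta> < 2 * pi" using M\<theta> by simp
  qed
  define x where "x c = cis ((real K / 2 - real c) * \<theta>)" for c
  define w where "w = cis (- \<theta>)"
  define u where "u = cis (real K / 2 * \<theta>)"
  have xuw: "x = (\<lambda>c. u * w ^ c)"
    by (auto simp: x_def u_def w_def Complex.DeMoivre cis_mult algebra_simps)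
  have W: "quantum_W (Suc K) \<mu> (cis \<theta>) = schur {..<Suc K} x \<mu>" for \<mu>
  proof -
    have "cis \<theta> powr ((of_nat (Suc K) - 1) / 2 - of_nat i) = x i" for i
      using cis_powr_of_real[of \<theta> "real K / 2 - real i"] \<theta> by (simp add: x_def)
    then show ?thesis by (simp add: quantum_W_def)
  qed
  define A where "A \<mu> = alternant (Suc K) (\<lambda>r. \<mu> r + (K - r)) x" for \<mu>
  define A0 where "A0 = alternant (Suc K) (\<lambda>r. K - r) x"
  have norm_diff: "norm (x c - x m) = norm (1 - cis \<theta> ^ (m - c))" if "c < m" for c m
  proof -
    have "x c = x m * cis \<theta> ^ (m - c)"
      using that by (simp add: x_def Complex.DeMoivre cis_mult of_nat_diff algebra_simps)
    then have "x c - x m = - (x m * (1 - cis \<theta> ^ (m - c)))" by (simp add: algebra_simps)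
    then show ?thesis by (simp only: norm_minus_cancel norm_mult) (simp add: x_def)
  qed
  have normA0: "norm A0 = (\<Prod>n<Suc K. \<Prod>i=1..n. norm (1 - cis \<theta> ^ i))"
  proof -
    have "norm A0 = (\<Prod>m<Suc K. \<Prod>c<m. norm (x c - x m))"
      using alternant_vandermonde[of "Suc K" x] by (simp add: A0_def prod_norm[symmetric] del: prod.lessThan_Suc)
    also have "\<dots> = (\<Prod>m<Suc K. \<Prod>i=1..m. norm (1 - cis \<theta> ^ i))"
    proof (rule prod.cong[OF refl])
      fix m
      show "(\<Prod>c<m. norm (x c - x m)) = (\<Prod>i=1..m. norm (1 - cis \<theta> ^ i))"
        by (rule prod.reindex_bij_witness[of _ "\<lambda>i. m - i" "\<lambda>c. m - c"]) (auto simp: norm_diff)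
    qed
    finally show ?thesis .
  qed
  have "0 < (\<Prod>n<Suc K. \<Prod>i=1..n. norm (1 - cis \<theta> ^ i))"
  proof (intro prod_pos)
    fix n i assume "n \<in> {..<Suc K}" "i \<in> {1..n}"
    then have "0 < i" "i < M" using k by (auto simp: M_def)
    then show "0 < norm (1 - cis \<theta> ^ i)" using one_minus_cis(2)[OF lt] by (simp add: Complex.DeMoivre)
  qed
  then have "0 < norm A0" by (simp only: normA0)
  then have A0: "A0 \<noteq> 0" by simp
  have WA: "schur {..<Suc K} x \<mu> * A0 = A \<mu>" if "\<mu> \<in> bounded_partitions K k" for \<mu>
  proof -
    have "\<mu> \<in> int_partitions" "\<mu> K = 0" using that by (auto simp: bounded_partitions_iff)
    moreover from this have "\<mu> (Suc K) = 0" using int_partitionsD(1)[of \<mu> K "Suc K"] by simp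
    ultimately show ?thesis using schur_bialternant[of \<mu> "Suc K" x] by (simp add: A_def A0_def)
  qed
  define p where "p c = (if c < Suc K then K - c else c)" for c
  have p: "p permutes {..<Suc K}"
  proof (rule bij_imp_permutes)
    show "bij_betw p {..<Suc K} {..<Suc K}" by (rule bij_betwI[of _ _ _ p]) (auto simp: p_def)
  qed (simp add: p_def)
  have cnjA: "cnj (alternant (Suc K) l x) = signof p * alternant (Suc K) l x" for l
  proof -
    have "cnj (alternant (Suc K) l x) = alternant (Suc K) l (x \<circ> p)"
      unfolding cnj_alternant
    proof (rule alternant_cong)
      fix c assume "c < Suc K"
      then show "(cnj \<circ> x) c = (x \<circ> p) c"
        by (simp add: x_def p_def cis_cnj of_nat_diff algebra_simps)
    qed
    then show ?thesis by (simp add: alternant_permute_columns[OF p])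
  qed
  have W_sq: "(schur {..<Suc K} x \<mu>)\<^sup>2 = of_real ((norm (A \<mu>))\<^sup>2 / (norm A0)\<^sup>2)" if \<mu>: "\<mu> \<in> bounded_partitions K k" for \<mu>
  proof -
    let ?W = "schur {..<Suc K} x \<mu>"
    have "cnj ?W * cnj A0 = cnj (A \<mu>)" using WA[OF \<mu>] by (metis complex_cnj_mult)
    moreover have "cnj A0 = signof p * A0" "cnj (A \<mu>) = signof p * A \<mu>"
      unfolding A_def A0_def by (rule cnjA)+
    ultimately have "cnj ?W * (signof p * A0) = signof p * (?W * A0)"
      by (simp only: WA[OF \<mu>])
    moreover have "complex_of_int (sign p) \<noteq> 0" by (simp add: sign_def)
    ultimately have "cnj ?W = ?W" using A0 by simp
    then have "?W\<^sup>2 = of_real ((norm ?W)\<^sup>2)" unfolding complex_norm_square by (simp add: power2_eq_square)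
    moreover have "norm ?W = norm (A \<mu>) / norm A0" using WA[OF \<mu>] A0 by (simp add: norm_mult[symmetric] field_simps)
    ultimately show ?thesis by (simp add: power_divide)
  qed
  have "(\<Sum>\<mu>\<in>bounded_partitions K k. (quantum_W (Suc K) \<mu> (cis \<theta>))\<^sup>2) =
      of_real ((\<Sum>\<mu>\<in>bounded_partitions K k. (norm (A \<mu>))\<^sup>2) / (norm A0)\<^sup>2)"
    by (simp add: W W_sq sum_divide_distrib)
  also have "(\<Sum>\<mu>\<in>bounded_partitions K k. (norm (A \<mu>))\<^sup>2) = real (Suc K) * real M ^ K"
    unfolding A_def xuw M_def
  proof (rule sum_norm_alternant_partitions)
    have "w ^ M = cis (- (2 * pi))" using M\<theta> by (simp add: w_def Complex.DeMoivre)
    also have "\<dots> = 1" by (simp add: complex_eq_iff)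
    finally show "w ^ (k + Suc K) = 1" by (simp add: M_def)
    fix j assume "0 < j" "j < k + Suc K"
    then have "0 < norm (1 - cis (real j * \<theta>))" by (intro one_minus_cis lt) (auto simp: M_def)
    then have "cis (real j * \<theta>) \<noteq> 1" by auto
    moreover have "w ^ j = inverse (cis (real j * \<theta>))" by (simp add: w_def Complex.DeMoivre)
    ultimately show "w ^ j \<noteq> 1" by (metis inverse_1 inverse_inverse_eq)
  qed (simp_all add: u_def w_def)
  finally show ?thesis unfolding normA0 .
qed

text \<open>Both sides are \<open>D / ((1 - q) ^ t * sqrt (N * M ^ K))\<close> with \<open>K = N - 1\<close>, \<open>M = k + N\<close>,
\<open>t = N (N - 1) / 2\<close> and \<open>D\<close> the modulus of the Vandermonde product. This uses that at \<open>z = N\<close> the powers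
with base \<open>\<i>\<close> and \<open>1 - q\<close> have integral exponents, so that no branches are involved.\<close>

theorem sphere_Barnes:
  fixes k N :: nat
  assumes k: "0 < k" and N: "0 < N" and q: "q = exp (2 * of_real pi * \<i> / of_nat (k + N))" and z: "z = of_nat N"
  shows "(1 - q) powr (- (z * (z - 1) / 2)) * sphere_Z k N q =
     \<i> powr (z * (z - 1) / 2) * q powr (- (z * (z\<^sup>2 - 1) / 12)) * z powr (- (1 / 2)) *
     (Ln q / (2 * of_real pi * \<i>)) powr ((z - 1) / 2) * quantum_Barnes q (z + 1)"
proof -
  obtain K where K: "N = Suc K" using N by (cases N) auto
  define M where "M = k + Suc K"
  define \<theta> where "\<theta> = 2 * pi / real M"
  have M: "2 \<le> M" using k by (simp add: M_def)
  have \<theta>: "0 < \<theta>" "\<theta> \<le> pi" using M by (auto simp: \<theta>_def field_simps)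
  have q_cis: "q = cis \<theta>" by (simp add: q cis_conv_exp \<theta>_def M_def K mult_ac)
  have "real M * \<theta> = 2 * pi" using M by (simp add: \<theta>_def)
  moreover have "real K * \<theta> < real M * \<theta>" using \<theta> k by (intro mult_strict_right_mono) (auto simp: M_def)
  ultimately have K\<theta>: "real K * \<theta> < 2 * pi" by simp
  have q1: "q \<noteq> 1"
    using one_minus_cis(2)[of \<theta>] \<theta> pi_gt_zero unfolding q_cis by auto
  define D where "D = (\<Prod>n<Suc K. \<Prod>i=1..n. norm (1 - q ^ i))"
  define t where "t = (\<Sum>n<Suc K. n)"
  define e where "e = real N * ((real N)\<^sup>2 - 1) / 12"
  have D: "complex_of_real D = \<i> ^ t * cis (- e * \<theta>) * (\<Prod>n<Suc K. \<Prod>i=1..n. 1 - q ^ i)"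
    unfolding D_def t_def e_def K q_cis by (rule norm_prod_one_minus_cis[OF \<theta>(1) K\<theta>])
  have D0: "0 \<le> D" unfolding D_def by (intro prod_nonneg) auto
  have t: "z * (z - 1) / 2 = of_nat t"
  proof -
    have "complex_of_nat (\<Sum>n<N. n) = of_nat N * (of_nat N - 1) / 2" for N
      by (induction N) (auto simp: field_simps)
    then show ?thesis by (simp only: t_def z K[symmetric])
  qed
  have S: "sphere_Z k N q = of_real (D / (sqrt (real N) * sqrt (real M ^ K)))"
  proof -
    have "(\<Sum>\<mu>\<in>bounded_partitions (N - 1) k. (quantum_W N \<mu> q)\<^sup>2) = of_real (real N * real M ^ K / D\<^sup>2)"
      using sphere_sum[OF k, of K] by (simp add: K q_cis \<theta>_def M_def D_def del: prod.lessThan_Suc of_nat_Suc of_nat_add)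
    then have "sphere_Z k N q = inverse (of_real (sqrt (real N * real M ^ K / D\<^sup>2)))"
      by (simp add: sphere_Z_def csqrt_of_real_nonneg del: of_real_divide of_real_mult)
    also have "sqrt (real N * real M ^ K / D\<^sup>2) = sqrt (real N) * sqrt (real M ^ K) / D"
      using D0 by (simp add: real_sqrt_divide real_sqrt_mult)
    finally show ?thesis by simp
  qed
  have B: "quantum_Barnes q (z + 1) = (\<Prod>n<Suc K. \<Prod>i=1..n. 1 - q ^ i) / (1 - q) ^ t"
  proof -
    have "q \<notin> slit_disc" by (simp add: q_cis slit_disc_def)
    then have "quantum_Barnes q (z + 1) = (\<Prod>n<Suc K. \<Prod>i=1..n. (1 - q ^ i) / (1 - q))"
      unfolding z K by (rule quantum_Barnes_nat[OF _ q1])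
    also have "\<dots> = (\<Prod>n<Suc K. (\<Prod>i=1..n. 1 - q ^ i) / (1 - q) ^ n)"
      by (simp add: prod_dividef del: prod.lessThan_Suc)
    also have "\<dots> = (\<Prod>n<Suc K. \<Prod>i=1..n. 1 - q ^ i) / (\<Prod>n<Suc K. (1 - q) ^ n)" by (rule prod_dividef)
    also have "(\<Prod>n<Suc K. (1 - q) ^ n) = (1 - q) ^ t" by (simp only: t_def power_sum)
    finally show ?thesis .
  qed
  have 1: "(1 - q) powr (- (z * (z - 1) / 2)) = inverse ((1 - q) ^ t)"
    unfolding t using q1 by (simp add: powr_minus powr_nat')
  have 2: "\<i> powr (z * (z - 1) / 2) = \<i> ^ t" unfolding t by (simp add: powr_nat')
  have 3: "q powr (- (z * (z\<^sup>2 - 1) / 12)) = cis (- e * \<theta>)"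
  proof -
    have "- (z * (z\<^sup>2 - 1) / 12) = of_real (- e)" by (simp add: z e_def)
    then show ?thesis unfolding q_cis using \<theta> by (simp only: cis_powr_of_real)
  qed
  have 4: "z powr (- (1 / 2)) = of_real (inverse (sqrt (real N)))"
  proof -
    have "z powr (- (1 / 2)) = of_real (real N) powr of_real (- (1 / 2))" by (simp add: z)
    also have "\<dots> = of_real (real N powr (- (1 / 2)))" by (rule powr_of_real) simp
    finally show ?thesis by (simp add: powr_minus powr_half_sqrt)
  qed
  have 5: "(Ln q / (2 * of_real pi * \<i>)) powr ((z - 1) / 2) = of_real (inverse (sqrt (real M ^ K)))"
  proof -
    have "Ln q = \<i> * of_real \<theta>" unfolding q_cis cis_conv_exp by (rule Ln_exp) (use \<theta> in auto)
    then have "Ln q / (2 * of_real pi * \<i>) = of_real (inverse (real M))"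
      by (simp add: \<theta>_def field_simps)
    then have "(Ln q / (2 * of_real pi * \<i>)) powr ((z - 1) / 2) = of_real (inverse (real M)) powr of_real (real K / 2)"
      by (simp add: z K)
    also have "\<dots> = of_real (inverse (real M) powr (real K / 2))" by (rule powr_of_real) simp
    also have "inverse (real M) powr (real K / 2) = inverse (sqrt (real M ^ K))"
    proof -
      have "sqrt (real M ^ K) = (real M powr real K) powr (1 / 2)" using M by (simp add: powr_half_sqrt powr_realpow)
      also have "\<dots> = real M powr (real K / 2)" by (simp add: powr_powr)
      finally show ?thesis using M by (simp add: inverse_powr)
    qed
    finally show ?thesis .
  qed
  show ?thesis unfolding 1 2 3 4 5 B S of_real_divide D by (simp add: field_simps)
qed

theorem theorem3:
  shows "(\<forall>q z :: complex. q \<notin> \<real>\<^sub>\<le>\<^sub>0 \<and> norm q < 1 \<longrightarrow>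
           (1 - q) powr (- (z * (z - 1) / 2)) * conifold_Z (q powr z) q =
             qpoch_inf_powr q (- z) * quantum_Barnes q (z + 1)) \<and>
         (\<forall>k N :: nat. \<forall>q z :: complex.
           0 < k \<and> 0 < N \<and> q = exp (2 * of_real pi * \<i> / of_nat (k + N)) \<and> z = of_nat N \<longrightarrow>
           (1 - q) powr (- (z * (z - 1) / 2)) * sphere_Z k N q =
             \<i> powr (z * (z - 1) / 2) * q powr (- (z * (z\<^sup>2 - 1) / 12)) * z powr (- (1 / 2)) *
             (Ln q / (2 * of_real pi * \<i>)) powr ((z - 1) / 2) * quantum_Barnes q (z + 1))"
  using conifold_Barnes sphere_Barnes by blast

end
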